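(* Let $k$ be a perfect field with algebraic closure $\overline{k}$, let $n\geq 2$ and $d\geq 4$ with $(n,d)\neq(3,4)$, and let $V/k:F_V(X_0,\ldots,X_n)=0$ be a smooth hypersurface over $k$ of degree $d$, with $F_V\in k[X_0,\ldots,X_n]$. Assume that $\operatorname{Aut}(V\otimes_k\overline{k})\subseteq\operatorname{PGL}_{n+1}(\overline{k})$ (the automorphisms of the hypersurface $F_V=0$ over $\overline{k}$, all induced by projective linear maps) is a non-trivial cyclic group of order $m$, with $m$ coprime to the characteristic of $k$, generated by $\psi=\operatorname{diag}(1,\zeta_m^{a_1},\ldots,\zeta_m^{a_n})$ for some $a_i\in\mathbb{N}$, where $\zeta_m\in\overline{k}$ is a fixed primitive $m$-th root of unity. Then every twist of $V$ over $k$ is diagonal; more precisely, every twist of $V$ over $k$ is $k$-isomorphic to a non-singular hypersurface $F_V(D(X_0,\ldots,X_n))=0$ with $F_V(D(X_0,\ldots,X_n))\in k[X_0,\ldots,X_n]$ for some diagonal matrix $D\in\operatorname{PGL}_{n+1}(\overline{k})$. In particular, the map $\Sigma:\operatorname{H}^1(\operatorname{Gal}(\overline{k}/k),\operatorname{Aut}(V\otimes_k\overline{k}))\to\operatorname{H}^1(\operatorname{Gal}(\overline{k}/k),\operatorname{PGL}_{n+1}(\overline{k}))$ induced by the inclusion $\operatorname{Aut}(V\otimes_k\overline{k})\subseteq\operatorname{PGL}_{n+1}(\overline{k})$ is trivial.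
   Context: A smooth hypersurface over $k$ is a smooth projective variety $k$-isomorphic to a non-singular hypersurface in $\mathbb{P}^n_k$ given by a homogeneous polynomial with coefficients in $k$. A twist of $V$ over $k$ is a variety over $k$ that is $\overline{k}$-isomorphic to $V$. A twist $V'$ of $V$ over $k$ is called diagonal if there exist $M\in\operatorname{PGL}_{n+1}(k)$ and a diagonal matrix $D\in\operatorname{PGL}_{n+1}(\overline{k})$ such that $V'$ is $k$-isomorphic to $F_V(MD(X_0,\ldots,X_n))=0$, where $F_V(MD(X_0,\ldots,X_n))\in k[X_0,\ldots,X_n]$. $\Sigma$ being trivial means its image is the class of the trivial Brauer–Severi variety $\mathbb{P}^n_k$. *)

theory Defs
  imports
    "HOL-Library.Poly_Mapping"
    "HOL-Library.FuncSet"
    "HOL-Computational_Algebra.Polynomial"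
    "HOL-Algebra.Coset"
    "HOL-Algebra.Generated_Groups"
    "HOL-Algebra.Algebraic_Closure_Type"
    "Jordan_Normal_Form.Matrix"
begin

section \<open>The base field\<close>

text \<open>
  The field \<open>k\<close> is a type \<open>'k :: field\<close>, its algebraic closure is the type
  \<open>'k alg_closure\<close>, and \<open>k\<close> is identified with its image under \<open>to_ac\<close>.
\<close>

abbreviation base_field :: "'k::field alg_closure set" where
  "base_field \<equiv> range to_ac"

text \<open>
  Perfect: every irreducible polynomial over \<open>k\<close> is separable, i.e. has only simple roots
  in the algebraic closure.
\<close>

definition perfect :: "'k::field itself \<Rightarrow> bool" where
  "perfect _ \<longleftrightarrow> (\<forall>p :: 'k poly. irreducible p \<longrightarrow> rsquarefree (map_poly to_ac p))"

text \<open>\<open>char_coprime TYPE('k) m\<close>: no condition in characteristic 0, where \<open>CHAR('k) = 0\<close>.\<close>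

definition char_coprime :: "'k::field itself \<Rightarrow> nat \<Rightarrow> bool" where
  "char_coprime _ m \<longleftrightarrow> CHAR('k) = 0 \<or> coprime m CHAR('k)"

definition primitive_root_of_unity :: "nat \<Rightarrow> 'a::field \<Rightarrow> bool" where
  "primitive_root_of_unity m z \<longleftrightarrow> m > 0 \<and> z ^ m = 1 \<and> (\<forall>j. 0 < j \<and> j < m \<longrightarrow> z ^ j \<noteq> 1)"


section \<open>Polynomials in several variables\<close>

text \<open>
  A polynomial in the variables \<open>X\<^sub>0, X\<^sub>1, \<dots>\<close> is a finitely supported function from
  monomials (exponent vectors) to coefficients. Multiplication is the convolution product of
  \<^theory>\<open>HOL-Library.Poly_Mapping\<close>.
\<close>

type_synonym 'a mpoly = "(nat \<Rightarrow>\<^sub>0 nat) \<Rightarrow>\<^sub>0 'a"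

definition mpoly_const :: "'a \<Rightarrow> 'a::zero mpoly" where
  "mpoly_const c = Poly_Mapping.single 0 c"

definition mpoly_var :: "nat \<Rightarrow> 'a::zero_neq_one mpoly" where
  "mpoly_var i = Poly_Mapping.single (Poly_Mapping.single i 1) 1"

definition coeffs_in :: "'a set \<Rightarrow> 'a::zero mpoly \<Rightarrow> bool" where
  "coeffs_in K F \<longleftrightarrow> (\<forall>e. Poly_Mapping.lookup F e \<in> K)"

text \<open>
  Homogeneous of degree \<open>d\<close> in the variables \<open>X\<^sub>0, \<dots>, X\<^sub>n\<close>; the zero polynomial is
  homogeneous of every degree.
\<close>

definition homogeneous :: "nat \<Rightarrow> nat \<Rightarrow> 'a::zero mpoly \<Rightarrow> bool" where
  "homogeneous n d F \<longleftrightarrow>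
     (\<forall>e\<in>Poly_Mapping.keys F. Poly_Mapping.keys e \<subseteq> {..n} \<and>
        (\<Sum>i\<in>Poly_Mapping.keys e. Poly_Mapping.lookup e i) = d)"

definition mpoly_eval :: "'a::comm_semiring_1 mpoly \<Rightarrow> 'a vec \<Rightarrow> 'a" where
  "mpoly_eval F v =
     (\<Sum>e\<in>Poly_Mapping.keys F. Poly_Mapping.lookup F e *
        (\<Prod>i\<in>Poly_Mapping.keys e. (v $ i) ^ Poly_Mapping.lookup e i))"

definition mpoly_deriv :: "nat \<Rightarrow> 'a::comm_semiring_1 mpoly \<Rightarrow> 'a mpoly" where
  "mpoly_deriv i F =
     (\<Sum>e\<in>Poly_Mapping.keys F. Poly_Mapping.single (e - Poly_Mapping.single i 1)
        (of_nat (Poly_Mapping.lookup e i) * Poly_Mapping.lookup F e))"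

text \<open>\<open>lin_subst A F\<close> is the polynomial \<open>F(A(X\<^sub>0, \<dots>, X\<^sub>n))\<close>.\<close>

definition lin_subst :: "'a::comm_ring_1 mat \<Rightarrow> 'a mpoly \<Rightarrow> 'a mpoly" where
  "lin_subst A F =
     (\<Sum>e\<in>Poly_Mapping.keys F. mpoly_const (Poly_Mapping.lookup F e) *
        (\<Prod>i\<in>Poly_Mapping.keys e.
           (\<Sum>j<dim_col A. mpoly_const (A $$ (i, j)) * mpoly_var j) ^ Poly_Mapping.lookup e i))"


section \<open>Projective varieties\<close>

text \<open>
  A point of \<open>\<PP>\<^sup>n\<close> over an algebraically closed field is represented by the set of its
  homogeneous coordinate vectors.
\<close>

definition proj_pt :: "'a::field vec \<Rightarrow> 'a vec set" where
  "proj_pt v = {c \<cdot>\<^sub>v v | c. c \<noteq> 0}"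

definition coord_vecs :: "nat \<Rightarrow> 'a::field vec set" where
  "coord_vecs n = carrier_vec (Suc n) - {0\<^sub>v (Suc n)}"

definition proj_zeros :: "nat \<Rightarrow> 'a::field mpoly set \<Rightarrow> 'a vec set set" where
  "proj_zeros n S = {proj_pt v | v. v \<in> coord_vecs n \<and> (\<forall>f\<in>S. mpoly_eval f v = 0)}"

text \<open>Zariski closed subsets of \<open>\<PP>\<^sup>n\<close> defined by forms with coefficients in \<open>K\<close>.\<close>

definition zariski_closed :: "'a::field set \<Rightarrow> nat \<Rightarrow> 'a vec set set \<Rightarrow> bool" where
  "zariski_closed K n W \<longleftrightarrow>
     (\<exists>S. (\<forall>f\<in>S. coeffs_in K f \<and> (\<exists>e. homogeneous n e f)) \<and> W = proj_zeros n S)"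

text \<open>
  Classical (geometrically irreducible) projective varieties over a perfect subfield \<open>K\<close> of
  the algebraically closed field \<open>'a\<close>, given by their geometric points. As \<open>K\<close> is perfect,
  the zero set of forms over \<open>K\<close> has its homogeneous ideal generated by forms over \<open>K\<close>.
\<close>

definition proj_variety :: "'a::alg_closed_field set \<Rightarrow> nat \<Rightarrow> 'a vec set set \<Rightarrow> bool" where
  "proj_variety K n W \<longleftrightarrow>
     zariski_closed K n W \<and> W \<noteq> {} \<and>
     (\<forall>Y Z. zariski_closed UNIV n Y \<and> zariski_closed UNIV n Z \<and> W = Y \<union> Z
        \<longrightarrow> W = Y \<or> W = Z)"

text \<open>
  Morphisms defined over \<open>K\<close>. Around every point, \<open>f = [G\<^sub>0 : \<dots> : G\<^sub>n\<^sub>']\<close> for forms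
  \<open>G\<^sub>i\<close> of equal degree over \<open>K\<close>, on the open neighbourhood where the \<open>G\<^sub>i\<close> do not all
  vanish. (A representation valid on a smaller neighbourhood can be multiplied by a form over
  \<open>K\<close> that vanishes outside of it but not at the point, so this is no restriction.)
\<close>

definition morphism ::
    "'a::field set \<Rightarrow> nat \<Rightarrow> 'a vec set set \<Rightarrow> nat \<Rightarrow> 'a vec set set
       \<Rightarrow> ('a vec set \<Rightarrow> 'a vec set) \<Rightarrow> bool" where
  "morphism K n W n' W' f \<longleftrightarrow>
     f ` W \<subseteq> W' \<and>
     (\<forall>v\<in>coord_vecs n. proj_pt v \<in> W \<longrightarrow>
        (\<exists>e G. (\<forall>i\<le>n'. homogeneous n e (G i) \<and> coeffs_in K (G i)) \<and>
           (\<exists>i\<le>n'. mpoly_eval (G i) v \<noteq> 0) \<and>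
           (\<forall>w\<in>coord_vecs n. proj_pt w \<in> W \<and> (\<exists>i\<le>n'. mpoly_eval (G i) w \<noteq> 0) \<longrightarrow>
              f (proj_pt w) = proj_pt (vec (Suc n') (\<lambda>i. mpoly_eval (G i) w)))))"

definition isomorphism ::
    "'a::field set \<Rightarrow> nat \<Rightarrow> 'a vec set set \<Rightarrow> nat \<Rightarrow> 'a vec set set
       \<Rightarrow> ('a vec set \<Rightarrow> 'a vec set) \<Rightarrow> bool" where
  "isomorphism K n W n' W' f \<longleftrightarrow>
     morphism K n W n' W' f \<and>
     (\<exists>g. morphism K n' W' n W g \<and> (\<forall>P\<in>W. g (f P) = P) \<and> (\<forall>Q\<in>W'. f (g Q) = Q))"

definition isomorphic ::
    "'a::field set \<Rightarrow> nat \<Rightarrow> 'a vec set set \<Rightarrow> nat \<Rightarrow> 'a vec set set \<Rightarrow> bool" where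
  "isomorphic K n W n' W' \<longleftrightarrow> (\<exists>f. isomorphism K n W n' W' f)"

definition hypersurface :: "nat \<Rightarrow> 'a::field mpoly \<Rightarrow> 'a vec set set" where
  "hypersurface n F = proj_zeros n {F}"

definition nonsingular :: "nat \<Rightarrow> 'a::alg_closed_field mpoly \<Rightarrow> bool" where
  "nonsingular n F \<longleftrightarrow>
     (\<forall>v\<in>coord_vecs n. mpoly_eval F v = 0 \<longrightarrow> (\<exists>i\<le>n. mpoly_eval (mpoly_deriv i F) v \<noteq> 0))"

text \<open>\<open>W \<subseteq> \<PP>\<^sup>N\<close> is a twist over \<open>k\<close> of \<open>V \<subseteq> \<PP>\<^sup>n\<close>.\<close>

definition is_twist ::
    "nat \<Rightarrow> 'k::field alg_closure vec set set \<Rightarrow> nat \<Rightarrow> 'k alg_closure vec set set \<Rightarrow> bool" where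
  "is_twist n V N W \<longleftrightarrow> proj_variety base_field N W \<and> isomorphic UNIV N W n V"

text \<open>
  The projective classes of \<open>M\<close> and \<open>D\<close> are given by matrices; the choice of \<open>D\<close> within its
  class accounts for the fact that \<open>F(MD(X))\<close> is only determined up to a scalar.
\<close>

definition is_diagonal_twist ::
    "nat \<Rightarrow> 'k::field alg_closure mpoly \<Rightarrow> nat \<Rightarrow> 'k alg_closure vec set set \<Rightarrow> bool" where
  "is_diagonal_twist n F N W \<longleftrightarrow>
     is_twist n (hypersurface n F) N W \<and>
     (\<exists>M :: 'k mat. \<exists>D :: 'k alg_closure mat.
        M \<in> carrier_mat (Suc n) (Suc n) \<and> invertible_mat M \<and>
        D \<in> carrier_mat (Suc n) (Suc n) \<and> invertible_mat D \<and> diagonal_mat D \<and>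
        coeffs_in base_field (lin_subst (map_mat to_ac M * D) F) \<and>
        isomorphic base_field N W n (hypersurface n (lin_subst (map_mat to_ac M * D) F)))"


section \<open>Projective linear groups\<close>

text \<open>\<open>GL n\<close> and \<open>PGL n\<close> consist of matrices of size \<open>n + 1\<close> and act on \<open>\<PP>\<^sup>n\<close>.\<close>

definition GL :: "nat \<Rightarrow> 'a::field mat monoid" where
  "GL n = units_of (ring_mat TYPE('a) (Suc n) ())"

definition scalar_mats :: "nat \<Rightarrow> 'a::field mat set" where
  "scalar_mats n = {c \<cdot>\<^sub>m 1\<^sub>m (Suc n) | c. c \<noteq> 0}"

definition PGL :: "nat \<Rightarrow> 'a::field mat set monoid" where
  "PGL n = GL n Mod scalar_mats n"

definition pgl_class :: "nat \<Rightarrow> 'a::field mat \<Rightarrow> 'a mat set" where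
  "pgl_class n A = scalar_mats n #>\<^bsub>GL n\<^esub> A"

definition pgl_apply :: "'a::field mat set \<Rightarrow> 'a vec set \<Rightarrow> 'a vec set" where
  "pgl_apply g P = {A *\<^sub>v v | A v. A \<in> g \<and> v \<in> P}"

text \<open>
  \<open>Aut_PGL n V\<close> is the group of automorphisms of \<open>V \<subseteq> \<PP>\<^sup>n\<close> over the algebraically closed
  field that are induced by elements of \<open>PGL n\<close>; \<open>Aut_subset_PGL n V\<close> says that
  all automorphisms of the variety \<open>V\<close> are of this form.
\<close>

definition Aut_PGL :: "nat \<Rightarrow> 'a::alg_closed_field vec set set \<Rightarrow> 'a mat set monoid" where
  "Aut_PGL n V = (PGL n)\<lparr>carrier := {g \<in> carrier (PGL n). isomorphism UNIV n V n V (pgl_apply g)}\<rparr>"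

definition Aut_subset_PGL :: "nat \<Rightarrow> 'a::alg_closed_field vec set set \<Rightarrow> bool" where
  "Aut_subset_PGL n V \<longleftrightarrow>
     (\<forall>f. isomorphism UNIV n V n V f \<longrightarrow> (\<exists>g\<in>carrier (Aut_PGL n V). \<forall>P\<in>V. f P = pgl_apply g P))"


section \<open>Galois cohomology\<close>

definition Gal :: "('k::field alg_closure \<Rightarrow> 'k alg_closure) monoid" where
  "Gal = \<lparr>carrier = {\<sigma>. bij \<sigma> \<and> (\<forall>x y. \<sigma> (x + y) = \<sigma> x + \<sigma> y) \<and> (\<forall>x y. \<sigma> (x * y) = \<sigma> x * \<sigma> y)
                        \<and> (\<forall>c. \<sigma> (to_ac c) = to_ac c)},
          monoid.mult = (\<circ>), one = id\<rparr>"

definition gal_pgl :: "('k::field alg_closure \<Rightarrow> 'k alg_closure)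
    \<Rightarrow> 'k alg_closure mat set \<Rightarrow> 'k alg_closure mat set" where
  "gal_pgl \<sigma> g = map_mat \<sigma> ` g"

text \<open>
  Continuity for the Krull topology on the Galois group and the discrete topology on the
  target: a basic open neighbourhood of \<open>\<sigma>\<close> consists of those \<open>\<tau>\<close> that agree with \<open>\<sigma>\<close> on a
  finite set.
\<close>

definition krull_continuous :: "(('k::field alg_closure \<Rightarrow> 'k alg_closure) \<Rightarrow> 'g) \<Rightarrow> bool" where
  "krull_continuous \<xi> \<longleftrightarrow>
     (\<forall>\<sigma>\<in>carrier Gal. \<exists>S. finite S \<and>
        (\<forall>\<tau>\<in>carrier Gal. (\<forall>x\<in>S. \<tau> x = \<sigma> x) \<longrightarrow> \<xi> \<tau> = \<xi> \<sigma>))"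

text \<open>
  Non-abelian cohomology of the Galois group with values in a group \<open>A\<close> on which it acts by
  \<open>act\<close>.
\<close>

definition Z1 :: "('g, 'x) monoid_scheme \<Rightarrow> (('k::field alg_closure \<Rightarrow> 'k alg_closure) \<Rightarrow> 'g \<Rightarrow> 'g)
    \<Rightarrow> (('k alg_closure \<Rightarrow> 'k alg_closure) \<Rightarrow> 'g) set" where
  "Z1 A act =
     {\<xi> \<in> carrier Gal \<rightarrow>\<^sub>E carrier A. krull_continuous \<xi> \<and>
        (\<forall>\<sigma>\<in>carrier Gal. \<forall>\<tau>\<in>carrier Gal. \<xi> (\<sigma> \<circ> \<tau>) = \<xi> \<sigma> \<otimes>\<^bsub>A\<^esub> act \<sigma> (\<xi> \<tau>))}"

definition cohomologous :: "('g, 'x) monoid_scheme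
    \<Rightarrow> (('k::field alg_closure \<Rightarrow> 'k alg_closure) \<Rightarrow> 'g \<Rightarrow> 'g)
    \<Rightarrow> (('k alg_closure \<Rightarrow> 'k alg_closure) \<Rightarrow> 'g) rel" where
  "cohomologous A act =
     {(\<xi>, \<eta>). \<xi> \<in> Z1 A act \<and> \<eta> \<in> Z1 A act \<and>
        (\<exists>b\<in>carrier A. \<forall>\<sigma>\<in>carrier Gal. \<eta> \<sigma> = inv\<^bsub>A\<^esub> b \<otimes>\<^bsub>A\<^esub> \<xi> \<sigma> \<otimes>\<^bsub>A\<^esub> act \<sigma> b)}"

definition H1 :: "('g, 'x) monoid_scheme \<Rightarrow> (('k::field alg_closure \<Rightarrow> 'k alg_closure) \<Rightarrow> 'g \<Rightarrow> 'g)
    \<Rightarrow> (('k alg_closure \<Rightarrow> 'k alg_closure) \<Rightarrow> 'g) set set" where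
  "H1 A act = Z1 A act // cohomologous A act"

text \<open>
  The class of the constant cocycle. In \<open>H1 (PGL n) gal_pgl\<close>, it is the class of the trivial
  Brauer-Severi variety \<open>\<PP>\<^sup>n\<close>.
\<close>

definition H1_trivial :: "('g, 'x) monoid_scheme
    \<Rightarrow> (('k::field alg_closure \<Rightarrow> 'k alg_closure) \<Rightarrow> 'g \<Rightarrow> 'g)
    \<Rightarrow> (('k alg_closure \<Rightarrow> 'k alg_closure) \<Rightarrow> 'g) set" where
  "H1_trivial A act = cohomologous A act `` {\<lambda>\<sigma>\<in>carrier Gal. \<one>\<^bsub>A\<^esub>}"

text \<open>
  The map \<open>\<Sigma>\<close> induced by the inclusion of \<open>Aut_PGL n V\<close> into \<open>PGL n\<close>: a cocycle with values
  in the subgroup is sent to its class as a cocycle with values in \<open>PGL n\<close>.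
\<close>

definition Sigma_map :: "nat
    \<Rightarrow> (('k::field alg_closure \<Rightarrow> 'k alg_closure) \<Rightarrow> 'k alg_closure mat set) set
    \<Rightarrow> (('k alg_closure \<Rightarrow> 'k alg_closure) \<Rightarrow> 'k alg_closure mat set) set" where
  "Sigma_map n c = cohomologous (PGL n) gal_pgl `` c"

end

theory Submission
  imports Defs "Jordan_Normal_Form.Char_Poly"
begin

text \<open>
  Let \<open>\<phi> : W \<rightarrow> V\<close> be an isomorphism over the algebraic closure. The maps
  \<open>\<xi>\<^sub>\<sigma> = \<phi> \<circ> \<sigma> \<circ> \<phi>\<^sup>-\<^sup>1 \<circ> \<sigma>\<^sup>-\<^sup>1\<close> are automorphisms of \<open>V\<close>, hence diagonal. Normalised by a leading entry \<open>1\<close>,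
  their entries are determined by \<open>\<xi>\<^sub>\<sigma>\<close>, as a non-trivial diagonal map moves some point of \<open>V\<close>. So the entries
  are cocycles with values in the multiplicative group, and Hilbert's Theorem 90 provides a diagonal \<open>D\<close>
  such that \<open>D\<^sup>-\<^sup>1 \<circ> \<phi>\<close> commutes with the Galois group, i.e. is defined over \<open>k\<close>. The form \<open>F \<circ> D\<close> is
  proportional to its conjugates, because a form that vanishes on a smooth hypersurface of the same
  degree is a multiple of its equation; rescaling \<open>D\<close> moves its coefficients into \<open>k\<close>. Applied
  to abstract cocycles, Theorem 90 also trivialises \<open>\<Sigma>\<close>.
\<close>

section \<open>Evaluation of polynomials in several variables\<close>

text \<open>Lifting a cocycle from PGL to GL meets in general an obstruction in the Brauer group. An
  invertible diagonal class has exactly one representative with leading entry 1, and Galois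
  conjugation preserves this normalisation; hence the lift is again a cocycle and each entry can be
  treated by itself. The entries may well be moved by the Galois group, as roots of unity are: only
  the cocycle relation counts.

  For a twist, the cocycle is known only through its action on the points of V. Equality of entries
  and continuity both have to be read off from points. For the former, V must not lie in a pair of
  coordinate hyperplanes. For the latter, only finitely many values occur, and each non-trivial one
  is excluded by a single moved point and the finitely many coordinates of that point and of its
  image in W.

  The twisted equation is compared with its conjugates through its zeros alone. The instance of the
  Nullstellensatz behind this comparison is derived directly from smoothness, by division along
  parallel lines.

  Perfectness enters through the fixed field of the Galois group, whose automorphisms are produced
  by extending embeddings of subrings.\<close>

definition monom_eval :: "(nat \<Rightarrow> 'b::comm_semiring_1) \<Rightarrow> (nat \<Rightarrow>\<^sub>0 nat) \<Rightarrow> 'b" where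
  "monom_eval x e = (\<Prod>i\<in>Poly_Mapping.keys e. x i ^ Poly_Mapping.lookup e i)"

text \<open>The coefficient map is a parameter, so that numerical evaluation, linear substitution
  and restriction to a line are all instances, and \<open>hom_meval\<close> relates them to each
  other.\<close>

definition meval :: "('a::zero \<Rightarrow> 'b::comm_semiring_1) \<Rightarrow> (nat \<Rightarrow> 'b) \<Rightarrow> 'a mpoly \<Rightarrow> 'b" where
  "meval \<phi> x F = (\<Sum>e\<in>Poly_Mapping.keys F. \<phi> (Poly_Mapping.lookup F e) * monom_eval x e)"

lemma monom_eval_superset:
  assumes "finite A" "Poly_Mapping.keys e \<subseteq> A"
  shows "monom_eval x e = (\<Prod>i\<in>A. x i ^ Poly_Mapping.lookup e i)"
  unfolding monom_eval_def using assms
  by (intro prod.mono_neutral_left) (auto simp: in_keys_iff)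

lemma monom_eval_0 [simp]: "monom_eval x 0 = 1"
  by (simp add: monom_eval_def)

lemma monom_eval_single [simp]: "monom_eval x (Poly_Mapping.single i k) = x i ^ k"
  by (simp add: monom_eval_def)

lemma monom_eval_add: "monom_eval x (e + e') = monom_eval x e * monom_eval x e'"
proof -
  let ?A = "Poly_Mapping.keys e \<union> Poly_Mapping.keys e'"
  have "monom_eval x (e + e') = (\<Prod>i\<in>?A. x i ^ Poly_Mapping.lookup (e + e') i)"
    by (rule monom_eval_superset) (auto simp: keys_add)
  also have "\<dots> = (\<Prod>i\<in>?A. x i ^ Poly_Mapping.lookup e i) * (\<Prod>i\<in>?A. x i ^ Poly_Mapping.lookup e' i)"
    by (simp add: lookup_add power_add prod.distrib)
  also have "\<dots> = monom_eval x e * monom_eval x e'"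
    using monom_eval_superset[of ?A e x] monom_eval_superset[of ?A e' x] by simp
  finally show ?thesis .
qed

lemma monom_eval_mult: "monom_eval (\<lambda>i. x i * y i) e = monom_eval x e * monom_eval y e"
  by (simp add: monom_eval_def power_mult_distrib prod.distrib)

lemma poly_mapping_sum_singles:
  "F = (\<Sum>e\<in>Poly_Mapping.keys F. Poly_Mapping.single e (Poly_Mapping.lookup F e))"
  by (rule poly_mapping_eqI)
    (auto simp: lookup_sum lookup_single when_def in_keys_iff)

context comm_ring_hom
begin

lemma monom_eval_hom: "hom (monom_eval x e) = monom_eval (\<lambda>i. hom (x i)) e"
  by (simp add: monom_eval_def hom_prod hom_power)

lemma meval_superset:
  assumes "finite A" "Poly_Mapping.keys F \<subseteq> A"
  shows "meval hom x F = (\<Sum>e\<in>A. hom (Poly_Mapping.lookup F e) * monom_eval x e)"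
  unfolding meval_def using assms
  by (intro sum.mono_neutral_left) (auto simp: in_keys_iff)

lemma meval_0 [simp]: "meval hom x 0 = 0"
  by (simp add: meval_def)

lemma meval_single [simp]: "meval hom x (Poly_Mapping.single e c) = hom c * monom_eval x e"
  by (cases "c = 0") (auto simp: meval_def)

lemma meval_1 [simp]: "meval hom x 1 = 1"
  by (metis hom_one meval_single monom_eval_0 mult_1 single_one)

lemma meval_const [simp]: "meval hom x (mpoly_const c) = hom c"
  by (simp add: mpoly_const_def)

lemma meval_var [simp]: "meval hom x (mpoly_var i) = x i"
  by (simp add: mpoly_var_def)

lemma meval_add [simp]: "meval hom x (F + G) = meval hom x F + meval hom x G"
proof -
  let ?A = "Poly_Mapping.keys F \<union> Poly_Mapping.keys G"
  have "meval hom x (F + G) = (\<Sum>e\<in>?A. hom (Poly_Mapping.lookup (F + G) e) * monom_eval x e)"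
    by (rule meval_superset) (auto simp: keys_add)
  also have "\<dots> = meval hom x F + meval hom x G"
    using meval_superset[of ?A F x] meval_superset[of ?A G x]
    by (simp add: lookup_add hom_add distrib_right sum.distrib)
  finally show ?thesis .
qed

lemma meval_sum: "meval hom x (sum f A) = (\<Sum>a\<in>A. meval hom x (f a))"
  by (induction A rule: infinite_finite_induct) auto

lemma meval_mult [simp]: "meval hom x (F * G) = meval hom x F * meval hom x G"
proof -
  have "F * G = (\<Sum>e\<in>Poly_Mapping.keys F. \<Sum>e'\<in>Poly_Mapping.keys G.
      Poly_Mapping.single (e + e') (Poly_Mapping.lookup F e * Poly_Mapping.lookup G e'))"
    by (subst (1) poly_mapping_sum_singles[of F], subst (1) poly_mapping_sum_singles[of G])
      (simp add: sum_product mult_single)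
  hence "meval hom x (F * G) = (\<Sum>e\<in>Poly_Mapping.keys F. \<Sum>e'\<in>Poly_Mapping.keys G.
      hom (Poly_Mapping.lookup F e) * monom_eval x e * (hom (Poly_Mapping.lookup G e') * monom_eval x e'))"
    by (simp add: meval_sum monom_eval_add hom_mult mult_ac)
  thus ?thesis by (simp add: meval_def sum_product)
qed

lemma comm_ring_hom_meval: "comm_ring_hom (meval hom x)"
  by unfold_locales auto

end

lemma hom_meval:
  assumes "comm_ring_hom h"
  shows "h (meval \<phi> x F) = meval (\<lambda>c. h (\<phi> c)) (\<lambda>i. h (x i)) F"
proof -
  interpret comm_ring_hom h by fact
  show ?thesis by (simp add: meval_def hom_sum hom_mult monom_eval_hom)
qed

lemma comm_ring_hom_mpoly_const: "comm_ring_hom (mpoly_const :: 'a::comm_ring_1 \<Rightarrow> 'a mpoly)"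
  by unfold_locales (auto simp: mpoly_const_def single_add mult_single)

lemma monom_eval_var:
  "monom_eval mpoly_var e = (Poly_Mapping.single e 1 :: 'a::comm_ring_1 mpoly)"
proof -
  have pw: "(mpoly_var i :: 'a mpoly) ^ k = Poly_Mapping.single (Poly_Mapping.single i k) 1" for i k
    by (induction k) (auto simp: mpoly_var_def mult_single simp flip: single_add)
  have "(\<Prod>i\<in>A. mpoly_var i ^ f i) = (Poly_Mapping.single (\<Sum>i\<in>A. Poly_Mapping.single i (f i)) 1 :: 'a mpoly)"
    for A f by (induction A rule: infinite_finite_induct) (auto simp: pw mult_single)
  thus ?thesis unfolding monom_eval_def using poly_mapping_sum_singles[of e] by simp
qed

lemma meval_mpoly_const_var [simp]: "meval mpoly_const mpoly_var F = (F :: 'a::comm_ring_1 mpoly)"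
  using poly_mapping_sum_singles[of F]
  by (simp add: meval_def monom_eval_var mpoly_const_def mult_single)

lemma mpoly_eval_conv_meval: "mpoly_eval F v = meval (\<lambda>c. c) (\<lambda>i. v $ i) F"
  by (simp add: mpoly_eval_def meval_def monom_eval_def)

lemma lin_subst_conv_meval:
  "lin_subst A F = meval mpoly_const (\<lambda>i. \<Sum>j<dim_col A. mpoly_const (A $$ (i, j)) * mpoly_var j) F"
  by (simp add: lin_subst_def meval_def monom_eval_def)

lemma comm_ring_hom_ident: "comm_ring_hom (\<lambda>c::'a::comm_ring_1. c)"
  by unfold_locales auto

lemma comm_ring_hom_pCons: "comm_ring_hom (\<lambda>c::'a::comm_ring_1. [:c:])"
  by unfold_locales auto

lemma comm_ring_hom_poly: "comm_ring_hom (\<lambda>p. poly p (x :: 'a::comm_ring_1))"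
  by unfold_locales auto

lemmas meval_id = comm_ring_hom.meval_add[OF comm_ring_hom_ident]
  comm_ring_hom.meval_mult[OF comm_ring_hom_ident] comm_ring_hom.meval_0[OF comm_ring_hom_ident]
  comm_ring_hom.meval_const[OF comm_ring_hom_ident] comm_ring_hom.meval_var[OF comm_ring_hom_ident]
  comm_ring_hom.meval_single[OF comm_ring_hom_ident] comm_ring_hom.meval_1[OF comm_ring_hom_ident]

lemma meval_homogeneous_cong:
  assumes "homogeneous n d F" "\<And>i. i \<le> n \<Longrightarrow> x i = y i"
  shows "meval \<phi> x F = meval \<phi> y F"
  unfolding meval_def monom_eval_def
  using assms by (intro sum.cong refl arg_cong2[where f="(*)"] prod.cong) (force simp: homogeneous_def)+

lemma monom_eval_smult_deg:
  "monom_eval (\<lambda>i. c * x i) e = c ^ (\<Sum>i\<in>Poly_Mapping.keys e. Poly_Mapping.lookup e i) * monom_eval x e"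
  by (simp add: monom_eval_mult) (simp add: monom_eval_def power_sum)

lemma meval_homogeneous_smult:
  assumes "homogeneous n d F"
  shows "meval \<phi> (\<lambda>i. c * x i) F = c ^ d * meval \<phi> x F"
  unfolding meval_def sum_distrib_left
  using assms by (intro sum.cong refl) (auto simp: homogeneous_def monom_eval_smult_deg mult_ac)

lemma mpoly_eval_smult_vec:
  assumes "homogeneous n d F" "v \<in> carrier_vec (Suc n)"
  shows "mpoly_eval F (c \<cdot>\<^sub>v v) = c ^ d * mpoly_eval F v"
proof -
  have "meval (\<lambda>c. c) (\<lambda>i. (c \<cdot>\<^sub>v v) $ i) F = meval (\<lambda>c. c) (\<lambda>i. c * v $ i) F"
    using assms by (intro meval_homogeneous_cong[OF assms(1)]) auto
  thus ?thesis using meval_homogeneous_smult[OF assms(1)] by (simp add: mpoly_eval_conv_meval)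
qed

section \<open>Non-vanishing of polynomials over infinite domains\<close>

lemma infinite_alg_closed: "infinite (UNIV :: 'a::alg_closed_field set)"
proof
  assume fin: "finite (UNIV :: 'a set)"
  \<comment> \<open>Over a finite field, \<open>q + 1\<close> would take the value 1 everywhere
    although its degree is positive.\<close>
  define q :: "'a poly" where "q = (\<Prod>a\<in>UNIV. [:- a, 1:])"
  have dq: "degree q = card (UNIV :: 'a set)"
    unfolding q_def by (subst degree_prod_eq_sum_degree) auto
  moreover have "card (UNIV :: 'a set) > 0" using fin by (simp add: card_gt_0_iff)
  ultimately have "degree (q + 1) > 0" using degree_add_eq_left[of 1 q] by simp
  then obtain x where x: "poly (q + 1) x = 0" using alg_closed_imp_poly_has_root by blast
  have "poly q x = 0" unfolding q_def poly_prod using fin by (auto intro!: prod_zero)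
  with x show False by simp
qed

text \<open>Kronecker substitution with weights \<open>b ^ i\<close>. An exponent vector is read as
  an integer polynomial whose value at b is the weighted degree; b only has to avoid the finitely
  many roots of the pairwise differences.\<close>

lemma exists_separating_weights:
  fixes E :: "(nat \<Rightarrow>\<^sub>0 nat) set"
  assumes "finite E"
  obtains w :: "nat \<Rightarrow> nat" where
    "inj_on (\<lambda>e. \<Sum>i\<in>Poly_Mapping.keys e. Poly_Mapping.lookup e i * w i) E"
proof -
  define p where "p e = (\<Sum>i\<in>Poly_Mapping.keys e. monom (int (Poly_Mapping.lookup e i)) i)" for e :: "nat \<Rightarrow>\<^sub>0 nat"
  have cp: "coeff (p e) i = int (Poly_Mapping.lookup e i)" for e i
    unfolding p_def coeff_sum coeff_monom by (auto simp: in_keys_iff)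
  have pne: "p e - p e' \<noteq> 0" if "e \<noteq> e'" for e e'
  proof
    assume "p e - p e' = 0"
    hence "coeff (p e) i = coeff (p e') i" for i by simp
    hence "e = e'" by (intro poly_mapping_eqI) (simp add: cp)
    with that show False by simp
  qed
  define B where "B = (\<Union>(e, e')\<in>{(e, e'). e \<in> E \<and> e' \<in> E \<and> e \<noteq> e'}. {z. poly (p e - p e') z = 0})"
  have "finite {(e, e'). e \<in> E \<and> e' \<in> E \<and> e \<noteq> e'}"
    by (rule finite_subset[of _ "E \<times> E"]) (use assms in auto)
  hence "finite B" unfolding B_def using poly_roots_finite[OF pne] by (auto simp del: poly_diff)
  moreover have "infinite (range int)" by (simp add: finite_image_iff)
  ultimately obtain b where b: "int b \<notin> B"
    using finite_subset[of "range int" B] by blast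
  have "poly (p e) (int b) = int (\<Sum>i\<in>Poly_Mapping.keys e. Poly_Mapping.lookup e i * b ^ i)" for e
    by (simp add: p_def poly_sum poly_monom)
  moreover have "poly (p e) (int b) \<noteq> poly (p e') (int b)" if "e \<in> E" "e' \<in> E" "e \<noteq> e'" for e e'
    using b that unfolding B_def by auto
  ultimately have "inj_on (\<lambda>e. \<Sum>i\<in>Poly_Mapping.keys e. Poly_Mapping.lookup e i * b ^ i) E"
    by (intro inj_onI) (metis of_nat_eq_iff)
  thus ?thesis by (rule that)
qed

text \<open>Substituting powers of one variable with separating weights sends distinct monomials to
  distinct powers. Nothing cancels, and a non-zero polynomial in one variable has only finitely many
  roots.\<close>

lemma mpoly_nonzero_eval:
  fixes F :: "'a::idom mpoly"
  assumes "infinite (UNIV :: 'a set)" "F \<noteq> 0"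
  obtains x where "meval (\<lambda>c. c) x F \<noteq> 0"
proof -
  obtain w where w: "inj_on (\<lambda>e. \<Sum>i\<in>Poly_Mapping.keys e. Poly_Mapping.lookup e i * w i) (Poly_Mapping.keys F)"
    using exists_separating_weights[OF finite_keys] by blast
  define N where "N e = (\<Sum>i\<in>Poly_Mapping.keys e. Poly_Mapping.lookup e i * w i)" for e
  define q where "q = meval (\<lambda>c. [:c:]) (\<lambda>i. monom 1 (w i)) F"
  have "monom_eval (\<lambda>i. monom (1::'a) (w i)) e = monom 1 (N e)" for e
  proof -
    have "(\<Prod>i\<in>A. monom (1::'a) (w i) ^ f i) = monom 1 (\<Sum>i\<in>A. f i * w i)" for A and f :: "nat \<Rightarrow> nat"
      by (induction A rule: infinite_finite_induct) (auto simp: monom_power mult_monom mult.commute)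
    thus ?thesis by (simp add: monom_eval_def N_def)
  qed
  hence q: "q = (\<Sum>e\<in>Poly_Mapping.keys F. monom (Poly_Mapping.lookup F e) (N e))"
    by (simp add: q_def meval_def smult_monom)
  from assms(2) obtain e where e: "e \<in> Poly_Mapping.keys F" using poly_mapping_sum_singles[of F] by force
  have "coeff q (N e) = (\<Sum>e'\<in>Poly_Mapping.keys F. if e' = e then Poly_Mapping.lookup F e' else 0)"
    unfolding q coeff_sum coeff_monom using w e by (intro sum.cong refl) (auto simp: N_def dest: inj_onD)
  also have "\<dots> = Poly_Mapping.lookup F e" using e by simp
  finally have "q \<noteq> 0" using e by (auto simp: in_keys_iff)
  hence "finite {t. poly q t = 0}" by (rule poly_roots_finite)
  hence "{t. poly q t = 0} \<noteq> UNIV" using assms(1) by auto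
  then obtain t where t: "poly q t \<noteq> 0" by auto
  have "poly q t = meval (\<lambda>c. c) (\<lambda>i. poly (monom 1 (w i)) t) F"
    unfolding q_def by (subst hom_meval[OF comm_ring_hom_poly]) simp
  with t that show ?thesis by metis
qed

lemma comm_ring_hom_map_poly: "comm_ring_hom h \<Longrightarrow> comm_ring_hom (map_poly h)"
proof -
  assume "comm_ring_hom h"
  then interpret h: comm_ring_hom h .
  interpret m: map_poly_comm_ring_hom h ..
  show ?thesis by (rule m.comm_ring_hom_axioms)
qed

lemma comm_ring_hom_compose:
  "comm_ring_hom f \<Longrightarrow> comm_ring_hom g \<Longrightarrow> comm_ring_hom (\<lambda>x. f (g x))"
proof -
  assume "comm_ring_hom f" "comm_ring_hom g"
  then interpret f: comm_ring_hom f + g: comm_ring_hom g by simp_all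
  show ?thesis by unfold_locales (auto simp: f.hom_add g.hom_add f.hom_mult g.hom_mult)
qed

section \<open>Expansion of forms along lines\<close>

lemma coeff_mult_le_degree_sum:
  assumes "degree p \<le> m" "degree q \<le> k"
  shows "coeff (p * q) (m + k) = coeff p m * coeff q k"
proof -
  have "coeff (p * q) (m + k) = (\<Sum>i\<le>m + k. if i = m then coeff p m * coeff q k else 0)"
    unfolding coeff_mult
  proof (intro sum.cong refl)
    fix i assume "i \<in> {..m + k}"
    consider "i < m" | "i = m" | "i > m" by linarith
    thus "coeff p i * coeff q (m + k - i) = (if i = m then coeff p m * coeff q k else 0)"
      using assms by cases (auto simp: coeff_eq_0)
  qed
  thus ?thesis by simp
qed

lemma pow_linear_coeff:
  "degree ([:a, b:] ^ k) \<le> k \<and> coeff ([:a, b:] ^ k) k = (b :: 'a::comm_ring_1) ^ k"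
proof (induction k)
  case (Suc k)
  have d: "degree [:a, b:] \<le> 1" by simp
  have "coeff ([:a, b:] * [:a, b:] ^ k) (1 + k) = coeff [:a, b:] 1 * coeff ([:a, b:] ^ k) k"
    by (rule coeff_mult_le_degree_sum) (use Suc in auto)
  moreover have "degree ([:a, b:] * [:a, b:] ^ k) \<le> 1 + k"
    using degree_mult_le[of "[:a, b:]" "[:a, b:] ^ k"] d Suc by linarith
  ultimately show ?case using Suc by (auto simp del: mult_pCons_left)
qed auto

lemma monom_eval_linear_coeff:
  fixes a b :: "nat \<Rightarrow> 'a::comm_ring_1"
  defines "D \<equiv> \<lambda>e :: nat \<Rightarrow>\<^sub>0 nat. \<Sum>i\<in>Poly_Mapping.keys e. Poly_Mapping.lookup e i"
  shows "degree (monom_eval (\<lambda>i. [:a i, b i:]) e) \<le> D e"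
    and "coeff (monom_eval (\<lambda>i. [:a i, b i:]) e) (D e) = monom_eval b e"
proof -
  have "degree (\<Prod>i\<in>S. [:a i, b i:] ^ f i) \<le> (\<Sum>i\<in>S. f i) \<and>
    coeff (\<Prod>i\<in>S. [:a i, b i:] ^ f i) (\<Sum>i\<in>S. f i) = (\<Prod>i\<in>S. b i ^ f i)" for S and f :: "nat \<Rightarrow> nat"
  proof (induction S rule: infinite_finite_induct)
    case (insert j S)
    let ?p = "[:a j, b j:] ^ f j" and ?q = "\<Prod>i\<in>S. [:a i, b i:] ^ f i"
    have "coeff (?p * ?q) (f j + (\<Sum>i\<in>S. f i)) = coeff ?p (f j) * coeff ?q (\<Sum>i\<in>S. f i)"
      by (rule coeff_mult_le_degree_sum) (use insert pow_linear_coeff in auto)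
    moreover have "degree (?p * ?q) \<le> f j + (\<Sum>i\<in>S. f i)"
      using degree_mult_le[of ?p ?q] pow_linear_coeff[of "a j" "b j" "f j"] insert by linarith
    ultimately show ?case using insert pow_linear_coeff[of "a j" "b j" "f j"] by simp
  qed auto
  thus "degree (monom_eval (\<lambda>i. [:a i, b i:]) e) \<le> D e"
    "coeff (monom_eval (\<lambda>i. [:a i, b i:]) e) (D e) = monom_eval b e"
    unfolding monom_eval_def D_def by blast+
qed

text \<open>Every monomial of a form of degree d has d linear factors, and only the choice of the
  slope in each of them reaches the d-th power of the parameter. A direction on which the form does
  not vanish therefore yields exact degree d.\<close>

lemma meval_linear_coeff:
  fixes a b :: "nat \<Rightarrow> 'b::comm_ring_1"
  assumes "homogeneous n d F"
  shows "degree (meval (\<lambda>c. [:\<phi> c:]) (\<lambda>i. [:a i, b i:]) F) \<le> d"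
    and "coeff (meval (\<lambda>c. [:\<phi> c:]) (\<lambda>i. [:a i, b i:]) F) d = meval \<phi> b F"
proof -
  have de: "degree (monom_eval (\<lambda>i. [:a i, b i:]) e) \<le> d"
    "coeff (monom_eval (\<lambda>i. [:a i, b i:]) e) d = monom_eval b e"
    if "e \<in> Poly_Mapping.keys F" for e
    using monom_eval_linear_coeff[of a b e] that assms by (auto simp: homogeneous_def)
  show "degree (meval (\<lambda>c. [:\<phi> c:]) (\<lambda>i. [:a i, b i:]) F) \<le> d"
    unfolding meval_def using de
    by (intro degree_sum_le) (auto intro: order.trans[OF degree_smult_le])
  show "coeff (meval (\<lambda>c. [:\<phi> c:]) (\<lambda>i. [:a i, b i:]) F) d = meval \<phi> b F"
    unfolding meval_def coeff_sum using de by (intro sum.cong) auto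
qed

text \<open>Product rule at parameter 0. Only indices in the support of e occur, so lowering the
  exponent by one is never truncated.\<close>

lemma poly_pderiv_monom_eval:
  fixes v w :: "nat \<Rightarrow> 'a::idom"
  shows "poly (pderiv (monom_eval (\<lambda>i. [:v i, w i:]) e)) 0 =
    (\<Sum>i\<in>Poly_Mapping.keys e. w i * of_nat (Poly_Mapping.lookup e i) *
        monom_eval v (e - Poly_Mapping.single i 1))"
proof -
  have "poly (pderiv (monom_eval (\<lambda>i. [:v i, w i:]) e)) 0 =
    (\<Sum>i\<in>Poly_Mapping.keys e. (\<Prod>j\<in>Poly_Mapping.keys e - {i}. v j ^ Poly_Mapping.lookup e j) *
       (of_nat (Poly_Mapping.lookup e i) * (v i ^ (Poly_Mapping.lookup e i - 1) * w i)))"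
    unfolding monom_eval_def pderiv_prod poly_sum poly_mult poly_prod
    by (simp add: pderiv_power pderiv_pCons mult_ac)
  also have "\<dots> = (\<Sum>i\<in>Poly_Mapping.keys e. w i * of_nat (Poly_Mapping.lookup e i) *
        monom_eval v (e - Poly_Mapping.single i 1))"
  proof (intro sum.cong refl)
    fix i assume i: "i \<in> Poly_Mapping.keys e"
    have "monom_eval v (e - Poly_Mapping.single i 1) =
        (\<Prod>j\<in>Poly_Mapping.keys e. v j ^ Poly_Mapping.lookup (e - Poly_Mapping.single i 1) j)"
      by (rule monom_eval_superset) (auto simp: in_keys_iff lookup_minus)
    also have "\<dots> = v i ^ (Poly_Mapping.lookup e i - 1) *
        (\<Prod>j\<in>Poly_Mapping.keys e - {i}. v j ^ Poly_Mapping.lookup (e - Poly_Mapping.single i 1) j)"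
      using i by (subst prod.remove[of _ i]) (auto simp: lookup_minus)
    also have "(\<Prod>j\<in>Poly_Mapping.keys e - {i}. v j ^ Poly_Mapping.lookup (e - Poly_Mapping.single i 1) j) =
        (\<Prod>j\<in>Poly_Mapping.keys e - {i}. v j ^ Poly_Mapping.lookup e j)"
      by (intro prod.cong refl) (auto simp: lookup_minus lookup_single when_def)
    finally show "(\<Prod>j\<in>Poly_Mapping.keys e - {i}. v j ^ Poly_Mapping.lookup e j) *
       (of_nat (Poly_Mapping.lookup e i) * (v i ^ (Poly_Mapping.lookup e i - 1) * w i)) =
       w i * of_nat (Poly_Mapping.lookup e i) * monom_eval v (e - Poly_Mapping.single i 1)"
      by (simp add: mult_ac)
  qed
  finally show ?thesis .
qed

lemma meval_mpoly_deriv: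
  fixes F :: "'a::comm_ring_1 mpoly"
  shows "meval (\<lambda>c. c) v (mpoly_deriv i F) =
    (\<Sum>e\<in>Poly_Mapping.keys F. of_nat (Poly_Mapping.lookup e i) * Poly_Mapping.lookup F e *
        monom_eval v (e - Poly_Mapping.single i 1))"
  unfolding mpoly_deriv_def
  by (simp add: comm_ring_hom.meval_sum[OF comm_ring_hom_ident] meval_id)

text \<open>Taylor expansion to first order. It turns smoothness into a statement about one
  coefficient, which can be followed through ring homomorphisms.\<close>

lemma meval_first_order:
  fixes F :: "'a::idom mpoly"
  assumes "homogeneous n d F"
  shows "coeff (meval (\<lambda>c. [:c:]) (\<lambda>i. [:v i, w i:]) F) 0 = meval (\<lambda>c. c) v F"
    and "coeff (meval (\<lambda>c. [:c:]) (\<lambda>i. [:v i, w i:]) F) 1 =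
      (\<Sum>i\<le>n. w i * meval (\<lambda>c. c) v (mpoly_deriv i F))"
proof -
  let ?p = "meval (\<lambda>c. [:c:]) (\<lambda>i. [:v i, w i:]) F"
  show "coeff ?p 0 = meval (\<lambda>c. c) v F"
    unfolding poly_0_coeff_0[symmetric] by (simp add: hom_meval[OF comm_ring_hom_poly])
  have "coeff ?p 1 = poly (pderiv ?p) 0"
    by (simp add: poly_0_coeff_0 coeff_pderiv)
  also have "\<dots> = (\<Sum>e\<in>Poly_Mapping.keys F. Poly_Mapping.lookup F e *
      poly (pderiv (monom_eval (\<lambda>i. [:v i, w i:]) e)) 0)"
    by (simp add: meval_def pderiv_sum pderiv_smult poly_sum)
  also have "\<dots> = (\<Sum>e\<in>Poly_Mapping.keys F. Poly_Mapping.lookup F e *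
      (\<Sum>i\<le>n. w i * of_nat (Poly_Mapping.lookup e i) * monom_eval v (e - Poly_Mapping.single i 1)))"
    unfolding poly_pderiv_monom_eval using assms
    by (intro sum.cong refl arg_cong2[where f="(*)"] sum.mono_neutral_left)
      (auto simp: homogeneous_def in_keys_iff)
  also have "\<dots> = (\<Sum>i\<le>n. w i * meval (\<lambda>c. c) v (mpoly_deriv i F))"
    unfolding meval_mpoly_deriv sum_distrib_left
    by (subst sum.swap) (intro sum.cong refl, simp add: mult_ac)
  finally show "coeff ?p 1 = (\<Sum>i\<le>n. w i * meval (\<lambda>c. c) v (mpoly_deriv i F))" .
qed

lemma homogeneous_mpoly_deriv: "homogeneous n d F \<Longrightarrow> homogeneous n (d - 1) (mpoly_deriv i F)"
proof -
  assume F: "homogeneous n d F"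
  show ?thesis unfolding homogeneous_def
  proof
    fix e assume "e \<in> Poly_Mapping.keys (mpoly_deriv i F)"
    then obtain e' where e': "e' \<in> Poly_Mapping.keys F"
      "e \<in> Poly_Mapping.keys (Poly_Mapping.single (e' - Poly_Mapping.single i 1)
         (of_nat (Poly_Mapping.lookup e' i) * Poly_Mapping.lookup F e'))"
      unfolding mpoly_deriv_def by (blast dest: subsetD[OF keys_sum])
    \<comment> \<open>A monomial without the variable contributes coefficient 0, so a surviving
      exponent really comes from lowering a positive one.\<close>
    hence e: "e = e' - Poly_Mapping.single i 1" and i: "i \<in> Poly_Mapping.keys e'"
      by (auto split: if_splits simp: in_keys_iff intro!: Nat.gr0I)
    have sub: "Poly_Mapping.keys e \<subseteq> Poly_Mapping.keys e'"
      by (auto simp: e in_keys_iff lookup_minus)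
    have "(\<Sum>j\<in>Poly_Mapping.keys e. Poly_Mapping.lookup e j) = (\<Sum>j\<in>Poly_Mapping.keys e'. Poly_Mapping.lookup e j)"
      using sub by (intro sum.mono_neutral_left) (auto simp: in_keys_iff)
    also have "\<dots> = (Poly_Mapping.lookup e' i - 1) + (\<Sum>j\<in>Poly_Mapping.keys e' - {i}. Poly_Mapping.lookup e' j)"
      using i by (subst sum.remove[of _ i])
        (auto simp: e lookup_minus lookup_single when_def intro!: sum.cong)
    also have "\<dots> = (\<Sum>j\<in>Poly_Mapping.keys e'. Poly_Mapping.lookup e' j) - 1"
      using i sum.remove[of "Poly_Mapping.keys e'" i "Poly_Mapping.lookup e'"] by (simp add: in_keys_iff)
    finally show "Poly_Mapping.keys e \<subseteq> {..n} \<and> (\<Sum>j\<in>Poly_Mapping.keys e. Poly_Mapping.lookup e j) = d - 1"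
      using F e' sub unfolding homogeneous_def by auto
  qed
qed

lemma mpoly_eval_vec:
  assumes "homogeneous n d F"
  shows "mpoly_eval F (vec (Suc n) v) = meval (\<lambda>c. c) v F"
  unfolding mpoly_eval_conv_meval by (rule meval_homogeneous_cong[OF assms]) auto

lemma vec_in_coord_vecs: "i \<le> n \<Longrightarrow> v i \<noteq> 0 \<Longrightarrow> vec (Suc n) v \<in> coord_vecs n"
  unfolding coord_vecs_def by (auto simp: vec_eq_iff less_Suc_eq_le)

text \<open>A non-zero partial derivative is the derivative in the direction of the corresponding
  unit vector.\<close>

lemma nonsingular_direction:
  assumes "homogeneous n d F" "nonsingular n F" "meval (\<lambda>c. c) v F = 0" "i \<le> n" "v i \<noteq> 0"
  obtains w where "coeff (meval (\<lambda>c. [:c:]) (\<lambda>i. [:v i, w i:]) F) 1 \<noteq> 0"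
proof -
  obtain j where j: "j \<le> n" "mpoly_eval (mpoly_deriv j F) (vec (Suc n) v) \<noteq> 0"
    using assms vec_in_coord_vecs[of i n v] unfolding nonsingular_def
    by (metis mpoly_eval_vec)
  have "(\<Sum>k\<le>n. (if k = j then 1 else 0) * meval (\<lambda>c. c) v (mpoly_deriv k F)) =
      (\<Sum>k\<le>n. if k = j then meval (\<lambda>c. c) v (mpoly_deriv k F) else 0)"
    by (intro sum.cong) auto
  also have "\<dots> = mpoly_eval (mpoly_deriv j F) (vec (Suc n) v)"
    using j by (simp add: mpoly_eval_vec[OF homogeneous_mpoly_deriv[OF assms(1)]])
  finally show ?thesis
    using j(2) meval_first_order(2)[OF assms(1), of v "\<lambda>k. if k = j then 1 else 0"]
    by (intro that[of "\<lambda>k. if k = j then 1 else 0"]) metis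
qed

section \<open>Forms vanishing on a smooth hypersurface\<close>

text \<open>The line runs through the generic point X in direction P. The coefficients are
  polynomials in X, so one identity covers all parallel lines at once.\<close>

definition along_line :: "(nat \<Rightarrow> 'a) \<Rightarrow> 'a::comm_ring_1 mpoly \<Rightarrow> 'a mpoly poly" where
  "along_line P = meval (\<lambda>c. [:mpoly_const c:]) (\<lambda>i. [:mpoly_var i, mpoly_const (P i):])"

lemma comm_ring_hom_along_line: "comm_ring_hom (along_line P)"
  unfolding along_line_def
  by (intro comm_ring_hom.comm_ring_hom_meval
      comm_ring_hom_compose[OF comm_ring_hom_pCons comm_ring_hom_mpoly_const])

text \<open>Specialises the generic point by E and the parameter to t. Besides evaluation at a
  point, E will be evaluation along a second line, which carries the first-order
  information.\<close>

lemma poly_along_line: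
  assumes "comm_ring_hom \<phi>" "comm_ring_hom E" "\<And>c. E (mpoly_const c) = \<phi> c"
  shows "poly (map_poly E (along_line P G)) t =
     meval \<phi> (\<lambda>i. E (mpoly_var i) + t * \<phi> (P i)) G"
proof -
  interpret E: comm_ring_hom E by fact
  have h: "comm_ring_hom (\<lambda>p. poly (map_poly E p) t)"
    using comm_ring_hom_compose[OF comm_ring_hom_poly comm_ring_hom_map_poly[OF assms(2)]] .
  show ?thesis unfolding along_line_def
    by (subst hom_meval[OF h]) (simp add: assms(3) E.map_poly_pCons_hom)
qed

text \<open>A greatest common divisor over the fraction field, expressed inside the ring. A non-zero
  element h of least degree in the ideal of f and g leaves pseudo-remainders that lie in the ideal
  and have smaller degree, hence vanish; l and l' are the denominators cleared on the way.\<close>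

lemma linear_combination_of_min_degree:
  fixes f g :: "'a::idom poly"
  assumes "f \<noteq> 0"
  obtains h u v l b l' c where "h = u * f + v * g" "l \<noteq> 0" "smult l f = h * b" "l' \<noteq> 0" "smult l' g = h * c"
proof -
  define I where "I = {u * f + v * g | u v. True}"
  have "f = 1 * f + 0 * g" by simp
  hence "f \<in> I - {0}" using assms unfolding I_def by blast
  then obtain h where h: "h \<in> I - {0}" and hmin: "\<And>r. r \<in> I - {0} \<Longrightarrow> degree h \<le> degree r"
    using ex_has_least_nat[of "\<lambda>p. p \<in> I - {0}" f degree] by blast
  from h obtain u v where uv: "h = u * f + v * g" unfolding I_def by blast
  have "\<exists>a q. a \<noteq> 0 \<and> smult a p = h * q" if p: "p = u' * f + v' * g" for p u' v'
  proof -
    obtain a q where aq: "a \<noteq> 0" "smult a p = h * q + pseudo_mod p h"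
      using pseudo_mod(1)[of h p] h by blast
    have "pseudo_mod p h = smult a p - h * q" using aq by simp
    also have "\<dots> = ([:a:] * u' - q * u) * f + ([:a:] * v' - q * v) * g"
      unfolding p uv by (simp add: algebra_simps smult_add_right)
    finally have "pseudo_mod p h \<in> I" unfolding I_def by blast
    hence "pseudo_mod p h = 0" using hmin[of "pseudo_mod p h"] pseudo_mod(2)[of h p] h by fastforce
    with aq show ?thesis by auto
  qed
  from this[of f 1 0] this[of g 0 1] uv that show ?thesis by fastforce
qed

text \<open>
  Along lines in a fixed direction \<open>P\<close> with \<open>F P \<noteq> 0\<close>, a common divisor \<open>h\<close> of \<open>F\<close> and \<open>g\<close>
  with \<open>l F = h b\<close> is obtained by pseudo-division. If \<open>b\<close> were not constant along the line,
  a zero of \<open>b\<close> would be a zero of \<open>F\<close>, hence of \<open>g\<close> and of \<open>h\<close>, and so a singular point of \<open>F\<close>.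
\<close>

lemma form_vanishing_on_hypersurface:
  fixes F g :: "'a::alg_closed_field mpoly"
  assumes F: "homogeneous n d F" and g: "homogeneous n d g" and ns: "nonsingular n F"
    and n: "n \<ge> 1" and d: "d \<ge> 1"
    and van: "\<And>v. v \<in> coord_vecs n \<Longrightarrow> mpoly_eval F v = 0 \<Longrightarrow> mpoly_eval g v = 0"
  obtains c where "g = mpoly_const c * F"
proof -
  define ev where "ev = meval (\<lambda>c::'a. c)"
  define ev2 where "ev2 = (\<lambda>y w. meval (\<lambda>c::'a. [:c:]) (\<lambda>i. [:y i, w i:]))"
  have ev: "comm_ring_hom (ev y)" for y
    unfolding ev_def by (rule comm_ring_hom.comm_ring_hom_meval[OF comm_ring_hom_ident])
  have ev2: "comm_ring_hom (ev2 y w)" for y w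
    unfolding ev2_def by (rule comm_ring_hom.comm_ring_hom_meval[OF comm_ring_hom_pCons])
  interpret e: comm_ring_hom "ev y" for y by (rule ev)
  have evc: "ev y (mpoly_const c) = c" "ev y (mpoly_var k) = y k" for y c k
    by (simp_all add: ev_def meval_id)
  have van': "ev v g = 0" if "ev v F = 0" "i \<le> n" "v i \<noteq> 0" for v i
    using van[of "vec (Suc n) v"] vec_in_coord_vecs[of i n v] that
    unfolding ev_def by (simp add: mpoly_eval_vec[OF F] mpoly_eval_vec[OF g])
  have "F \<noteq> 0"
  proof
    assume "F = 0"
    hence "meval (\<lambda>c. c) (\<lambda>i. 1) F = 0" by (simp add: meval_id)
    then obtain w where w: "coeff (meval (\<lambda>c. [:c:]) (\<lambda>i. [:1, w i:]) F) 1 \<noteq> 0"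
      using nonsingular_direction[OF F ns, of "\<lambda>_. 1" 0] by auto
    thus False using \<open>F = 0\<close> by (simp add: comm_ring_hom.meval_0[OF comm_ring_hom_pCons])
  qed
  \<comment> \<open>The direction of all lines below. The leading coefficient of F along it is the
    non-zero constant F(P).\<close>
  then obtain P where P: "ev P F \<noteq> 0"
    using mpoly_nonzero_eval[OF infinite_alg_closed] unfolding ev_def by blast
  have "\<exists>j\<le>n. P j \<noteq> 0"
  proof (rule ccontr)
    assume "\<not> (\<exists>j\<le>n. P j \<noteq> 0)"
    hence "ev P F = meval (\<lambda>c. c) (\<lambda>i. 0 * P i) F"
      unfolding ev_def by (intro meval_homogeneous_cong[OF F]) auto
    also have "\<dots> = 0" using d by (subst meval_homogeneous_smult[OF F]) simp
    finally show False using P by simp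
  qed
  then obtain j where j: "j \<le> n" "P j \<noteq> 0" by blast
  \<comment> \<open>A second coordinate exists because n is at least 1; it serves to keep lines away
    from the origin.\<close>
  obtain i where i: "i \<le> n" "i \<noteq> j"
    by (metis le_eq_less_or_eq n not_one_le_zero zero_le)
  interpret L: comm_ring_hom "along_line P" by (rule comm_ring_hom_along_line)
  have deg: "degree (along_line P G) \<le> d" "coeff (along_line P G) d = mpoly_const (ev P G)"
    if "homogeneous n d G" for G
  proof -
    show "degree (along_line P G) \<le> d" unfolding along_line_def by (rule meval_linear_coeff(1)[OF that])
    have "coeff (along_line P G) d = meval mpoly_const (\<lambda>i. mpoly_const (P i)) G"
      unfolding along_line_def by (rule meval_linear_coeff(2)[OF that])
    also have "\<dots> = mpoly_const (ev P G)"
      unfolding ev_def by (subst hom_meval[OF comm_ring_hom_mpoly_const]) simp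
    finally show "coeff (along_line P G) d = mpoly_const (ev P G)" .
  qed
  have const0: "mpoly_const c = 0 \<longleftrightarrow> c = 0" for c :: 'a
  proof
    assume "mpoly_const c = 0"
    hence "Poly_Mapping.lookup (mpoly_const c :: 'a mpoly) 0 = 0" by simp
    thus "c = 0" by (simp add: mpoly_const_def)
  qed (simp add: mpoly_const_def)
  define f\<^sub>1 where "f\<^sub>1 = along_line P F"
  define g\<^sub>1 where "g\<^sub>1 = along_line P g"
  have cf: "coeff f\<^sub>1 d \<noteq> 0"
    unfolding f\<^sub>1_def deg(2)[OF F] using P by (simp add: const0)
  have f1: "degree f\<^sub>1 = d" "f\<^sub>1 \<noteq> 0"
    using le_degree[OF cf] deg(1)[OF F] cf unfolding f\<^sub>1_def by auto
  obtain h u v l b l' c where h: "h = u * f\<^sub>1 + v * g\<^sub>1" and l: "l \<noteq> 0" "smult l f\<^sub>1 = h * b"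
    and l': "l' \<noteq> 0" "smult l' g\<^sub>1 = h * c"
    using linear_combination_of_min_degree[OF f1(2), of g\<^sub>1] by blast
  have hb: "h \<noteq> 0" "b \<noteq> 0" using l f1 by auto
  have "degree b = 0"
  proof (rule ccontr)
    assume b: "degree b \<noteq> 0"
    \<comment> \<open>If z does not vanish at y, then y and P are not proportional in the
      coordinates i and j. The line through y then misses the origin, and each of its points is a
      point of projective space.\<close>
    define z where "z = (mpoly_const (P j) * mpoly_var i - mpoly_const (P i) * mpoly_var j :: 'a mpoly)"
    have "ev (\<lambda>k. if k = i then 1 else 0) z = P j"
      using i by (simp add: z_def e.hom_minus e.hom_mult evc)
    hence "z \<noteq> 0" using j by (auto simp: e.hom_zero)
    \<comment> \<open>One y has to satisfy three conditions: the denominator l survives, b keeps its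
      positive degree, and the line misses the origin.\<close>
    hence "l * lead_coeff b * z \<noteq> 0" using l hb by simp
    then obtain y where "ev y (l * lead_coeff b * z) \<noteq> 0"
      using mpoly_nonzero_eval[OF infinite_alg_closed] unfolding ev_def by blast
    hence y: "ev y l \<noteq> 0" "ev y (lead_coeff b) \<noteq> 0" "P j * y i - P i * y j \<noteq> 0"
      by (auto simp: z_def e.hom_minus e.hom_mult evc)
    have "coeff (map_poly (ev y) b) (degree b) \<noteq> 0" using y(2) by simp
    hence "degree (map_poly (ev y) b) \<noteq> 0" using b le_degree by fastforce
    then obtain t where t: "poly (map_poly (ev y) b) t = 0"
      using alg_closed_imp_poly_has_root by blast
    define w where "w = (\<lambda>k. y k + t * P k)"
    interpret q: comm_ring_hom "\<lambda>p. poly (map_poly (ev y) p) t"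
      by (rule comm_ring_hom_compose[OF comm_ring_hom_poly comm_ring_hom_map_poly[OF ev]])
    have line: "poly (map_poly (ev y) (along_line P G)) t = ev w G" for G
      unfolding w_def by (subst poly_along_line[OF comm_ring_hom_ident ev]) (simp_all add: ev_def meval_id)
    obtain k where k: "k \<le> n" "w k \<noteq> 0"
    proof (cases "w i = 0 \<and> w j = 0")
      case True
      hence "y i = - t * P i" "y j = - t * P j" by (auto simp: w_def add_eq_0_iff)
      with y(3) show ?thesis by simp
    qed (use i j that in blast)
    have "ev y l * ev w F = poly (map_poly (ev y) (smult l f\<^sub>1)) t"
      unfolding f\<^sub>1_def line[symmetric] by (simp add: e.map_poly_hom_smult)
    also have "\<dots> = 0" unfolding l(2) q.hom_mult t by simp
    finally have wF: "ev w F = 0" using y(1) by simp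
    with van'[of w k] k have "ev w g = 0" by simp
    with wF have "poly (map_poly (ev y) h) t = 0"
      unfolding h q.hom_add q.hom_mult f\<^sub>1_def g\<^sub>1_def line by simp
    note ht = this
    obtain r where r: "coeff (meval (\<lambda>c. [:c:]) (\<lambda>i. [:w i, r i:]) F) 1 \<noteq> 0"
      using nonsingular_direction[OF F ns wF[unfolded ev_def], of k] k by blast
    \<comment> \<open>First-order variation: y moves to y + s r while the parameter of the line
      stays at t, so the point w moves in the direction r, along which F has non-zero
      derivative.\<close>
    define \<Psi> where "\<Psi> = (\<lambda>p. poly (map_poly (ev2 y r) p) [:t:])"
    interpret \<Psi>: comm_ring_hom \<Psi>
      unfolding \<Psi>_def by (rule comm_ring_hom_compose[OF comm_ring_hom_poly comm_ring_hom_map_poly[OF ev2]])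
    interpret e2: comm_ring_hom "ev2 y r" by (rule ev2)
    have c0: "coeff (\<Psi> p) 0 = poly (map_poly (ev y) p) t" for p
    proof -
      have ev0: "poly (ev2 y r G) 0 = ev y G" for G
        unfolding ev2_def ev_def by (simp add: hom_meval[OF comm_ring_hom_poly])
      have "coeff (\<Psi> p) 0 = poly (map_poly (\<lambda>p. poly p 0) (map_poly (ev2 y r) p)) (poly [:t:] 0)"
        unfolding \<Psi>_def poly_0_coeff_0[symmetric] by (rule poly_hom.poly_map_poly[symmetric])
      also have "\<dots> = poly (map_poly (ev y) p) t"
        by (subst map_poly_map_poly) (simp_all add: o_def ev0 e2.hom_zero)
      finally show ?thesis .
    qed
    have "\<Psi> (along_line P F) = meval (\<lambda>c. [:c:]) (\<lambda>i. [:w i, r i:]) F"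
      unfolding \<Psi>_def
      by (subst poly_along_line[OF comm_ring_hom_pCons ev2])
        (simp_all add: ev2_def comm_ring_hom.meval_const[OF comm_ring_hom_pCons]
          comm_ring_hom.meval_var[OF comm_ring_hom_pCons] w_def mult.commute)
    hence \<Psi>F: "coeff (\<Psi> f\<^sub>1) 0 = 0" "coeff (\<Psi> f\<^sub>1) 1 \<noteq> 0"
      using r wF unfolding f\<^sub>1_def c0 line by simp_all
    have "ev2 y r l * \<Psi> f\<^sub>1 = \<Psi> (smult l f\<^sub>1)"
      unfolding \<Psi>_def by (simp add: e2.map_poly_hom_smult)
    also have "\<dots> = \<Psi> h * \<Psi> b" unfolding l(2) by (rule \<Psi>.hom_mult)
    finally have "coeff (ev2 y r l * \<Psi> f\<^sub>1) 1 = coeff (\<Psi> h * \<Psi> b) 1" by simp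
    moreover have "coeff (\<Psi> h) 0 = 0" "coeff (\<Psi> b) 0 = 0" using ht t by (simp_all add: c0)
    \<comment> \<open>Two factors without constant term have a product without linear term. As F
      vanishes at w, the linear term on the other side is l(y) times the derivative of F along
      r.\<close>
    ultimately have "coeff (ev2 y r l) 0 * coeff (\<Psi> f\<^sub>1) 1 = 0"
      using \<Psi>F(1) by (simp add: coeff_mult)
    moreover have "coeff (ev2 y r l) 0 = ev y l"
      unfolding poly_0_coeff_0[symmetric] ev2_def ev_def by (simp add: hom_meval[OF comm_ring_hom_poly])
    ultimately show False using y(1) \<Psi>F(2) by simp
  qed
  then obtain b\<^sub>0 where b0: "b = [:b\<^sub>0:]" "b\<^sub>0 \<noteq> 0" using hb by (auto elim: degree_eq_zeroE)
  \<comment> \<open>With b constant, h has the full degree d. As g has degree at most d along the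
    line, its cofactor c is constant too.\<close>
  have "degree h = d"
    using arg_cong[OF l(2), of degree] l(1) f1(1) b0 hb by simp
  moreover have "degree (smult l' g\<^sub>1) \<le> d" using deg(1)[OF g] unfolding g\<^sub>1_def
    using degree_smult_le order.trans by blast
  ultimately have "degree c = 0" unfolding l'(2) using hb by (cases "c = 0") (auto simp: degree_mult_eq)
  then obtain c\<^sub>0 where c0: "c = [:c\<^sub>0:]" by (auto elim: degree_eq_zeroE)
  have E: "smult (b\<^sub>0 * l') g\<^sub>1 = smult (c\<^sub>0 * l) f\<^sub>1"
  proof -
    have "smult (b\<^sub>0 * l') g\<^sub>1 = smult b\<^sub>0 (h * c)" by (simp flip: l'(2))
    also have "\<dots> = smult c\<^sub>0 (h * b)" by (simp add: b0 c0 mult.commute)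
    also have "\<dots> = smult (c\<^sub>0 * l) f\<^sub>1" by (simp flip: l(2))
    finally show ?thesis .
  qed
  \<comment> \<open>The factors in E are still polynomials in X. Comparing coefficients in degree d,
    which are the constants F(P) and g(P), shows that their quotient is a scalar.\<close>
  define \<gamma> where "\<gamma> = ev P g / ev P F"
  have "b\<^sub>0 * l' * mpoly_const (ev P g) = c\<^sub>0 * l * mpoly_const (ev P F)"
    using arg_cong[OF E, of "\<lambda>p. coeff p d"] deg(2)[OF F] deg(2)[OF g] by (simp add: f\<^sub>1_def g\<^sub>1_def)
  moreover have "mpoly_const (ev P g) = mpoly_const \<gamma> * mpoly_const (ev P F)"
    using P by (simp add: \<gamma>_def mpoly_const_def mult_single)
  ultimately have "b\<^sub>0 * l' * mpoly_const \<gamma> = c\<^sub>0 * l"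
    using P const0 mult_right_cancel[of "mpoly_const (ev P F)" "b\<^sub>0 * l' * mpoly_const \<gamma>" "c\<^sub>0 * l"]
    by (simp add: mult.assoc)
  with E have "smult (b\<^sub>0 * l') (g\<^sub>1 - smult (mpoly_const \<gamma>) f\<^sub>1) = 0"
    by (simp add: smult_diff_right)
  hence gf: "g\<^sub>1 = smult (mpoly_const \<gamma>) f\<^sub>1" using b0 l' by simp
  \<comment> \<open>At parameter 0 the generic line passes through X itself, which recovers the
    form.\<close>
  have at0: "poly (along_line P G) 0 = G" for G
    unfolding along_line_def by (subst hom_meval[OF comm_ring_hom_poly]) simp
  have "g = mpoly_const \<gamma> * F"
    using arg_cong[OF gf, of "\<lambda>p. poly p 0"] by (simp add: f\<^sub>1_def g\<^sub>1_def at0)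
  thus ?thesis by (rule that)
qed

section \<open>The absolute Galois group\<close>

lemma Gal_iff:
  "\<sigma> \<in> carrier Gal \<longleftrightarrow> bij \<sigma> \<and> (\<forall>x y. \<sigma> (x + y) = \<sigma> x + \<sigma> y) \<and> (\<forall>x y. \<sigma> (x * y) = \<sigma> x * \<sigma> y)
     \<and> (\<forall>c. \<sigma> (to_ac c) = to_ac c)"
  by (simp add: Gal_def)

lemma Gal_to_ac: "\<sigma> \<in> carrier Gal \<Longrightarrow> \<sigma> (to_ac c) = to_ac c"
  by (simp add: Gal_iff)

lemma comm_ring_hom_Gal: "\<sigma> \<in> carrier Gal \<Longrightarrow> comm_ring_hom \<sigma>"
proof -
  assume s: "\<sigma> \<in> carrier Gal"
  hence "\<sigma> (to_ac 0) = to_ac 0" "\<sigma> (to_ac 1) = to_ac 1" by (simp_all only: Gal_to_ac)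
  with s show ?thesis by unfold_locales (simp_all add: Gal_iff)
qed

lemma Gal_inj: "\<sigma> \<in> carrier Gal \<Longrightarrow> \<sigma> x = \<sigma> y \<longleftrightarrow> x = y"
  by (auto simp: Gal_iff bij_def inj_eq)

lemma Gal_eq_0: "\<sigma> \<in> carrier Gal \<Longrightarrow> \<sigma> x = 0 \<longleftrightarrow> x = 0"
  by (metis Gal_inj Gal_to_ac to_ac_0)

lemma Gal_id: "id \<in> carrier Gal" "(\<lambda>x. x) \<in> carrier Gal"
  by (auto simp: Gal_iff bij_id[unfolded id_def])

lemma Gal_comp: "\<sigma> \<in> carrier Gal \<Longrightarrow> \<tau> \<in> carrier Gal \<Longrightarrow> \<sigma> \<circ> \<tau> \<in> carrier Gal"
  by (auto simp: Gal_iff bij_comp)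

lemma Gal_inv:
  assumes "\<sigma> \<in> carrier Gal"
  shows "inv_into UNIV \<sigma> \<in> carrier Gal" "\<sigma> (inv_into UNIV \<sigma> x) = x" "inv_into UNIV \<sigma> (\<sigma> x) = x"
proof -
  have b: "bij \<sigma>" using assms by (simp add: Gal_iff)
  show 1: "\<sigma> (inv_into UNIV \<sigma> x) = x" for x using b by (simp add: bij_is_surj surj_f_inv_f)
  show 2: "inv_into UNIV \<sigma> (\<sigma> x) = x" for x using b by (simp add: bij_is_inj)
  have "inv_into UNIV \<sigma> (x + y) = inv_into UNIV \<sigma> x + inv_into UNIV \<sigma> y" "inv_into UNIV \<sigma> (x * y) = inv_into UNIV \<sigma> x * inv_into UNIV \<sigma> y" for x y
    using assms 1 2 unfolding Gal_iff by metis+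
  moreover have "inv_into UNIV \<sigma> (to_ac c) = to_ac c" for c using 2[of "to_ac c"] Gal_to_ac[OF assms] by simp
  ultimately show "inv_into UNIV \<sigma> \<in> carrier Gal" using b by (simp add: Gal_iff bij_imp_bij_inv)
qed

lemma Gal_inverse: "\<sigma> \<in> carrier Gal \<Longrightarrow> \<sigma> (inverse x) = inverse (\<sigma> x)"
proof (cases "x = 0")
  case False
  assume s: "\<sigma> \<in> carrier Gal"
  then interpret comm_ring_hom \<sigma> by (rule comm_ring_hom_Gal)
  have "\<sigma> x * \<sigma> (inverse x) = 1" using False by (simp flip: hom_mult)
  thus ?thesis by (simp add: inverse_unique)
qed (simp add: Gal_eq_0[THEN iffD2])

lemma poly_Gal_to_ac:
  assumes "\<sigma> \<in> carrier Gal"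
  shows "\<sigma> (poly (map_poly to_ac p) x) = poly (map_poly to_ac p) (\<sigma> x)"
proof -
  interpret comm_ring_hom \<sigma> by (rule comm_ring_hom_Gal[OF assms])
  have "map_poly \<sigma> (map_poly to_ac p) = map_poly to_ac p"
    by (subst map_poly_map_poly) (simp_all add: o_def Gal_to_ac[OF assms] hom_zero)
  thus ?thesis by (metis poly_map_poly)
qed

section \<open>Minimal polynomials and extension of embeddings\<close>

lemma algebraic_min:
  fixes x :: "'k::field alg_closure"
  obtains p where "p \<noteq> 0" "poly (map_poly to_ac p) x = 0"
    "\<And>q. poly (map_poly to_ac q) x = 0 \<Longrightarrow> p dvd q"
proof -
  interpret a: comm_ring_hom "to_ac :: 'k \<Rightarrow> _" by unfold_locales auto
  interpret ap: comm_ring_hom "map_poly (to_ac :: 'k \<Rightarrow> _)"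
    by (rule comm_ring_hom_map_poly[OF a.comm_ring_hom_axioms])
  let ?P = "\<lambda>p. p \<noteq> 0 \<and> poly (map_poly to_ac p) x = 0"
  obtain p0 where "?P p0" using alg_closure_algebraic[of x] by metis
  then obtain p where p: "?P p" and pm: "\<And>q. ?P q \<Longrightarrow> degree p \<le> degree q"
    using ex_has_least_nat[of ?P p0 degree] by blast
  \<comment> \<open>Division with remainder: the remainder also annihilates x and has smaller
    degree.\<close>
  have "p dvd q" if "poly (map_poly to_ac q) x = 0" for q
  proof -
    have "map_poly to_ac q = map_poly to_ac p * map_poly to_ac (q div p) + map_poly to_ac (q mod p)"
      by (simp flip: ap.hom_mult ap.hom_add)
    hence "poly (map_poly to_ac (q mod p)) x = 0" using that p by simp
    hence "q mod p = 0" using pm[of "q mod p"] degree_mod_less[of p q] p by fastforce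
    thus ?thesis by (simp add: mod_eq_0_iff_dvd)
  qed
  with p that show ?thesis by blast
qed

text \<open>The graph of a \<open>k\<close>-homomorphism from a subring of the algebraic closure to the algebraic closure.\<close>

definition partial_hom :: "('k::field alg_closure \<times> 'k alg_closure) set \<Rightarrow> bool" where
  "partial_hom H \<longleftrightarrow> (\<forall>c. (to_ac c, to_ac c) \<in> H) \<and>
     (\<forall>x y x' y'. (x, y) \<in> H \<longrightarrow> (x', y') \<in> H \<longrightarrow> (x + x', y + y') \<in> H \<and> (x * x', y * y') \<in> H) \<and>
     (\<forall>y. (0, y) \<in> H \<longrightarrow> y = 0)"

context
  fixes H :: "('k::field alg_closure \<times> 'k alg_closure) set"
  assumes H: "partial_hom H"
begin

lemma partial_hom_const: "(to_ac c, to_ac c) \<in> H"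
  and partial_hom_add: "(x, y) \<in> H \<Longrightarrow> (x', y') \<in> H \<Longrightarrow> (x + x', y + y') \<in> H"
  and partial_hom_mult: "(x, y) \<in> H \<Longrightarrow> (x', y') \<in> H \<Longrightarrow> (x * x', y * y') \<in> H"
  and partial_hom_0: "(0, y) \<in> H \<Longrightarrow> y = 0"
  using H unfolding partial_hom_def by blast+

lemma partial_hom_00: "(0, 0) \<in> H" and partial_hom_11: "(1, 1) \<in> H"
  using partial_hom_const[of 0] partial_hom_const[of 1] by simp_all

lemma partial_hom_diff: "(x, y) \<in> H \<Longrightarrow> (x', y') \<in> H \<Longrightarrow> (x - x', y - y') \<in> H"
  using partial_hom_add[of x y "- x'" "- y'"] partial_hom_mult[OF partial_hom_const[of "- 1"], of x' y']
  by simp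

lemma partial_hom_sum: "(\<And>i. i \<in> A \<Longrightarrow> (f i, g i) \<in> H) \<Longrightarrow> (sum f A, sum g A) \<in> H"
  by (induction A rule: infinite_finite_induct) (auto intro: partial_hom_add partial_hom_00)

lemma partial_hom_power: "(x, y) \<in> H \<Longrightarrow> (x ^ n, y ^ n) \<in> H"
  by (induction n) (auto intro: partial_hom_mult partial_hom_11)

lemma partial_hom_poly:
  assumes "(x, y) \<in> H"
  shows "(poly (map_poly to_ac p) x, poly (map_poly to_ac p) y) \<in> H"
  using assms unfolding poly_altdef
  by (intro partial_hom_sum partial_hom_mult partial_hom_power)
    (auto simp: coeff_map_poly partial_hom_const)

text \<open>The domain is only a ring, so algebraicity takes the place of inverses. If x maps to 0,
  then p(x) = 0 maps to the constant coefficient of the minimal polynomial p, which is non-zero: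
  otherwise p divided by X would annihilate x in smaller degree.\<close>

lemma partial_hom_inj:
  assumes "(x, 0) \<in> H"
  shows "x = 0"
proof (rule ccontr)
  assume x: "x \<noteq> 0"
  interpret a: comm_ring_hom "to_ac :: 'k \<Rightarrow> _" by unfold_locales auto
  obtain p where p: "p \<noteq> 0" "poly (map_poly to_ac p) x = 0"
    "\<And>q. poly (map_poly to_ac q) x = 0 \<Longrightarrow> p dvd q"
    using algebraic_min[of x] by metis
  have "coeff p 0 \<noteq> 0"
  proof
    assume "coeff p 0 = 0"
    then obtain q where q: "p = pCons 0 q" by (cases p) auto
    hence "q \<noteq> 0" using p(1) by auto
    have "poly (map_poly to_ac q) x = 0" using p(2) x by (simp add: q a.map_poly_pCons_hom)
    hence "degree p \<le> degree q" using p(3) \<open>q \<noteq> 0\<close> by (simp add: dvd_imp_degree_le)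
    thus False using \<open>q \<noteq> 0\<close> by (simp add: q)
  qed
  moreover have "(0, to_ac (coeff p 0)) \<in> H"
    using partial_hom_poly[OF assms, of p] p(2) by (simp add: poly_0_coeff_0)
  ultimately show False using partial_hom_0 by force
qed

text \<open>The classical extension to a simple algebraic ring extension. Among pairs of polynomials
  with corresponding coefficients, take p of least degree vanishing at x, with partner q, and let y
  be any root of q. Pseudo-division of a pair by (p, q) shows that relations satisfied by x are
  carried to relations satisfied by y.\<close>

lemma partial_hom_extend:
  obtains y H' where "partial_hom H'" "H \<subseteq> H'" "(x, y) \<in> H'"
proof -
  define pp where "pp p q \<longleftrightarrow> (\<forall>i. (coeff p i, coeff q i) \<in> H)" for p q
  have pp_0: "q = 0" if "pp 0 q" for q
    using that partial_hom_0 unfolding pp_def by (intro poly_eqI) auto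
  have pp_mult: "pp (p * p') (q * q')" if "pp p q" "pp p' q'" for p q p' q'
    using that unfolding pp_def coeff_mult by (blast intro: partial_hom_sum partial_hom_mult)
  have pp_add: "pp (p + p') (q + q')" and pp_diff: "pp (p - p') (q - q')"
    if "pp p q" "pp p' q'" for p q p' q'
    using that unfolding pp_def by (auto intro: partial_hom_add partial_hom_diff)
  have pp_monom: "pp (monom a i) (monom b i)" if "(a, b) \<in> H" for a b i
    using that partial_hom_00 unfolding pp_def by simp
  let ?P = "\<lambda>(p, q). pp p q \<and> p \<noteq> 0 \<and> poly p x = 0"
  obtain p0 :: "'k poly" where "p0 \<noteq> 0" "poly (map_poly to_ac p0) x = 0" using alg_closure_algebraic[of x] by metis
  hence "?P (map_poly to_ac p0, map_poly to_ac p0)"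
    by (auto simp: pp_def coeff_map_poly partial_hom_const map_poly_eq_0_iff)
  then obtain pq where "?P pq" and "\<And>r. ?P r \<Longrightarrow> degree (fst pq) \<le> degree (fst r)"
    using ex_has_least_nat[of ?P _ "\<lambda>r. degree (fst r)"] by blast
  then obtain p q where p: "pp p q" "p \<noteq> 0" "poly p x = 0"
    and pm: "\<And>r s. pp r s \<Longrightarrow> r \<noteq> 0 \<Longrightarrow> poly r x = 0 \<Longrightarrow> degree p \<le> degree r"
    by (cases pq) fastforce
  \<comment> \<open>By injectivity the leading coefficient of p does not map to 0, so q is
    non-constant and has a root.\<close>
  have lq: "coeff q (degree p) \<noteq> 0"
  proof
    assume "coeff q (degree p) = 0"
    hence "(lead_coeff p, 0) \<in> H" using p(1) unfolding pp_def by metis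
    thus False using partial_hom_inj[of "lead_coeff p"] p(2) by simp
  qed
  have "degree p > 0"
  proof (rule ccontr)
    assume "\<not> degree p > 0"
    then obtain a where "p = [:a:]" by (auto elim: degree_eq_zeroE)
    thus False using p(2,3) by simp
  qed
  hence "degree q > 0" using le_degree[OF lq] by simp
  then obtain y where y: "poly q y = 0" using alg_closed_imp_poly_has_root by blast
  have wd: "poly s y = 0" if "pp r s" "poly r x = 0" for r s
    using that
  \<comment> \<open>The zero polynomial gets a measure of its own, below that of the non-zero
    constants.\<close>
  proof (induction "if r = 0 then 0 else Suc (degree r)" arbitrary: r s rule: less_induct)
    case less
    show ?case
    proof (cases "r = 0")
      case True
      thus ?thesis using pp_0[of s] less.prems by simp
    next
      case False
      define k where "k = degree r - degree p"
      have k: "degree r = k + degree p" using pm[OF less.prems(1) False less.prems(2)] by (simp add: k_def)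
      \<comment> \<open>One step of pseudo-division, carried out on both members of the pair: it
        cancels the leading term of r without dividing by a coefficient, and keeps corresponding
        coefficients in \<open>H\<close>.\<close>
      define r' where "r' = monom (lead_coeff p) 0 * r - monom (lead_coeff r) k * p"
      define s' where "s' = monom (coeff q (degree p)) 0 * s - monom (coeff s (degree r)) k * q"
      have "pp r' s'" unfolding r'_def s'_def
        using p(1) less.prems(1) by (intro pp_diff pp_mult pp_monom) (auto simp: pp_def)
      moreover have "poly r' x = 0" using less.prems(2) p(3) by (simp add: r'_def)
      moreover have "r' = 0 \<or> degree r' < degree r"
      proof -
        have "degree r' \<le> degree r" unfolding r'_def
          by (intro degree_diff_le order.trans[OF degree_mult_le] order.trans[OF add_mono[OF degree_monom_le order.refl]])
            (auto simp: k)
        moreover have "coeff r' (degree r) = lead_coeff p * lead_coeff r - lead_coeff r * lead_coeff p"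
          unfolding r'_def by (simp add: coeff_monom_mult k)
        hence "coeff r' (degree r) = 0" by (simp add: mult.commute)
        ultimately show ?thesis by (metis eq_zero_or_degree_less)
      qed
      ultimately have "poly s' y = 0" using False by (intro less.hyps) auto
      thus ?thesis using y lq by (simp add: s'_def poly_monom)
    qed
  qed
  define H' where "H' = {(poly r x, poly s y) | r s. pp r s}"
  have "partial_hom H'" unfolding partial_hom_def
  proof (intro conjI allI impI)
    fix c show "(to_ac c, to_ac c) \<in> H'" unfolding H'_def
      using pp_monom[OF partial_hom_const, of c 0]
      by (auto simp: monom_0 intro!: exI[of _ "[:to_ac c:]"])
  next
    fix a b a' b' assume "(a, b) \<in> H'" "(a', b') \<in> H'"
    then obtain r s r' s' where rs: "pp r s" "pp r' s'"
      and e: "a = poly r x" "b = poly s y" "a' = poly r' x" "b' = poly s' y"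
      unfolding H'_def by blast
    have "(poly (r + r') x, poly (s + s') y) \<in> H'" "(poly (r * r') x, poly (s * s') y) \<in> H'"
      using pp_add[OF rs] pp_mult[OF rs] unfolding H'_def by blast+
    thus "(a + a', b + b') \<in> H'" "(a * a', b * b') \<in> H'" by (simp_all add: e)
  next
    fix z assume "(0, z) \<in> H'"
    then obtain r s where "pp r s" "poly r x = 0" "z = poly s y" unfolding H'_def by auto
    thus "z = 0" using wd by simp
  qed
  moreover have "H \<subseteq> H'"
  proof
    fix ab assume ab: "ab \<in> H"
    obtain a b where "ab = (a, b)" by force
    hence "pp [:a:] [:b:]" using ab pp_monom[of a b 0] by (simp add: monom_0)
    hence "(poly [:a:] x, poly [:b:] y) \<in> H'" unfolding H'_def by blast
    thus "ab \<in> H'" using \<open>ab = (a, b)\<close> by simp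
  qed
  moreover have "(x, y) \<in> H'"
  proof -
    have "(poly (monom 1 1) x, poly (monom 1 1) y) \<in> H'"
      using pp_monom[OF partial_hom_11, of 1] unfolding H'_def by blast
    thus ?thesis by (simp add: poly_monom)
  qed
  ultimately show ?thesis by (rule that)
qed

end

text \<open>Graphs are closed under unions of chains, and by \<open>partial_hom_extend\<close> a
  maximal one has full domain. The resulting map is injective by \<open>partial_hom_inj\<close>; it
  is surjective because it permutes the finite root set of every polynomial over k.\<close>

lemma partial_hom_extend_Gal:
  assumes "partial_hom H\<^sub>0"
  obtains \<sigma> where "\<sigma> \<in> carrier Gal" "\<And>x y. (x, y) \<in> H\<^sub>0 \<Longrightarrow> \<sigma> x = y"
proof -
  define \<A> where "\<A> = {H. partial_hom H \<and> H\<^sub>0 \<subseteq> H}"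
  have "\<exists>M\<in>\<A>. \<forall>Y\<in>\<A>. M \<subseteq> Y \<longrightarrow> Y = M"
  proof (rule subset_Zorn_nonempty)
    show "\<A> \<noteq> {}" using assms unfolding \<A>_def by blast
  next
    fix C assume C: "C \<noteq> {}" "subset.chain \<A> C"
    have sub: "H \<in> C \<Longrightarrow> partial_hom H \<and> H\<^sub>0 \<subseteq> H" for H
      using C(2) unfolding subset.chain_def \<A>_def by blast
    have "partial_hom (\<Union>C)" unfolding partial_hom_def
    proof (intro conjI allI impI)
      fix c show "(to_ac c, to_ac c) \<in> \<Union>C" using C(1) sub unfolding partial_hom_def by blast
    next
      fix x y x' y' assume "(x, y) \<in> \<Union>C" "(x', y') \<in> \<Union>C"
      then obtain H H' where "H \<in> C" "H' \<in> C" "(x, y) \<in> H" "(x', y') \<in> H'" by blast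
      moreover have "H \<subseteq> H' \<or> H' \<subseteq> H" using C(2) \<open>H \<in> C\<close> \<open>H' \<in> C\<close> unfolding subset.chain_def by blast
      ultimately obtain K where "K \<in> C" "(x, y) \<in> K" "(x', y') \<in> K" by blast
      thus "(x + x', y + y') \<in> \<Union>C" "(x * x', y * y') \<in> \<Union>C"
        using sub[of K] partial_hom_add partial_hom_mult by blast+
    next
      fix y assume "(0, y) \<in> \<Union>C"
      thus "y = 0" using sub partial_hom_0 by blast
    qed
    thus "\<Union>C \<in> \<A>" using C(1) sub unfolding \<A>_def by blast
  qed
  then obtain M where M: "partial_hom M" "H\<^sub>0 \<subseteq> M"
    and max: "\<And>Y. partial_hom Y \<Longrightarrow> M \<subseteq> Y \<Longrightarrow> Y = M"
    unfolding \<A>_def by fastforce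
  have total: "\<exists>y. (x, y) \<in> M" for x
    using partial_hom_extend[OF M(1), of x] max by metis
  have uniq: "y = y'" if "(x, y) \<in> M" "(x, y') \<in> M" for x y y'
    using partial_hom_0[OF M(1), of "y - y'"] partial_hom_diff[OF M(1) that] by simp
  define \<sigma> where "\<sigma> x = (THE y. (x, y) \<in> M)" for x
  have \<sigma>: "(x, y) \<in> M \<longleftrightarrow> \<sigma> x = y" for x y
    unfolding \<sigma>_def using total[of x] uniq by (metis the_equality)
  have add: "\<sigma> (x + y) = \<sigma> x + \<sigma> y" and mult: "\<sigma> (x * y) = \<sigma> x * \<sigma> y" and c: "\<sigma> (to_ac c) = to_ac c" for x y c
    using partial_hom_add[OF M(1), of x "\<sigma> x" y "\<sigma> y"] partial_hom_mult[OF M(1), of x "\<sigma> x" y "\<sigma> y"]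
      partial_hom_const[OF M(1), of c] by (simp_all add: \<sigma>)
  have inj: "inj \<sigma>"
  proof (rule injI)
    fix x y assume "\<sigma> x = \<sigma> y"
    hence "(x - y, 0) \<in> M" using partial_hom_diff[OF M(1), of x "\<sigma> x" y "\<sigma> y"] by (simp add: \<sigma>)
    thus "x = y" using partial_hom_inj[OF M(1)] by force
  qed
  have "\<exists>x. z = \<sigma> x" for z
  proof -
    obtain p :: "'a poly" where p: "p \<noteq> 0" "poly (map_poly to_ac p) z = 0"
      using alg_closure_algebraic[of z] by metis
    define R where "R = {w. poly (map_poly to_ac p) w = 0}"
    \<comment> \<open>An injective map of the finite root set into itself is onto, so z is
      attained.\<close>
    have "finite R" unfolding R_def using p(1) by (intro poly_roots_finite) (simp add: map_poly_eq_0_iff)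
    moreover have "\<sigma> w \<in> R" if "w \<in> R" for w
      using partial_hom_poly[OF M(1), of w "\<sigma> w" p] that c[of 0] by (simp add: \<sigma> R_def)
    ultimately have "\<sigma> ` R = R"
      using inj by (intro endo_inj_surj) (auto intro: inj_on_subset)
    moreover have "z \<in> R" using p by (simp add: R_def)
    ultimately show ?thesis by blast
  qed
  hence "surj \<sigma>" by blast
  with inj add mult c have "\<sigma> \<in> carrier Gal" by (simp add: Gal_iff bij_def)
  moreover have "\<And>x y. (x, y) \<in> H\<^sub>0 \<Longrightarrow> \<sigma> x = y" using M(2) \<sigma> by blast
  ultimately show ?thesis by (rule that)
qed

text \<open>If the minimal polynomial of x had degree above 1, separability would give a second root
  y, and the embedding x to y would extend to an automorphism moving x.\<close>

lemma fixed_field_Gal: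
  fixes x :: "'k::field alg_closure"
  assumes perf: "perfect TYPE('k)" and fixed: "\<And>\<sigma>. \<sigma> \<in> carrier Gal \<Longrightarrow> \<sigma> x = x"
  shows "x \<in> base_field"
proof -
  interpret a: comm_ring_hom "to_ac :: 'k \<Rightarrow> _" by unfold_locales auto
  interpret ap: comm_ring_hom "map_poly (to_ac :: 'k \<Rightarrow> _)"
    by (rule comm_ring_hom_map_poly[OF a.comm_ring_hom_axioms])
  obtain p where p: "p \<noteq> 0" "poly (map_poly to_ac p) x = 0"
    and pm: "\<And>q. poly (map_poly to_ac q) x = 0 \<Longrightarrow> p dvd q"
    using algebraic_min[of x] by metis
  define P where "P = map_poly to_ac p"
  have P: "P \<noteq> 0" "degree P = degree p" "poly P x = 0"
    using p by (simp_all add: P_def map_poly_eq_0_iff degree_map_poly)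
  have "degree P \<noteq> 0"
  proof
    assume "degree P = 0"
    then obtain a where "P = [:a:]" by (auto elim: degree_eq_zeroE)
    thus False using P(1,3) by simp
  qed
  \<comment> \<open>One factor of p annihilates x, hence is divisible by p, which makes the other
    factor a unit.\<close>
  have "irreducible p"
  proof (rule irreducibleI)
    show "p \<noteq> 0" by fact
    show "\<not> p dvd 1" using \<open>degree P \<noteq> 0\<close> P(2) by (auto simp: is_unit_iff_degree p(1))
    fix f g assume fg: "p = f * g"
    have "poly (map_poly to_ac f) x * poly (map_poly to_ac g) x = 0"
      using p(2) by (simp add: fg ap.hom_mult)
    hence "p dvd f \<or> p dvd g" using pm by auto
    thus "f dvd 1 \<or> g dvd 1"
    proof
      assume "p dvd f"
      hence "f * g dvd f * 1" by (simp add: fg)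
      thus ?thesis using p(1) fg by (metis dvd_times_left_cancel_iff mult_eq_0_iff)
    next
      assume "p dvd g"
      hence "g * f dvd g * 1" by (simp add: fg mult.commute)
      thus ?thesis using p(1) fg by (metis dvd_times_left_cancel_iff mult_eq_0_iff)
    qed
  qed
  hence sqf: "rsquarefree P" using perf unfolding perfect_def P_def by blast
  obtain q where q: "P = [:- x, 1:] * q" using P(3) by (metis dvdE poly_eq_0_iff_dvd)
  have "q \<noteq> 0" using q P by auto
  have dq: "degree P = Suc (degree q)" using \<open>q \<noteq> 0\<close> by (simp add: q degree_mult_eq del: mult_pCons_left)
  show ?thesis
  proof (cases "degree q = 0")
    case True
    hence "degree p = 1" using dq P(2) by simp
    then obtain c0 c1 where c: "p = [:c0, c1:]" "c1 \<noteq> 0"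
      using degree1_coeffs by blast
    hence "x = to_ac (- c0 / c1)" using p(2) c(2)
      by (simp add: a.map_poly_pCons_hom field_simps eq_neg_iff_add_eq_0)
    thus ?thesis by blast
  next
    case False
    then obtain y where y: "poly q y = 0" using alg_closed_imp_poly_has_root by blast
    \<comment> \<open>Here perfectness is used: x is a simple root, so it is no root of the cofactor
      q.\<close>
    have "y \<noteq> x"
    proof
      assume "y = x"
      then obtain r where "q = [:- x, 1:] * r" using y by (metis dvdE poly_eq_0_iff_dvd)
      hence "[:- x, 1:] ^ 2 dvd P" unfolding q power2_eq_square by (metis dvd_triv_left mult.assoc)
      hence "order x P \<ge> 2" using P(1) by (simp add: order_divides)
      thus False using sqf unfolding rsquarefree_def by (metis One_nat_def Suc_1 not_less_eq_eq le0)
    qed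
    have Py: "poly P y = 0" using y by (simp add: q)
    \<comment> \<open>The map from k[x] to k[y]. It is well defined because p divides every
      polynomial annihilating x and vanishes at y.\<close>
    define H where "H = {(poly (map_poly to_ac r) x, poly (map_poly to_ac r) y) | r :: 'k poly. True}"
    have "partial_hom H" unfolding partial_hom_def
    proof (intro conjI allI impI)
      fix c show "(to_ac c, to_ac c) \<in> H" unfolding H_def
        by (auto simp: a.map_poly_pCons_hom intro!: exI[of _ "[:c:]"])
    next
      fix a b a' b' assume "(a, b) \<in> H" "(a', b') \<in> H"
      then obtain r r' where e: "a = poly (map_poly to_ac r) x" "b = poly (map_poly to_ac r) y"
        "a' = poly (map_poly to_ac r') x" "b' = poly (map_poly to_ac r') y"
        unfolding H_def by blast
      show "(a + a', b + b') \<in> H" unfolding H_def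
        by (auto simp: e ap.hom_add intro!: exI[of _ "r + r'"])
      show "(a * a', b * b') \<in> H" unfolding H_def
        by (auto simp: e ap.hom_mult intro!: exI[of _ "r * r'"])
    next
      fix z assume "(0, z) \<in> H"
      then obtain r where r: "poly (map_poly to_ac r) x = 0" "z = poly (map_poly to_ac r) y" unfolding H_def by auto
      then obtain s where "r = p * s" using pm by (metis dvdE)
      thus "z = 0" using r(2) Py by (simp add: ap.hom_mult P_def)
    qed
    then obtain \<sigma> where "\<sigma> \<in> carrier Gal" "\<And>a b. (a, b) \<in> H \<Longrightarrow> \<sigma> a = b"
      using partial_hom_extend_Gal by blast
    moreover have "(x, y) \<in> H" unfolding H_def
      by (auto simp: a.map_poly_pCons_hom intro!: exI[of _ "[:0, 1:]"])
    ultimately show ?thesis using fixed \<open>y \<noteq> x\<close> by metis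
  qed
qed

section \<open>Galois descent for scalars\<close>

text \<open>A model of the Galois group of L over k: \<open>restrict\<close> identifies
  automorphisms that agree on L, so that this set can be finite.\<close>

definition Gal_on :: "'k::field alg_closure set \<Rightarrow> ('k alg_closure \<Rightarrow> 'k alg_closure) set" where
  "Gal_on L = (\<lambda>\<sigma>. restrict \<sigma> L) ` carrier Gal"

text \<open>Stands for a finite Galois extension. Finiteness is imposed on the group of
  restrictions, since that is the range over which traces and resolvents are summed.\<close>

definition finite_galois :: "'k::field alg_closure set \<Rightarrow> bool" where
  "finite_galois L \<longleftrightarrow> (\<forall>c. to_ac c \<in> L) \<and> (\<forall>x\<in>L. \<forall>y\<in>L. x + y \<in> L \<and> x * y \<in> L) \<and>
     (\<forall>\<sigma>\<in>carrier Gal. \<forall>x\<in>L. \<sigma> x \<in> L) \<and> finite (Gal_on L)"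

text \<open>Conjugates are roots of the same polynomial over k.\<close>

lemma finite_Gal_orbit: "finite ((\<lambda>\<sigma>. \<sigma> x) ` carrier Gal)" for x :: "'k::field alg_closure"
proof -
  obtain p :: "'k poly" where p: "p \<noteq> 0" "poly (map_poly to_ac p) x = 0"
    using alg_closure_algebraic[of x] by metis
  have "(\<lambda>\<sigma>. \<sigma> x) ` carrier Gal \<subseteq> {y. poly (map_poly to_ac p) y = 0}"
    using p(2) by (auto simp flip: poly_Gal_to_ac simp: Gal_eq_0)
  thus ?thesis
    by (rule finite_subset) (intro poly_roots_finite, simp add: map_poly_eq_0_iff p(1))
qed

text \<open>L is the fixed set of the pointwise stabiliser of S', the set of all conjugates of S. As
  S' is finite and Galois stable, so is L stable, and the restriction of an automorphism to L is
  determined by the self-map that it induces on S'.\<close>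

lemma finite_subset_finite_galois:
  assumes "finite (S :: 'k::field alg_closure set)"
  obtains L where "finite_galois L" "S \<subseteq> L"
proof -
  define S' where "S' = (\<Union>x\<in>S. (\<lambda>\<sigma>. \<sigma> x) ` carrier Gal)"
  define L where "L = {x. \<forall>\<tau>\<in>carrier Gal. (\<forall>s\<in>S'. \<tau> s = s) \<longrightarrow> \<tau> x = x}"
  have finS: "finite S'" unfolding S'_def using assms finite_Gal_orbit by blast
  have SS: "S \<subseteq> S'" unfolding S'_def using Gal_id(2) by force
  have stable: "\<sigma> x \<in> S'" if s: "\<sigma> \<in> carrier Gal" and x: "x \<in> S'" for \<sigma> x
  proof -
    obtain z \<tau> where z: "z \<in> S" "\<tau> \<in> carrier Gal" "x = \<tau> z" using x unfolding S'_def by blast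
    hence "\<sigma> x = (\<sigma> \<circ> \<tau>) z" by simp
    thus ?thesis using z Gal_comp[OF s z(2)] unfolding S'_def by blast
  qed
  have dep: "restrict \<sigma> L = restrict \<tau> L"
    if s: "\<sigma> \<in> carrier Gal" and t: "\<tau> \<in> carrier Gal" and e: "restrict \<sigma> S' = restrict \<tau> S'" for \<sigma> \<tau>
  proof -
    \<comment> \<open>The quotient of two automorphisms that agree on S' fixes S' pointwise, hence
      fixes L by definition.\<close>
    have "(inv_into UNIV \<sigma> \<circ> \<tau>) x = x" if "x \<in> L" for x
    proof -
      have "(inv_into UNIV \<sigma> \<circ> \<tau>) z = z" if "z \<in> S'" for z
      proof -
        have "\<tau> z = \<sigma> z" using e that by (metis restrict_apply')
        thus ?thesis by (simp add: Gal_inv(3)[OF s])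
      qed
      with that show ?thesis using Gal_comp[OF Gal_inv(1)[OF s] t] unfolding L_def by blast
    qed
    hence "\<tau> x = \<sigma> x" if "x \<in> L" for x using that Gal_inv(2)[OF s] by (metis comp_apply)
    thus ?thesis by (auto simp: restrict_def)
  qed
  define h where "h r = restrict (SOME \<sigma>. \<sigma> \<in> carrier Gal \<and> restrict \<sigma> S' = r) L" for r
  have h: "restrict \<sigma> L = h (restrict \<sigma> S')" if s: "\<sigma> \<in> carrier Gal" for \<sigma>
  proof -
    let ?t = "SOME \<tau>. \<tau> \<in> carrier Gal \<and> restrict \<tau> S' = restrict \<sigma> S'"
    have "?t \<in> carrier Gal \<and> restrict ?t S' = restrict \<sigma> S'"
      by (rule someI[of _ \<sigma>]) (use s in simp)
    hence "restrict ?t L = restrict \<sigma> L" using s by (intro dep) simp_all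
    thus ?thesis by (simp add: h_def)
  qed
  have "Gal_on L \<subseteq> h ` (S' \<rightarrow>\<^sub>E S')"
    unfolding Gal_on_def
  proof
    fix r assume "r \<in> (\<lambda>\<sigma>. restrict \<sigma> L) ` carrier Gal"
    then obtain \<sigma> where s: "\<sigma> \<in> carrier Gal" "r = restrict \<sigma> L" by blast
    have "restrict \<sigma> S' \<in> S' \<rightarrow>\<^sub>E S'" using stable[OF s(1)] by simp
    thus "r \<in> h ` (S' \<rightarrow>\<^sub>E S')" unfolding s(2) h[OF s(1)] by (rule imageI)
  qed
  hence "finite (Gal_on L)" using finS by (meson finite_PiE finite_imageI finite_subset)
  moreover have "\<sigma> x \<in> L" if s: "\<sigma> \<in> carrier Gal" and x: "x \<in> L" for \<sigma> x
    unfolding L_def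
  proof (intro CollectI ballI impI)
    fix \<tau> assume t: "\<tau> \<in> carrier Gal" "\<forall>z\<in>S'. \<tau> z = z"
    have "inv_into UNIV \<sigma> \<circ> (\<tau> \<circ> \<sigma>) \<in> carrier Gal" using s t by (intro Gal_comp Gal_inv)
    moreover have "(inv_into UNIV \<sigma> \<circ> (\<tau> \<circ> \<sigma>)) z = z" if "z \<in> S'" for z
      using t stable[OF s that] by (simp add: Gal_inv(3)[OF s])
    ultimately have "inv_into UNIV \<sigma> (\<tau> (\<sigma> x)) = x" using x unfolding L_def by force
    thus "\<tau> (\<sigma> x) = \<sigma> x" using Gal_inv(2)[OF s] by metis
  qed
  moreover have "x + y \<in> L \<and> x * y \<in> L" if "x \<in> L" "y \<in> L" for x y
  proof -
    have "\<tau> (x + y) = x + y \<and> \<tau> (x * y) = x * y"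
      if "\<tau> \<in> carrier Gal" "\<forall>s\<in>S'. \<tau> s = s" for \<tau>
    proof -
      interpret comm_ring_hom \<tau> by (rule comm_ring_hom_Gal[OF that(1)])
      have "\<tau> x = x" "\<tau> y = y" using that \<open>x \<in> L\<close> \<open>y \<in> L\<close> unfolding L_def by blast+
      thus ?thesis by (simp add: hom_add hom_mult)
    qed
    thus ?thesis unfolding L_def by blast
  qed
  moreover have "to_ac c \<in> L" for c unfolding L_def by (simp add: Gal_to_ac)
  ultimately have "finite_galois L" unfolding finite_galois_def by blast
  moreover have "S \<subseteq> L" using SS unfolding L_def by blast
  ultimately show ?thesis by (rule that)
qed

text \<open>Dedekind's argument: evaluating the relation at c x and subtracting \<open>g c\<close>
  times the relation at x removes g. The induction hypothesis applies to the new coefficients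
  \<open>a f * (f c - g c)\<close>, and c is chosen to separate f from g.\<close>

lemma dedekind_independence:
  fixes a :: "('a::monoid_mult \<Rightarrow> 'b::field) \<Rightarrow> 'b"
  assumes "finite R" "1 \<in> L" "\<And>x y. x \<in> L \<Longrightarrow> y \<in> L \<Longrightarrow> x * y \<in> L"
    and "\<And>f x y. f \<in> R \<Longrightarrow> x \<in> L \<Longrightarrow> y \<in> L \<Longrightarrow> f (x * y) = f x * f y"
    and "\<And>f. f \<in> R \<Longrightarrow> f 1 = 1"
    and "\<And>f g. f \<in> R \<Longrightarrow> g \<in> R \<Longrightarrow> f \<noteq> g \<Longrightarrow> \<exists>x\<in>L. f x \<noteq> g x"
    and "\<And>x. x \<in> L \<Longrightarrow> (\<Sum>f\<in>R. a f * f x) = 0"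
  shows "\<forall>f\<in>R. a f = 0"
  using assms(1) assms(4-)
proof (induction R arbitrary: a rule: finite_induct)
  case (insert g R)
  have z: "a f * (f c - g c) = 0" if "f \<in> R" "c \<in> L" for f c
  proof -
    have "\<forall>f\<in>R. a f * (f c - g c) = 0"
    proof (rule insert.IH)
      fix x assume x: "x \<in> L"
      have "(\<Sum>f\<in>R. a f * (f c - g c) * f x) =
          (\<Sum>f\<in>insert g R. a f * (f c * f x)) - g c * (\<Sum>f\<in>insert g R. a f * f x)"
        using insert.hyps by (simp add: sum_distrib_left algebra_simps sum_subtractf)
      also have "(\<Sum>f\<in>insert g R. a f * (f c * f x)) = (\<Sum>f\<in>insert g R. a f * f (c * x))"
        by (intro sum.cong refl) (simp only: insert.prems(1)[OF _ \<open>c \<in> L\<close> x])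
      also have "\<dots> - g c * (\<Sum>f\<in>insert g R. a f * f x) = 0"
        using insert.prems(4)[OF x] insert.prems(4)[OF assms(3)[OF \<open>c \<in> L\<close> x]] by simp
      finally show "(\<Sum>f\<in>R. a f * (f c - g c) * f x) = 0" .
    qed (use insert.prems in blast)+
    thus ?thesis using that by blast
  qed
  have R: "a f = 0" if "f \<in> R" for f
  proof -
    have "f \<noteq> g" using insert.hyps that by blast
    then obtain c where "c \<in> L" "f c \<noteq> g c" using insert.prems(3)[of f g] \<open>f \<in> R\<close> by blast
    thus ?thesis using z[OF that, of c] by simp
  qed
  have "a g = 0" using insert.prems(4)[OF assms(2)] insert.prems(2)[of g] insert.hyps R by simp
  with R show ?case by blast
qed simp

lemma restrict_in_Gal_on: "\<sigma> \<in> carrier Gal \<Longrightarrow> restrict \<sigma> L \<in> Gal_on L"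
  by (simp add: Gal_on_def)

context
  fixes L :: "'k::field alg_closure set"
  assumes L: "finite_galois L"
begin

lemma finite_galois_closed: "to_ac c \<in> L" "x \<in> L \<Longrightarrow> y \<in> L \<Longrightarrow> x * y \<in> L"
    "\<sigma> \<in> carrier Gal \<Longrightarrow> x \<in> L \<Longrightarrow> \<sigma> x \<in> L" "finite (Gal_on L)"
  using L unfolding finite_galois_def by auto

lemma finite_galois_0: "0 \<in> L" and finite_galois_1: "1 \<in> L"
  using finite_galois_closed(1)[of 0] finite_galois_closed(1)[of 1] by simp_all

lemma Gal_on_nonvanishing:
  assumes "r\<^sub>0 \<in> Gal_on L" "a r\<^sub>0 \<noteq> 0"
  obtains c where "c \<in> L" "(\<Sum>r\<in>Gal_on L. a r * r c) \<noteq> 0"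
proof -
  have "\<exists>c\<in>L. (\<Sum>r\<in>Gal_on L. a r * r c) \<noteq> 0"
  proof (rule ccontr)
    assume "\<not> (\<exists>c\<in>L. (\<Sum>r\<in>Gal_on L. a r * r c) \<noteq> 0)"
    hence van: "(\<Sum>r\<in>Gal_on L. a r * r c) = 0" if "c \<in> L" for c using that by blast
    have "\<forall>r\<in>Gal_on L. a r = 0"
    proof (rule dedekind_independence[where L = L])
      fix r x y assume "r \<in> Gal_on L" "x \<in> L" "y \<in> L"
      thus "r (x * y) = r x * r y" by (auto simp: Gal_on_def Gal_iff finite_galois_closed)
    next
      fix r assume "r \<in> Gal_on L"
      thus "r 1 = 1" using Gal_to_ac[of _ 1] finite_galois_1 by (auto simp: Gal_on_def)
    next
      fix r s assume "r \<in> Gal_on L" "s \<in> Gal_on L" "r \<noteq> s"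
      thus "\<exists>x\<in>L. r x \<noteq> s x" by (auto simp: Gal_on_def restrict_def fun_eq_iff) metis
    qed (use van finite_galois_closed finite_galois_1 in auto)
    thus False using assms by blast
  qed
  thus ?thesis using that by blast
qed

text \<open>Left translation is injective on the finite set \<open>Gal_on L\<close>, hence permutes
  it.\<close>

lemma Gal_on_shift:
  assumes "\<sigma> \<in> carrier Gal"
  shows "(\<Sum>r\<in>Gal_on L. f (restrict (\<sigma> \<circ> r) L)) = (\<Sum>r\<in>Gal_on L. f r)"
proof -
  let ?t = "\<lambda>r. restrict (\<sigma> \<circ> r) L"
  have t: "?t (restrict \<tau> L) = restrict (\<sigma> \<circ> \<tau>) L" for \<tau> by (auto simp: restrict_def)
  have into: "?t ` Gal_on L \<subseteq> Gal_on L"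
    using Gal_comp[OF assms] unfolding Gal_on_def image_image t by blast
  have "inj_on ?t (Gal_on L)"
  proof (rule inj_onI)
    fix r s assume rs: "r \<in> Gal_on L" "s \<in> Gal_on L" and e: "?t r = ?t s"
    have "r x = s x" for x
    proof (cases "x \<in> L")
      case True
      hence "\<sigma> (r x) = \<sigma> (s x)" using fun_cong[OF e, of x] by simp
      thus ?thesis using assms by (simp add: Gal_inj)
    qed (use rs in \<open>auto simp: Gal_on_def\<close>)
    thus "r = s" by blast
  qed
  hence "bij_betw ?t (Gal_on L) (Gal_on L)"
    using endo_inj_surj[OF finite_galois_closed(4) into] by (simp add: bij_betw_def)
  thus ?thesis by (rule sum.reindex_bij_betw)
qed

text \<open>Translation invariance makes the trace a fixed element, and over a perfect field fixed
  elements lie in k.\<close>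

lemma Gal_on_trace:
  assumes "perfect TYPE('k)" "x \<in> L"
  shows "(\<Sum>r\<in>Gal_on L. r x) \<in> base_field"
proof (rule fixed_field_Gal[OF assms(1)])
  fix \<sigma> :: "'k alg_closure \<Rightarrow> _" assume s: "\<sigma> \<in> carrier Gal"
  interpret comm_ring_hom \<sigma> by (rule comm_ring_hom_Gal[OF s])
  show "\<sigma> (\<Sum>r\<in>Gal_on L. r x) = (\<Sum>r\<in>Gal_on L. r x)"
    using Gal_on_shift[OF s, of "\<lambda>r. r x"] assms(2) by (simp add: hom_sum)
qed

end

text \<open>Continuity is assumed at the identity; the cocycle relation spreads it, so that
  \<open>\<chi>\<close> factors through a finite group. The Lagrange resolvent b, the sum of
  \<open>\<chi>' r * r c\<close>, is then permuted termwise by b to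
  \<open>\<chi> \<sigma> * \<sigma> b\<close>, and c makes it non-zero.\<close>

lemma hilbert90:
  fixes \<chi> :: "('k::field alg_closure \<Rightarrow> 'k alg_closure) \<Rightarrow> 'k alg_closure"
  assumes nz: "\<And>\<sigma>. \<sigma> \<in> carrier Gal \<Longrightarrow> \<chi> \<sigma> \<noteq> 0"
    and cocycle: "\<And>\<sigma> \<tau>. \<sigma> \<in> carrier Gal \<Longrightarrow> \<tau> \<in> carrier Gal \<Longrightarrow> \<chi> (\<sigma> \<circ> \<tau>) = \<chi> \<sigma> * \<sigma> (\<chi> \<tau>)"
    and cont: "finite S" "\<And>\<tau>. \<tau> \<in> carrier Gal \<Longrightarrow> (\<forall>s\<in>S. \<tau> s = s) \<Longrightarrow> \<chi> \<tau> = 1"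
  obtains b where "b \<noteq> 0" "\<And>\<sigma>. \<sigma> \<in> carrier Gal \<Longrightarrow> \<chi> \<sigma> * \<sigma> b = b"
proof -
  obtain L where L: "finite_galois L" "S \<subseteq> L" using finite_subset_finite_galois[OF cont(1)] .
  \<comment> \<open>Write \<open>\<tau> = \<sigma> \<circ> ?\<rho>\<close>, where
    \<open>?\<rho>\<close> fixes S; the cocycle relation multiplies \<open>\<chi> \<sigma>\<close>
    by \<open>\<sigma> 1\<close>.\<close>
  have dep: "\<chi> \<sigma> = \<chi> \<tau>" if s: "\<sigma> \<in> carrier Gal" and t: "\<tau> \<in> carrier Gal" and e: "restrict \<sigma> L = restrict \<tau> L" for \<sigma> \<tau>
  proof -
    let ?\<rho> = "inv_into UNIV \<sigma> \<circ> \<tau>"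
    have r: "?\<rho> \<in> carrier Gal" by (intro Gal_comp Gal_inv s t)
    have "?\<rho> z = z" if "z \<in> S" for z
    proof -
      have "\<tau> z = \<sigma> z" using e that L(2) by (metis restrict_apply' subsetD)
      thus ?thesis by (simp add: Gal_inv(3)[OF s])
    qed
    hence "\<chi> ?\<rho> = 1" using cont(2)[OF r] by blast
    moreover have "\<sigma> \<circ> ?\<rho> = \<tau>" by (auto simp: Gal_inv(2)[OF s])
    ultimately show ?thesis using cocycle[OF s r] Gal_to_ac[OF s, of 1] by simp
  qed
  define \<chi>' where "\<chi>' r = \<chi> (SOME \<sigma>. \<sigma> \<in> carrier Gal \<and> restrict \<sigma> L = r)" for r
  have \<chi>': "\<chi>' (restrict \<sigma> L) = \<chi> \<sigma>" if s: "\<sigma> \<in> carrier Gal" for \<sigma>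
  proof -
    let ?t = "SOME \<tau>. \<tau> \<in> carrier Gal \<and> restrict \<tau> L = restrict \<sigma> L"
    have "?t \<in> carrier Gal \<and> restrict ?t L = restrict \<sigma> L"
      by (rule someI[of _ \<sigma>]) (use s in simp)
    hence "\<chi> ?t = \<chi> \<sigma>" using s by (intro dep) simp_all
    thus ?thesis by (simp add: \<chi>'_def)
  qed
  have "\<chi>' (restrict id L) \<noteq> 0" using nz[OF Gal_id(1)] \<chi>'[OF Gal_id(1)] by simp
  then obtain c where c: "c \<in> L" "(\<Sum>r\<in>Gal_on L. \<chi>' r * r c) \<noteq> 0"
    using Gal_on_nonvanishing[OF L(1) restrict_in_Gal_on[OF Gal_id(1)], of \<chi>'] by blast
  define b where "b = (\<Sum>r\<in>Gal_on L. \<chi>' r * r c)"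
  have "\<chi> \<sigma> * \<sigma> b = b" if s: "\<sigma> \<in> carrier Gal" for \<sigma>
  proof -
    interpret comm_ring_hom \<sigma> by (rule comm_ring_hom_Gal[OF s])
    have "\<chi> \<sigma> * \<sigma> b = (\<Sum>r\<in>Gal_on L. \<chi> \<sigma> * \<sigma> (\<chi>' r) * \<sigma> (r c))"
      unfolding b_def by (simp add: hom_sum hom_mult sum_distrib_left mult.assoc)
    also have "\<dots> = (\<Sum>r\<in>Gal_on L. \<chi>' (restrict (\<sigma> \<circ> r) L) * restrict (\<sigma> \<circ> r) L c)"
    proof (intro sum.cong refl)
      fix r assume "r \<in> Gal_on L"
      then obtain \<tau> where t: "\<tau> \<in> carrier Gal" "r = restrict \<tau> L" unfolding Gal_on_def by blast
      have "restrict (\<sigma> \<circ> r) L = restrict (\<sigma> \<circ> \<tau>) L" unfolding t(2) by (auto simp: restrict_def)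
      thus "\<chi> \<sigma> * \<sigma> (\<chi>' r) * \<sigma> (r c) = \<chi>' (restrict (\<sigma> \<circ> r) L) * restrict (\<sigma> \<circ> r) L c"
        using \<chi>'[OF t(1)] \<chi>'[OF Gal_comp[OF s t(1)]] cocycle[OF s t(1)] c(1) by (simp add: t(2))
    qed
    also have "\<dots> = b" unfolding b_def using Gal_on_shift[OF L(1) s, of "\<lambda>r. \<chi>' r * r c"] by simp
    finally show ?thesis .
  qed
  with c(2) that show ?thesis unfolding b_def by blast
qed

section \<open>Projective linear groups and cohomology classes\<close>

lemma diagonal_hilbert90:
  fixes \<chi> :: "('k::field alg_closure \<Rightarrow> 'k alg_closure) \<Rightarrow> nat \<Rightarrow> 'k alg_closure"
  assumes nz: "\<And>\<sigma> i. \<sigma> \<in> carrier Gal \<Longrightarrow> \<chi> \<sigma> i \<noteq> 0"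
    and one: "\<And>\<sigma>. \<sigma> \<in> carrier Gal \<Longrightarrow> \<chi> \<sigma> 0 = 1"
    and cocycle: "\<And>\<sigma> \<tau> i. \<sigma> \<in> carrier Gal \<Longrightarrow> \<tau> \<in> carrier Gal \<Longrightarrow> i \<le> n \<Longrightarrow> \<chi> (\<sigma> \<circ> \<tau>) i = \<chi> \<sigma> i * \<sigma> (\<chi> \<tau> i)"
    and cont: "finite S" "\<And>\<tau> i. \<tau> \<in> carrier Gal \<Longrightarrow> (\<forall>s\<in>S. \<tau> s = s) \<Longrightarrow> i \<le> n \<Longrightarrow> \<chi> \<tau> i = 1"
  obtains B where "B 0 = 1" "\<And>i. B i \<noteq> 0" "\<And>\<sigma> i. \<sigma> \<in> carrier Gal \<Longrightarrow> i \<le> n \<Longrightarrow> \<chi> \<sigma> i * \<sigma> (B i) = B i"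
proof -
  \<comment> \<open>Indices above n receive the value 1, so that B is nowhere zero.\<close>
  have "\<exists>b. b \<noteq> 0 \<and> (\<forall>\<sigma>\<in>carrier Gal. i \<le> n \<longrightarrow> \<chi> \<sigma> i * \<sigma> b = b)" for i
  proof (cases "i \<le> n")
    case True
    obtain b where "b \<noteq> 0" "\<And>\<sigma>. \<sigma> \<in> carrier Gal \<Longrightarrow> \<chi> \<sigma> i * \<sigma> b = b"
    proof (rule hilbert90[of "\<lambda>\<sigma>. \<chi> \<sigma> i" S])
      show "\<chi> \<sigma> i \<noteq> 0" if "\<sigma> \<in> carrier Gal" for \<sigma> using nz that .
      show "\<chi> (\<sigma> \<circ> \<tau>) i = \<chi> \<sigma> i * \<sigma> (\<chi> \<tau> i)" if "\<sigma> \<in> carrier Gal" "\<tau> \<in> carrier Gal" for \<sigma> \<tau>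
        using cocycle that True .
      show "finite S" by (rule cont(1))
      show "\<chi> \<tau> i = 1" if "\<tau> \<in> carrier Gal" "\<forall>s\<in>S. \<tau> s = s" for \<tau> using cont(2) that True .
    qed blast
    thus ?thesis by blast
  qed (auto intro: exI[of _ 1])
  then obtain B where B: "\<And>i. B i \<noteq> 0" "\<And>\<sigma> i. \<sigma> \<in> carrier Gal \<Longrightarrow> i \<le> n \<Longrightarrow> \<chi> \<sigma> i * \<sigma> (B i) = B i"
    by metis
  show ?thesis
  \<comment> \<open>Resetting the leading entry preserves the relation because
    \<open>\<chi> \<sigma> 0 = 1\<close>.\<close>
  proof (rule that[of "B(0 := 1)"])
    fix \<sigma> :: "'k alg_closure \<Rightarrow> _" and i assume "\<sigma> \<in> carrier Gal" "i \<le> n"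
    thus "\<chi> \<sigma> i * \<sigma> ((B(0 := 1)) i) = (B(0 := 1)) i"
      using B(2) one[of \<sigma>] Gal_to_ac[of \<sigma> 1] by simp
  qed (use B in auto)
qed

section \<open>Matrix classes and the Galois action on them\<close>

lemma GL_group: "group (GL n)"
proof -
  interpret ring "ring_mat TYPE('a::field) (Suc n) ()" by (rule ring_mat)
  show "group (GL n :: 'a mat monoid)" unfolding GL_def by (rule units_group)
qed

lemma GL_simps: "A \<otimes>\<^bsub>GL n\<^esub> B = A * B" "\<one>\<^bsub>GL n\<^esub> = 1\<^sub>m (Suc n)"
  by (simp_all add: GL_def units_of_def ring_mat_simps)

lemma GL_carrier_iff:
  "A \<in> carrier (GL n) \<longleftrightarrow> A \<in> carrier_mat (Suc n) (Suc n) \<and>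
     (\<exists>B\<in>carrier_mat (Suc n) (Suc n). B * A = 1\<^sub>m (Suc n) \<and> A * B = 1\<^sub>m (Suc n))"
  by (simp add: GL_def units_of_def Units_def ring_mat_simps)

lemma GL_carrier_mat: "A \<in> carrier (GL n) \<Longrightarrow> A \<in> carrier_mat (Suc n) (Suc n)"
  by (simp add: GL_carrier_iff)

lemma mat_diag_in_GL:
  assumes "\<And>i. i \<le> n \<Longrightarrow> f i \<noteq> (0::'a::field)"
  shows "mat_diag (Suc n) f \<in> carrier (GL n)"
  unfolding GL_carrier_iff
proof (intro conjI bexI[of _ "mat_diag (Suc n) (\<lambda>i. inverse (f i))"])
  have "mat_diag (Suc n) (\<lambda>i. inverse (f i) * f i) = mat_diag (Suc n) (\<lambda>i. 1)"
    "mat_diag (Suc n) (\<lambda>i. f i * inverse (f i)) = mat_diag (Suc n) (\<lambda>i. 1)"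
    using assms by (auto simp: mat_diag_def less_Suc_eq_le intro!: eq_matI)
  thus "mat_diag (Suc n) (\<lambda>i. inverse (f i)) * mat_diag (Suc n) f = 1\<^sub>m (Suc n)"
    "mat_diag (Suc n) f * mat_diag (Suc n) (\<lambda>i. inverse (f i)) = 1\<^sub>m (Suc n)" by simp_all
qed auto

lemma smult_1_mult:
  "A \<in> carrier_mat (Suc n) k \<Longrightarrow> (c \<cdot>\<^sub>m 1\<^sub>m (Suc n)) * A = c \<cdot>\<^sub>m (A :: 'a::comm_ring_1 mat)"
  "A \<in> carrier_mat k (Suc n) \<Longrightarrow> A * (c \<cdot>\<^sub>m 1\<^sub>m (Suc n)) = c \<cdot>\<^sub>m A"
proof -
  show "(c \<cdot>\<^sub>m 1\<^sub>m (Suc n)) * A = c \<cdot>\<^sub>m A" if "A \<in> carrier_mat (Suc n) k"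
    using mult_smult_assoc_mat[of "1\<^sub>m (Suc n)" "Suc n" "Suc n" A k c] that by simp
  show "A * (c \<cdot>\<^sub>m 1\<^sub>m (Suc n)) = c \<cdot>\<^sub>m A" if "A \<in> carrier_mat k (Suc n)"
    using mult_smult_distrib[of A k "Suc n" "1\<^sub>m (Suc n)" "Suc n" c] that by simp
qed

lemma scalar_matsI: "c \<noteq> 0 \<Longrightarrow> c \<cdot>\<^sub>m 1\<^sub>m (Suc n) \<in> scalar_mats n"
  unfolding scalar_mats_def by blast

lemma scalar_mats_subset: "scalar_mats n \<subseteq> carrier (GL n)"
proof
  fix A :: "'a mat" assume "A \<in> scalar_mats n"
  then obtain c where c: "c \<noteq> 0" "A = c \<cdot>\<^sub>m 1\<^sub>m (Suc n)" unfolding scalar_mats_def by blast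
  have "A = mat_diag (Suc n) (\<lambda>i. c)" unfolding c(2) by (auto simp: mat_diag_def intro!: eq_matI)
  thus "A \<in> carrier (GL n)" using c(1) by (simp add: mat_diag_in_GL)
qed

lemma pgl_class_eq:
  "A \<in> carrier_mat (Suc n) (Suc n) \<Longrightarrow> pgl_class n A = {c \<cdot>\<^sub>m A | c. c \<noteq> 0}"
  unfolding pgl_class_def r_coset_def scalar_mats_def by (auto simp: GL_simps smult_1_mult)

text \<open>Scalar matrices are central, so left and right cosets coincide.\<close>

lemma scalar_mats_normal: "(scalar_mats n :: 'a::field mat set) \<lhd> GL n"
proof -
  interpret group "GL n :: 'a mat monoid" by (rule GL_group)
  have "subgroup (scalar_mats n :: 'a mat set) (GL n)"
  proof (rule subgroupI)
    show "scalar_mats n \<noteq> ({} :: 'a mat set)" using scalar_matsI[OF one_neq_zero] by (metis empty_iff)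
  next
    fix A :: "'a mat" assume A: "A \<in> scalar_mats n"
    then obtain c :: 'a where c: "c \<noteq> 0" "A = c \<cdot>\<^sub>m 1\<^sub>m (Suc n)" unfolding scalar_mats_def by blast
    have "(inverse c \<cdot>\<^sub>m 1\<^sub>m (Suc n)) \<otimes>\<^bsub>GL n\<^esub> A = \<one>\<^bsub>GL n\<^esub>"
      using c(1) unfolding GL_simps c(2) by (subst smult_1_mult(1)[of _ _ "Suc n"]) (auto intro!: eq_matI)
    moreover have "inverse c \<cdot>\<^sub>m 1\<^sub>m (Suc n) \<in> scalar_mats n"
      using c(1) by (intro scalar_matsI) simp
    ultimately show "inv\<^bsub>GL n\<^esub> A \<in> scalar_mats n"
      using A scalar_mats_subset inv_equality by (metis subsetD)
  next
    fix A B :: "'a mat" assume "A \<in> scalar_mats n" "B \<in> scalar_mats n"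
    then obtain c e where c: "c \<noteq> 0" "A = c \<cdot>\<^sub>m 1\<^sub>m (Suc n)" and e: "e \<noteq> 0" "B = e \<cdot>\<^sub>m 1\<^sub>m (Suc n)"
      unfolding scalar_mats_def by blast
    have "A \<otimes>\<^bsub>GL n\<^esub> B = (c * e) \<cdot>\<^sub>m 1\<^sub>m (Suc n)"
      unfolding GL_simps c(2) e(2) by (subst smult_1_mult(1)[of _ _ "Suc n"]) (auto intro!: eq_matI)
    thus "A \<otimes>\<^bsub>GL n\<^esub> B \<in> scalar_mats n"
      using c(1) e(1) scalar_matsI[of "c * e" n] by simp
  qed (rule scalar_mats_subset)
  moreover have "scalar_mats n #>\<^bsub>GL n\<^esub> A = A <#\<^bsub>GL n\<^esub> scalar_mats n" if "A \<in> carrier (GL n)" for A :: "'a mat"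
    using GL_carrier_mat[OF that] unfolding r_coset_def l_coset_def scalar_mats_def
    by (auto simp: GL_simps smult_1_mult)
  ultimately show ?thesis by (intro normalI) auto
qed

lemma PGL_group: "group (PGL n)"
  unfolding PGL_def by (rule normal.factorgroup_is_group[OF scalar_mats_normal])

lemma PGL_carrier: "carrier (PGL n) = pgl_class n ` carrier (GL n)"
  unfolding PGL_def FactGroup_def RCOSETS_def pgl_class_def by auto

lemma pgl_class_mult:
  "A \<in> carrier (GL n) \<Longrightarrow> B \<in> carrier (GL n) \<Longrightarrow>
     pgl_class n A \<otimes>\<^bsub>PGL n\<^esub> pgl_class n B = pgl_class n (A * B)"
  using normal.rcos_sum[OF scalar_mats_normal, of A n B]
  unfolding PGL_def FactGroup_def pgl_class_def by (simp add: GL_simps)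

lemma pgl_class_one: "pgl_class n (1\<^sub>m (Suc n)) = \<one>\<^bsub>PGL n\<^esub>"
  by (simp add: pgl_class_eq PGL_def FactGroup_def scalar_mats_def)

lemma pgl_class_eqD:
  assumes "pgl_class n A = pgl_class n B" "A \<in> carrier_mat (Suc n) (Suc n)" "B \<in> carrier_mat (Suc n) (Suc n)"
  obtains c where "c \<noteq> 0" "A = c \<cdot>\<^sub>m B"
proof -
  have "A = 1 \<cdot>\<^sub>m A" by (auto intro!: eq_matI)
  hence "A \<in> pgl_class n A" unfolding pgl_class_eq[OF assms(2)] using one_neq_zero by blast
  thus ?thesis using that unfolding assms(1) pgl_class_eq[OF assms(3)] by blast
qed

text \<open>The leading entry 1 removes the scalar ambiguity. This is what turns identities between
  projective classes into identities between entries.\<close>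

lemma pgl_class_mat_diag_eqD:
  assumes "pgl_class n (mat_diag (Suc n) f) = pgl_class n (mat_diag (Suc n) g)"
    and "f 0 = 1" "g 0 = (1 :: 'a::field)" "i \<le> n"
  shows "f i = g i"
proof -
  obtain c where c: "mat_diag (Suc n) f = c \<cdot>\<^sub>m mat_diag (Suc n) g"
    using pgl_class_eqD[OF assms(1)] by auto
  have "f j = c * g j" if "j \<le> n" for j
    using arg_cong[OF c, of "\<lambda>M. M $$ (j, j)"] that by (simp add: mat_diag_def)
  from this[of 0] this[of i] show ?thesis using assms(2-4) by simp
qed

lemma map_mat_Gal_GL:
  assumes "\<sigma> \<in> carrier Gal" "A \<in> carrier (GL n)"
  shows "map_mat \<sigma> A \<in> carrier (GL n)"
proof -
  interpret comm_ring_hom \<sigma> by (rule comm_ring_hom_Gal[OF assms(1)])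
  from assms(2) obtain B where A: "A \<in> carrier_mat (Suc n) (Suc n)" and B: "B \<in> carrier_mat (Suc n) (Suc n)"
    "B * A = 1\<^sub>m (Suc n)" "A * B = 1\<^sub>m (Suc n)" unfolding GL_carrier_iff by blast
  have "map_mat \<sigma> B * map_mat \<sigma> A = 1\<^sub>m (Suc n)" "map_mat \<sigma> A * map_mat \<sigma> B = 1\<^sub>m (Suc n)"
    using A B by (metis mat_hom_mult mat_hom_one)+
  thus ?thesis using A B unfolding GL_carrier_iff by auto
qed

lemma gal_pgl_class:
  assumes "\<sigma> \<in> carrier Gal" "A \<in> carrier_mat (Suc n) (Suc n)"
  shows "gal_pgl \<sigma> (pgl_class n A) = pgl_class n (map_mat \<sigma> A)"
proof -
  interpret comm_ring_hom \<sigma> by (rule comm_ring_hom_Gal[OF assms(1)])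
  have smult: "map_mat \<sigma> (c \<cdot>\<^sub>m A) = \<sigma> c \<cdot>\<^sub>m map_mat \<sigma> A" for c
    by (auto simp: hom_mult intro!: eq_matI)
  have "gal_pgl \<sigma> (pgl_class n A) = {\<sigma> c \<cdot>\<^sub>m map_mat \<sigma> A | c. c \<noteq> 0}"
    unfolding gal_pgl_def pgl_class_eq[OF assms(2)] by (auto simp flip: smult)
  also have "\<dots> = {c \<cdot>\<^sub>m map_mat \<sigma> A | c. c \<noteq> 0}"
    using Gal_inv[OF assms(1)] Gal_eq_0[OF assms(1)] by (metis (no_types, opaque_lifting))
  also have "\<dots> = pgl_class n (map_mat \<sigma> A)" using assms(2) by (subst pgl_class_eq) auto
  finally show ?thesis .
qed

lemma gal_pgl_hom:
  fixes \<sigma> :: "'k::field alg_closure \<Rightarrow> 'k alg_closure"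
  assumes "\<sigma> \<in> carrier Gal"
  shows "gal_pgl \<sigma> \<in> hom (PGL n) (PGL n)"
proof (rule homI)
  interpret comm_ring_hom \<sigma> by (rule comm_ring_hom_Gal[OF assms])
  interpret GL: group "GL n :: 'k alg_closure mat monoid" by (rule GL_group)
  fix g :: "'k alg_closure mat set" assume "g \<in> carrier (PGL n)"
  then obtain A where A: "A \<in> carrier (GL n)" "g = pgl_class n A" unfolding PGL_carrier by blast
  show "gal_pgl \<sigma> g \<in> carrier (PGL n)"
    using map_mat_Gal_GL[OF assms A(1)] by (simp add: A(2) gal_pgl_class[OF assms] GL_carrier_mat[OF A(1)] PGL_carrier)
  fix h :: "'k alg_closure mat set" assume "h \<in> carrier (PGL n)"
  then obtain B where B: "B \<in> carrier (GL n)" "h = pgl_class n B" unfolding PGL_carrier by blast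
  have "A * B \<in> carrier (GL n)" using GL.m_closed[OF A(1) B(1)] by (simp add: GL_simps)
  thus "gal_pgl \<sigma> (g \<otimes>\<^bsub>PGL n\<^esub> h) = gal_pgl \<sigma> g \<otimes>\<^bsub>PGL n\<^esub> gal_pgl \<sigma> h"
    using A B mat_hom_mult[OF GL_carrier_mat[OF A(1)] GL_carrier_mat[OF B(1)]]
    by (simp add: pgl_class_mult gal_pgl_class[OF assms] GL_carrier_mat map_mat_Gal_GL[OF assms])
qed

section \<open>Cohomology classes and triviality of the map to PGL\<close>

lemma cohomologous_sym_trans:
  assumes "group G" "\<And>\<sigma>. \<sigma> \<in> carrier Gal \<Longrightarrow> act \<sigma> \<in> hom G G"
  shows "sym (cohomologous G act)" "trans (cohomologous G act)"
proof -
  interpret group G by fact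
  have ah: "group_hom G G (act \<sigma>)" if "\<sigma> \<in> carrier Gal" for \<sigma>
    using assms(2)[OF that] by unfold_locales
  have Zc: "\<xi> \<sigma> \<in> carrier G" if "\<xi> \<in> Z1 G act" "\<sigma> \<in> carrier Gal" for \<xi> \<sigma>
    using that unfolding Z1_def by (auto simp: PiE_def Pi_def)
  show "sym (cohomologous G act)"
  proof (rule symI)
    fix \<xi> \<eta> assume "(\<xi>, \<eta>) \<in> cohomologous G act"
    then obtain b where b: "b \<in> carrier G" and Z: "\<xi> \<in> Z1 G act" "\<eta> \<in> Z1 G act"
      and e: "\<And>\<sigma>. \<sigma> \<in> carrier Gal \<Longrightarrow> \<eta> \<sigma> = inv\<^bsub>G\<^esub> b \<otimes>\<^bsub>G\<^esub> \<xi> \<sigma> \<otimes>\<^bsub>G\<^esub> act \<sigma> b"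
      unfolding cohomologous_def by blast
    have "\<xi> \<sigma> = inv\<^bsub>G\<^esub> (inv\<^bsub>G\<^esub> b) \<otimes>\<^bsub>G\<^esub> \<eta> \<sigma> \<otimes>\<^bsub>G\<^esub> act \<sigma> (inv\<^bsub>G\<^esub> b)" if s: "\<sigma> \<in> carrier Gal" for \<sigma>
    proof -
      interpret h: group_hom G G "act \<sigma>" by (rule ah[OF s])
      show ?thesis unfolding e[OF s] using b Zc[OF Z(1) s]
        by (simp add: m_assoc) (simp flip: m_assoc)
    qed
    thus "(\<eta>, \<xi>) \<in> cohomologous G act" unfolding cohomologous_def using inv_closed[OF b] Z by blast
  qed
  show "trans (cohomologous G act)"
  proof (rule transI)
    fix \<xi> \<eta> \<theta> assume "(\<xi>, \<eta>) \<in> cohomologous G act" "(\<eta>, \<theta>) \<in> cohomologous G act"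
    then obtain b c where b: "b \<in> carrier G" and Z: "\<xi> \<in> Z1 G act" "\<eta> \<in> Z1 G act" "\<theta> \<in> Z1 G act"
      and e: "\<And>\<sigma>. \<sigma> \<in> carrier Gal \<Longrightarrow> \<eta> \<sigma> = inv\<^bsub>G\<^esub> b \<otimes>\<^bsub>G\<^esub> \<xi> \<sigma> \<otimes>\<^bsub>G\<^esub> act \<sigma> b"
      and c: "c \<in> carrier G"
      and e': "\<And>\<sigma>. \<sigma> \<in> carrier Gal \<Longrightarrow> \<theta> \<sigma> = inv\<^bsub>G\<^esub> c \<otimes>\<^bsub>G\<^esub> \<eta> \<sigma> \<otimes>\<^bsub>G\<^esub> act \<sigma> c"
      unfolding cohomologous_def by blast
    have "\<theta> \<sigma> = inv\<^bsub>G\<^esub> (b \<otimes>\<^bsub>G\<^esub> c) \<otimes>\<^bsub>G\<^esub> \<xi> \<sigma> \<otimes>\<^bsub>G\<^esub> act \<sigma> (b \<otimes>\<^bsub>G\<^esub> c)" if s: "\<sigma> \<in> carrier Gal" for \<sigma>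
    proof -
      interpret h: group_hom G G "act \<sigma>" by (rule ah[OF s])
      show ?thesis unfolding e'[OF s] e[OF s] using b c Zc[OF Z(1) s]
        by (simp add: m_assoc inv_mult_group)
    qed
    thus "(\<xi>, \<theta>) \<in> cohomologous G act" unfolding cohomologous_def using m_closed[OF b c] Z by blast
  qed
qed

lemma constant_cocycle:
  assumes "group G" "\<And>\<sigma>. \<sigma> \<in> carrier Gal \<Longrightarrow> act \<sigma> \<one>\<^bsub>G\<^esub> = \<one>\<^bsub>G\<^esub>"
  shows "(\<lambda>\<sigma>\<in>carrier Gal. \<one>\<^bsub>G\<^esub>) \<in> Z1 G act"
proof -
  interpret group G by fact
  show ?thesis unfolding Z1_def krull_continuous_def
    using assms(2) by (auto simp: Gal_comp intro!: exI[of _ "{}"])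
qed


text \<open>Exponents may be reduced modulo m since all entries are m-th roots of unity. The bound
  on j makes the set of possible values finite, on which the continuity of the twist cocycle
  rests.\<close>

lemma generate_diagonal_cyclic:
  fixes \<zeta> :: "'a::field" and a :: "nat \<Rightarrow> nat"
  assumes \<zeta>: "\<zeta> ^ m = 1" "m > 0"
    and g: "g \<in> generate (PGL n) {pgl_class n (mat_diag (Suc n) (\<lambda>i. if i = 0 then 1 else \<zeta> ^ a i))}"
  obtains j where "j < m" "g = pgl_class n (mat_diag (Suc n) (\<lambda>i. if i = 0 then 1 else (\<zeta> ^ a i) ^ j))"
proof -
  let ?D = "\<lambda>j. mat_diag (Suc n) (\<lambda>i. if i = 0 then 1 else (\<zeta> ^ a i) ^ j)"
  have nz: "\<zeta> \<noteq> 0" using \<zeta> by (auto simp: power_0_left)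
  have D_GL: "?D j \<in> carrier (GL n)" for j
    using nz by (intro mat_diag_in_GL) auto
  have D_mult: "pgl_class n (?D j) \<otimes>\<^bsub>PGL n\<^esub> pgl_class n (?D k) = pgl_class n (?D (j + k))" for j k
  proof -
    have "?D j * ?D k = ?D (j + k)"
      unfolding mat_diag_diag by (rule arg_cong[of _ _ "mat_diag (Suc n)"]) (auto simp: power_add)
    thus ?thesis using pgl_class_mult[OF D_GL D_GL] by simp
  qed
  have pw: "(\<zeta> ^ a i) ^ (q * m) = 1" for i q
  proof -
    have "(\<zeta> ^ a i) ^ (q * m) = (\<zeta> ^ m) ^ (a i * q)" by (simp add: mult_ac flip: power_mult)
    thus ?thesis using \<zeta> by simp
  qed
  have D_cong: "?D j = ?D (j mod m)" for j
  proof -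
    have e: "(\<zeta> ^ a i) ^ j = (\<zeta> ^ a i) ^ (j mod m)" for i
    proof -
      have "(\<zeta> ^ a i) ^ j = (\<zeta> ^ a i) ^ (j div m * m + j mod m)" by simp
      thus ?thesis unfolding power_add pw by simp
    qed
    show ?thesis by (intro arg_cong[of _ _ "mat_diag (Suc n)"] ext if_cong refl e)
  qed
  have D0: "pgl_class n (?D 0) = \<one>\<^bsub>PGL n\<^esub>"
  proof -
    have "?D 0 = 1\<^sub>m (Suc n)" by (simp flip: mat_diag_one cong: if_cong)
    thus ?thesis using pgl_class_one by simp
  qed
  interpret group "PGL n :: 'a mat set monoid" by (rule PGL_group)
  have "\<exists>j. g = pgl_class n (?D j)"
    using g
  proof (induction rule: generate.induct)
    case one
    show ?case using D0 by metis
  next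
    case (incl h)
    hence "h = pgl_class n (?D 1)" by (simp cong: if_cong)
    thus ?case by blast
  next
    case (inv h)
    have h: "h = pgl_class n (?D 1)" using inv by (simp cong: if_cong)
    \<comment> \<open>The inverse of the generator is its power with exponent m - 1.\<close>
    have "pgl_class n (?D (m - 1)) \<otimes>\<^bsub>PGL n\<^esub> h = \<one>\<^bsub>PGL n\<^esub>"
    proof -
      have "m - 1 + 1 = m" using \<zeta>(2) by simp
      thus ?thesis unfolding h D_mult using D_cong[of m] D0 by (simp only: mod_self)
    qed
    moreover have "h \<in> carrier (PGL n)" "pgl_class n (?D (m - 1)) \<in> carrier (PGL n)"
      unfolding h PGL_carrier using D_GL by blast+
    ultimately have "inv\<^bsub>PGL n\<^esub> h = pgl_class n (?D (m - 1))" by (rule inv_equality)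
    thus ?case by blast
  next
    case (eng h1 h2)
    then obtain j k where "h1 = pgl_class n (?D j)" "h2 = pgl_class n (?D k)" by blast
    thus ?case using D_mult by blast
  qed
  then obtain j where "g = pgl_class n (?D j)" by blast
  hence "g = pgl_class n (?D (j mod m))" using D_cong[of j] by simp
  thus ?thesis using \<zeta>(2) by (intro that[of "j mod m"]) simp_all
qed

lemma Sigma_map_diagonal_trivial:
  fixes \<zeta> :: "'k::field alg_closure" and a :: "nat \<Rightarrow> nat" and n m :: nat
  defines "C \<equiv> generate (PGL n) {pgl_class n (mat_diag (Suc n) (\<lambda>i. if i = 0 then 1 else \<zeta> ^ a i))}"
  defines "A \<equiv> (PGL n)\<lparr>carrier := C\<rparr>"
  assumes \<zeta>: "\<zeta> ^ m = 1" "m > 0"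
  shows "Sigma_map n ` H1 A gal_pgl = {H1_trivial (PGL n) gal_pgl}"
proof -
  interpret P: group "PGL n :: 'k alg_closure mat set monoid" by (rule PGL_group)
  have nz: "\<zeta> \<noteq> 0" using \<zeta> by (auto simp: power_0_left)
  have "subgroup C (PGL n)" unfolding C_def
    using nz by (intro P.generate_is_subgroup) (auto simp: PGL_carrier intro!: imageI mat_diag_in_GL split: if_splits)
  then interpret C: subgroup C "PGL n" .
  interpret A: group A unfolding A_def by (rule P.subgroup_imp_group) (rule C.subgroup_axioms)
  have A_simps: "carrier A = C" "x \<otimes>\<^bsub>A\<^esub> y = x \<otimes>\<^bsub>PGL n\<^esub> y" "\<one>\<^bsub>A\<^esub> = \<one>\<^bsub>PGL n\<^esub>" for x y
    by (simp_all add: A_def)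
  have act1: "gal_pgl \<sigma> \<one>\<^bsub>PGL n\<^esub> = \<one>\<^bsub>PGL n\<^esub>" if "\<sigma> \<in> carrier Gal" for \<sigma> :: "'k alg_closure \<Rightarrow> _"
    using gal_pgl_hom[OF that] P.group_axioms by (rule hom_one) (rule P.group_axioms)
  let ?R = "cohomologous (PGL n) gal_pgl :: (('k alg_closure \<Rightarrow> 'k alg_closure) \<Rightarrow> _) rel"
  let ?t = "\<lambda>\<sigma>\<in>carrier Gal. \<one>\<^bsub>PGL n\<^esub> :: 'k alg_closure mat set"
  have tP: "?t \<in> Z1 (PGL n) gal_pgl" using P.group_axioms act1 by (rule constant_cocycle)
  have tA: "?t \<in> Z1 A gal_pgl"
    using constant_cocycle[OF A.group_axioms, of gal_pgl] act1 by (simp add: A_simps)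
  have triv: "(\<xi>, ?t) \<in> ?R" if \<xi>: "\<xi> \<in> Z1 A gal_pgl" for \<xi>
  proof -
    have coc: "\<xi> (\<sigma> \<circ> \<tau>) = \<xi> \<sigma> \<otimes>\<^bsub>PGL n\<^esub> gal_pgl \<sigma> (\<xi> \<tau>)" if "\<sigma> \<in> carrier Gal" "\<tau> \<in> carrier Gal" for \<sigma> \<tau>
      using \<xi> that unfolding Z1_def by (simp add: A_simps)
    have \<xi>P: "\<xi> \<in> Z1 (PGL n) gal_pgl"
      using \<xi> C.subset unfolding Z1_def A_simps by (auto simp: PiE_def Pi_def)
    have "\<forall>\<sigma>\<in>carrier Gal. \<exists>j. \<xi> \<sigma> = pgl_class n (mat_diag (Suc n) (\<lambda>i. if i = 0 then 1 else (\<zeta> ^ a i) ^ j))"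
    proof
      fix \<sigma> :: "'k alg_closure \<Rightarrow> _" assume s: "\<sigma> \<in> carrier Gal"
      have "\<xi> \<sigma> \<in> C" using \<xi> s unfolding Z1_def A_simps by (auto simp: PiE_def Pi_def)
      then obtain j where "\<xi> \<sigma> = pgl_class n (mat_diag (Suc n) (\<lambda>i. if i = 0 then 1 else (\<zeta> ^ a i) ^ j))"
        unfolding C_def by (rule generate_diagonal_cyclic[OF \<zeta>])
      thus "\<exists>j. \<xi> \<sigma> = pgl_class n (mat_diag (Suc n) (\<lambda>i. if i = 0 then 1 else (\<zeta> ^ a i) ^ j))" by blast
    qed
    then obtain j where j: "\<forall>\<sigma>\<in>carrier Gal.
      \<xi> \<sigma> = pgl_class n (mat_diag (Suc n) (\<lambda>i. if i = 0 then 1 else (\<zeta> ^ a i) ^ j \<sigma>))"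
      by (rule bchoice[THEN exE])
    define \<chi> where "\<chi> \<sigma> = (\<lambda>i. if i = 0 then 1 else (\<zeta> ^ a i) ^ j \<sigma>)" for \<sigma>
    have \<chi>: "\<xi> \<sigma> = pgl_class n (mat_diag (Suc n) (\<chi> \<sigma>))" if "\<sigma> \<in> carrier Gal" for \<sigma>
      unfolding \<chi>_def using j that by blast
    have \<chi>nz: "\<chi> \<sigma> i \<noteq> 0" and \<chi>0: "\<chi> \<sigma> 0 = 1" for \<sigma> i using nz by (simp_all add: \<chi>_def)
    have map_diag: "map_mat \<sigma> (mat_diag (Suc n) f) = mat_diag (Suc n) (\<lambda>i. \<sigma> (f i))"
      if "\<sigma> \<in> carrier Gal" for \<sigma> and f :: "nat \<Rightarrow> 'k alg_closure"
      using that by (auto simp: mat_diag_def Gal_eq_0 intro!: eq_matI)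
    \<comment> \<open>Both sides have leading entry 1, so the relation between classes holds entry
      by entry.\<close>
    have \<chi>coc: "\<chi> (\<sigma> \<circ> \<tau>) i = \<chi> \<sigma> i * \<sigma> (\<chi> \<tau> i)"
      if s: "\<sigma> \<in> carrier Gal" and t: "\<tau> \<in> carrier Gal" and i: "i \<le> n" for \<sigma> \<tau> i
    proof -
      have "pgl_class n (mat_diag (Suc n) (\<chi> (\<sigma> \<circ> \<tau>))) =
          pgl_class n (mat_diag (Suc n) (\<lambda>i. \<chi> \<sigma> i * \<sigma> (\<chi> \<tau> i)))"
        using coc[OF s t] s t \<chi>nz
        by (simp add: \<chi> Gal_comp gal_pgl_class map_diag pgl_class_mult mat_diag_in_GL Gal_eq_0)
      from pgl_class_mat_diag_eqD[OF this _ _ i] show ?thesis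
        using Gal_to_ac[OF s, of 1] by (simp add: \<chi>0)
    qed
    \<comment> \<open>The cocycle relation at the identity reads x = x * x with x non-zero.
      Continuity at the identity thus gives the value 1 nearby.\<close>
    have id1: "\<chi> id i = 1" if "i \<le> n" for i
      using \<chi>coc[OF Gal_id(1) Gal_id(1) that] \<chi>nz[of id i] by simp
    obtain S where S: "finite S" "\<And>\<tau>. \<tau> \<in> carrier Gal \<Longrightarrow> (\<forall>x\<in>S. \<tau> x = id x) \<Longrightarrow> \<xi> \<tau> = \<xi> id"
      using \<xi> Gal_id(1) unfolding Z1_def krull_continuous_def by blast
    have cont: "\<chi> \<tau> i = 1" if t: "\<tau> \<in> carrier Gal" "\<forall>x\<in>S. \<tau> x = x" and i: "i \<le> n" for \<tau> i
    proof -
      have "pgl_class n (mat_diag (Suc n) (\<chi> \<tau>)) = pgl_class n (mat_diag (Suc n) (\<chi> id))"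
        using S(2)[OF t(1)] t by (simp add: \<chi> Gal_id)
      thus ?thesis using pgl_class_mat_diag_eqD[of n "\<chi> \<tau>" "\<chi> id" i] \<chi>0 i id1 by simp
    qed
    obtain B where B: "B 0 = 1" "\<And>i. B i \<noteq> 0" "\<And>\<sigma> i. \<sigma> \<in> carrier Gal \<Longrightarrow> i \<le> n \<Longrightarrow> \<chi> \<sigma> i * \<sigma> (B i) = B i"
      using diagonal_hilbert90[of \<chi> n S, OF \<chi>nz \<chi>0 \<chi>coc S(1) cont] by blast
    let ?b = "pgl_class n (mat_diag (Suc n) B)"
    have b: "?b \<in> carrier (PGL n)" using B(2) by (simp add: PGL_carrier mat_diag_in_GL)
    have "?t \<sigma> = inv\<^bsub>PGL n\<^esub> ?b \<otimes>\<^bsub>PGL n\<^esub> \<xi> \<sigma> \<otimes>\<^bsub>PGL n\<^esub> gal_pgl \<sigma> ?b" if s: "\<sigma> \<in> carrier Gal" for \<sigma>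
    proof -
      have "mat_diag (Suc n) (\<lambda>i. \<chi> \<sigma> i * \<sigma> (B i)) = mat_diag (Suc n) B"
        using B(3)[OF s] by (auto simp: mat_diag_def intro!: eq_matI)
      hence "\<xi> \<sigma> \<otimes>\<^bsub>PGL n\<^esub> gal_pgl \<sigma> ?b = ?b"
        using s \<chi>nz B(2) by (simp add: \<chi> gal_pgl_class map_diag pgl_class_mult mat_diag_in_GL Gal_eq_0)
      moreover have "\<xi> \<sigma> \<in> carrier (PGL n)" "gal_pgl \<sigma> ?b \<in> carrier (PGL n)"
        using \<xi>P s b gal_pgl_hom[OF s] unfolding Z1_def by (auto simp: PiE_def Pi_def hom_def)
      ultimately show ?thesis using s b by (simp add: P.m_assoc)
    qed
    with b \<xi>P tP show ?thesis unfolding cohomologous_def by blast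
  qed
  have st: "sym ?R" "trans ?R"
    using cohomologous_sym_trans[OF P.group_axioms, of gal_pgl] gal_pgl_hom by blast+
  have cls: "?R `` {\<xi>} = ?R `` {?t}" if "\<xi> \<in> Z1 A gal_pgl" for \<xi>
    using triv[OF that] st by (auto dest: symD transD)
  \<comment> \<open>The unit is the witness. This puts a representative into its own class, so the
    union formed below has a non-empty index set.\<close>
  have coh_refl: "(\<xi>, \<xi>) \<in> cohomologous A gal_pgl" if \<xi>: "\<xi> \<in> Z1 A gal_pgl" for \<xi>
  proof -
    have "\<xi> \<sigma> = inv\<^bsub>A\<^esub> \<one>\<^bsub>A\<^esub> \<otimes>\<^bsub>A\<^esub> \<xi> \<sigma> \<otimes>\<^bsub>A\<^esub> gal_pgl \<sigma> \<one>\<^bsub>A\<^esub>" if s: "\<sigma> \<in> carrier Gal" for \<sigma>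
    proof -
      have "\<xi> \<sigma> \<in> carrier A" using \<xi> s unfolding Z1_def by (auto simp: PiE_def Pi_def)
      moreover have "gal_pgl \<sigma> \<one>\<^bsub>A\<^esub> = \<one>\<^bsub>A\<^esub>" using act1[OF s] by (simp add: A_simps)
      ultimately show ?thesis by (simp del: A_simps)
    qed
    thus ?thesis unfolding cohomologous_def using \<xi> A.one_closed by blast
  qed
  have "Sigma_map n c = H1_trivial (PGL n) gal_pgl" if "c \<in> H1 A gal_pgl" for c
  proof -
    from that obtain \<xi> where \<xi>: "\<xi> \<in> Z1 A gal_pgl" "c = cohomologous A gal_pgl `` {\<xi>}"
      unfolding H1_def quotient_def by blast
    have c: "\<xi> \<in> c" "c \<subseteq> Z1 A gal_pgl" unfolding \<xi>(2) using coh_refl[OF \<xi>(1)] by (auto simp: cohomologous_def)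
    have "?R `` c = (\<Union>\<eta>\<in>c. ?R `` {\<eta>})" by blast
    also have "\<dots> = (\<Union>\<eta>\<in>c. ?R `` {?t})" by (rule SUP_cong[OF refl]) (rule cls, erule subsetD[OF c(2)])
    also have "\<dots> = ?R `` {?t}" using c(1) by blast
    finally show ?thesis by (simp add: Sigma_map_def H1_trivial_def)
  qed
  \<comment> \<open>The constant cocycle makes the domain non-empty; a constant map then has exactly
    one value.\<close>
  moreover have "H1 A gal_pgl \<noteq> {}" unfolding H1_def using tA by (metis empty_iff quotientI)
  ultimately show ?thesis by blast
qed

section \<open>Morphisms and conjugation\<close>

definition monom_deg :: "(nat \<Rightarrow>\<^sub>0 nat) \<Rightarrow> nat" where
  "monom_deg e = (\<Sum>i\<in>Poly_Mapping.keys e. Poly_Mapping.lookup e i)"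

lemma homogeneous_iff:
  "homogeneous n d F \<longleftrightarrow> (\<forall>e\<in>Poly_Mapping.keys F. Poly_Mapping.keys e \<subseteq> {..n} \<and> monom_deg e = d)"
  by (simp add: homogeneous_def monom_deg_def)

lemma monom_deg_add: "monom_deg (e + e') = monom_deg e + monom_deg e'"
  unfolding monom_deg_def by (rule setsum_keys_plus_distrib) auto

lemma homogeneous_0: "homogeneous n d 0"
  by (simp add: homogeneous_def)

lemma homogeneous_const: "homogeneous n 0 (mpoly_const c)"
  by (simp add: homogeneous_iff mpoly_const_def monom_deg_def)

lemma homogeneous_var: "i \<le> n \<Longrightarrow> homogeneous n 1 (mpoly_var i)"
  by (simp add: homogeneous_iff mpoly_var_def monom_deg_def)

lemma homogeneous_add: "homogeneous n d F \<Longrightarrow> homogeneous n d G \<Longrightarrow> homogeneous n d (F + G)"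
  using keys_add[of F G] unfolding homogeneous_iff by blast

lemma homogeneous_sum: "(\<And>a. a \<in> A \<Longrightarrow> homogeneous n d (f a)) \<Longrightarrow> homogeneous n d (sum f A)"
  by (induction A rule: infinite_finite_induct) (auto intro: homogeneous_add homogeneous_0)

lemma homogeneous_mult:
  assumes "homogeneous n d F" "homogeneous n d' G"
  shows "homogeneous n (d + d') (F * G :: 'a::comm_ring_1 mpoly)"
  unfolding homogeneous_iff
proof
  fix e assume "e \<in> Poly_Mapping.keys (F * G)"
  then obtain a b where ab: "e = a + b" "a \<in> Poly_Mapping.keys F" "b \<in> Poly_Mapping.keys G"
    using keys_mult[of F G] by blast
  thus "Poly_Mapping.keys e \<subseteq> {..n} \<and> monom_deg e = d + d'"
    using assms keys_add[of a b] unfolding homogeneous_iff by (fastforce simp: monom_deg_add)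
qed

lemma homogeneous_smult: "homogeneous n d F \<Longrightarrow> homogeneous n d (mpoly_const c * F :: 'a::comm_ring_1 mpoly)"
  using homogeneous_mult[OF homogeneous_const] by fastforce

lemma homogeneous_power: "homogeneous n d F \<Longrightarrow> homogeneous n (k * d) (F ^ k :: 'a::comm_ring_1 mpoly)"
proof (induction k)
  case 0
  show ?case using homogeneous_const[of n "1::'a"] by (simp add: mpoly_const_def)
next
  case (Suc k)
  thus ?case using homogeneous_mult[of n d F "k * d" "F ^ k"] by simp
qed

lemma homogeneous_prod:
  fixes f :: "'b \<Rightarrow> 'a::comm_ring_1 mpoly"
  shows "(\<And>a. a \<in> A \<Longrightarrow> homogeneous n (d a) (f a)) \<Longrightarrow> homogeneous n (sum d A) (prod f A)"
proof (induction A rule: infinite_finite_induct)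
  case (insert a A)
  thus ?case using homogeneous_mult[of n "d a" "f a" "sum d A" "prod f A"] by simp
qed (use homogeneous_const[of n "1::'a"] in \<open>simp_all add: mpoly_const_def\<close>)

lemma homogeneous_subst:
  fixes H :: "'a::comm_ring_1 mpoly"
  assumes H: "homogeneous n' d' H" and G: "\<And>i. i \<le> n' \<Longrightarrow> homogeneous n d (G i)"
  shows "homogeneous n (d' * d) (meval mpoly_const G H)"
  unfolding meval_def monom_eval_def
proof (intro homogeneous_sum homogeneous_smult)
  fix e assume e: "e \<in> Poly_Mapping.keys H"
  have "homogeneous n (\<Sum>i\<in>Poly_Mapping.keys e. Poly_Mapping.lookup e i * d)
      (\<Prod>i\<in>Poly_Mapping.keys e. G i ^ Poly_Mapping.lookup e i)"
    using H e by (intro homogeneous_prod homogeneous_power G) (auto simp: homogeneous_def)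
  also have "(\<Sum>i\<in>Poly_Mapping.keys e. Poly_Mapping.lookup e i * d) = d' * d"
    using H e by (simp add: homogeneous_def flip: sum_distrib_right)
  finally show "homogeneous n (d' * d) (\<Prod>i\<in>Poly_Mapping.keys e. G i ^ Poly_Mapping.lookup e i)" .
qed

section \<open>Projective points and composition of morphisms\<close>

lemma proj_pt_self: "v \<in> proj_pt v"
proof -
  have "v = 1 \<cdot>\<^sub>v v" by (auto intro!: eq_vecI)
  thus ?thesis unfolding proj_pt_def using one_neq_zero by blast
qed

lemma proj_pt_smult: "c \<noteq> 0 \<Longrightarrow> proj_pt (c \<cdot>\<^sub>v v) = proj_pt v"
proof -
  assume c: "c \<noteq> 0"
  have "\<exists>b. b \<noteq> 0 \<and> a \<cdot>\<^sub>v v = b \<cdot>\<^sub>v (c \<cdot>\<^sub>v v)" if "a \<noteq> 0" for a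
    using c that by (intro exI[of _ "a / c"]) (auto simp: smult_smult_assoc)
  moreover have "\<exists>b. b \<noteq> 0 \<and> a \<cdot>\<^sub>v (c \<cdot>\<^sub>v v) = b \<cdot>\<^sub>v v" if "a \<noteq> 0" for a
    using c that by (intro exI[of _ "a * c"]) (auto simp: smult_smult_assoc)
  ultimately show ?thesis unfolding proj_pt_def by auto
qed

lemma proj_pt_eqE:
  assumes "proj_pt v = proj_pt w"
  obtains c where "c \<noteq> 0" "v = c \<cdot>\<^sub>v w"
  using proj_pt_self[of v] assms unfolding proj_pt_def by blast

lemma coord_vecs_iff: "v \<in> coord_vecs n \<longleftrightarrow> v \<in> carrier_vec (Suc n) \<and> (\<exists>i\<le>n. v $ i \<noteq> 0)"
proof -
  have "v = 0\<^sub>v (Suc n) \<longleftrightarrow> (\<forall>i\<le>n. v $ i = 0)" if "v \<in> carrier_vec (Suc n)"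
    using that by (auto simp: less_Suc_eq_le intro!: eq_vecI)
  thus ?thesis unfolding coord_vecs_def by auto
qed

lemma vec_coord_vecs: "vec (Suc n) f \<in> coord_vecs n \<longleftrightarrow> (\<exists>i\<le>n. f i \<noteq> 0)"
  by (auto simp: coord_vecs_iff)

lemma proj_pt_in_proj_zeros:
  assumes v: "v \<in> coord_vecs n" and hom: "\<And>f. f \<in> S \<Longrightarrow> \<exists>e. homogeneous n e f"
  shows "proj_pt v \<in> proj_zeros n S \<longleftrightarrow> (\<forall>f\<in>S. mpoly_eval f v = 0)"
proof
  assume "proj_pt v \<in> proj_zeros n S"
  then obtain w where w: "proj_pt v = proj_pt w" "w \<in> coord_vecs n" "\<forall>f\<in>S. mpoly_eval f w = 0"
    unfolding proj_zeros_def by blast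
  obtain c where c: "v = c \<cdot>\<^sub>v w" using proj_pt_eqE[OF w(1)] by blast
  show "\<forall>f\<in>S. mpoly_eval f v = 0"
  proof
    fix f assume f: "f \<in> S"
    then obtain e where "homogeneous n e f" using hom by blast
    from mpoly_eval_smult_vec[OF this, of w c] show "mpoly_eval f v = 0"
      using w(2,3) f by (simp add: c coord_vecs_iff)
  qed
next
  assume "\<forall>f\<in>S. mpoly_eval f v = 0"
  thus "proj_pt v \<in> proj_zeros n S" unfolding proj_zeros_def using v by blast
qed

lemma proj_pt_in_hypersurface:
  assumes "v \<in> coord_vecs n" "homogeneous n d F"
  shows "proj_pt v \<in> hypersurface n F \<longleftrightarrow> mpoly_eval F v = 0"
  unfolding hypersurface_def using proj_pt_in_proj_zeros[OF assms(1), of "{F}"] assms(2) by blast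

lemma morphismE:
  assumes f: "morphism K n W n' W' f" and v: "v \<in> coord_vecs n" "proj_pt v \<in> W"
  obtains e G where "\<And>i. i \<le> n' \<Longrightarrow> homogeneous n e (G i)" "\<exists>i\<le>n'. mpoly_eval (G i) v \<noteq> 0"
    "\<And>w. w \<in> coord_vecs n \<Longrightarrow> proj_pt w \<in> W \<Longrightarrow> \<exists>i\<le>n'. mpoly_eval (G i) w \<noteq> 0 \<Longrightarrow>
      f (proj_pt w) = proj_pt (vec (Suc n') (\<lambda>i. mpoly_eval (G i) w))"
proof -
  from f have "\<forall>v\<in>coord_vecs n. proj_pt v \<in> W \<longrightarrow>
        (\<exists>e G. (\<forall>i\<le>n'. homogeneous n e (G i) \<and> coeffs_in K (G i)) \<and>
           (\<exists>i\<le>n'. mpoly_eval (G i) v \<noteq> 0) \<and>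
           (\<forall>w\<in>coord_vecs n. proj_pt w \<in> W \<and> (\<exists>i\<le>n'. mpoly_eval (G i) w \<noteq> 0) \<longrightarrow>
              f (proj_pt w) = proj_pt (vec (Suc n') (\<lambda>i. mpoly_eval (G i) w))))"
    unfolding morphism_def by (rule conjunct2)
  from mp[OF bspec[OF this v(1)] v(2)] obtain e G where
    "\<forall>i\<le>n'. homogeneous n e (G i) \<and> coeffs_in K (G i)" "\<exists>i\<le>n'. mpoly_eval (G i) v \<noteq> 0"
    "\<forall>w\<in>coord_vecs n. proj_pt w \<in> W \<and> (\<exists>i\<le>n'. mpoly_eval (G i) w \<noteq> 0) \<longrightarrow>
              f (proj_pt w) = proj_pt (vec (Suc n') (\<lambda>i. mpoly_eval (G i) w))"
    by blast
  thus ?thesis by (intro that[of e G]) simp_all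
qed

lemma morphismI:
  assumes "\<And>P. P \<in> W \<Longrightarrow> f P \<in> W'"
    and "\<And>v. v \<in> coord_vecs n \<Longrightarrow> proj_pt v \<in> W \<Longrightarrow>
      \<exists>e G. (\<forall>i\<le>n'. homogeneous n e (G i) \<and> coeffs_in K (G i)) \<and>
           (\<exists>i\<le>n'. mpoly_eval (G i) v \<noteq> 0) \<and>
           (\<forall>w\<in>coord_vecs n. proj_pt w \<in> W \<and> (\<exists>i\<le>n'. mpoly_eval (G i) w \<noteq> 0) \<longrightarrow>
              f (proj_pt w) = proj_pt (vec (Suc n') (\<lambda>i. mpoly_eval (G i) w)))"
  shows "morphism K n W n' W' f"
  unfolding morphism_def using assms by (intro conjI ballI impI image_subsetI)

lemma morphism_in: "morphism K n W n' W' f \<Longrightarrow> P \<in> W \<Longrightarrow> f P \<in> W'"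
  unfolding morphism_def by (elim conjE) (erule subsetD, erule imageI)

lemma morphism_rep:
  assumes f: "morphism K n W n' W' f" and v: "v \<in> coord_vecs n" "proj_pt v \<in> W"
  obtains u where "u \<in> coord_vecs n'" "f (proj_pt v) = proj_pt u" "proj_pt u \<in> W'"
proof -
  obtain e G where "\<And>i. i \<le> n' \<Longrightarrow> homogeneous n e (G i)"
    and G: "\<exists>i\<le>n'. mpoly_eval (G i) v \<noteq> 0"
    and Gw: "\<And>w. w \<in> coord_vecs n \<Longrightarrow> proj_pt w \<in> W \<Longrightarrow> \<exists>i\<le>n'. mpoly_eval (G i) w \<noteq> 0 \<Longrightarrow>
      f (proj_pt w) = proj_pt (vec (Suc n') (\<lambda>i. mpoly_eval (G i) w))"
    by (rule morphismE[OF f v]) (rule that)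
  from Gw[OF v G] morphism_in[OF f v(2)] show ?thesis
    using that[OF iffD2[OF vec_coord_vecs G]] by simp
qed

text \<open>The factor \<open>0 ^ d\<close> treats degree 0 together with the rest: a constant form
  does not vanish at the origin but takes the same value everywhere.\<close>

lemma meval_homogeneous_0:
  fixes H :: "'a::comm_ring_1 mpoly"
  assumes "homogeneous n d H" "\<And>i. i \<le> n \<Longrightarrow> x i = 0"
  shows "meval (\<lambda>c. c) x H = 0 ^ d * meval (\<lambda>c. c) y H"
proof -
  have "meval (\<lambda>c. c) x H = meval (\<lambda>c. c) (\<lambda>i. 0 * y i) H"
    using assms(2) by (intro meval_homogeneous_cong[OF assms(1)]) simp
  thus ?thesis using meval_homogeneous_smult[OF assms(1), of "\<lambda>c. c" 0 y] by (simp only:)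
qed

lemma mpoly_eval_subst:
  fixes H :: "'a::comm_ring_1 mpoly"
  assumes "homogeneous n' d H"
  shows "mpoly_eval (meval mpoly_const G H) w = mpoly_eval H (vec (Suc n') (\<lambda>i. mpoly_eval (G i) w))"
proof -
  have "mpoly_eval (meval mpoly_const G H) w = meval (\<lambda>c. c) (\<lambda>i. mpoly_eval (G i) w) H"
    unfolding mpoly_eval_conv_meval
    by (subst hom_meval[OF comm_ring_hom.comm_ring_hom_meval[OF comm_ring_hom_ident]]) (simp add: meval_id)
  thus ?thesis by (simp add: mpoly_eval_vec[OF assms])
qed

text \<open>Representing forms are substituted into each other. The delicate point is that a
  representation must be correct wherever the composed forms do not all vanish, which may include
  points where the inner forms do.\<close>

lemma morphism_comp:
  assumes f: "morphism UNIV n W n' W' f" and g: "morphism UNIV n' W' n'' W'' g"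
  shows "morphism UNIV n W n'' W'' (\<lambda>P. g (f P))"
proof (rule morphismI)
  show "g (f P) \<in> W''" if "P \<in> W" for P by (intro morphism_in[OF g] morphism_in[OF f] that)
next
  fix v assume v: "v \<in> coord_vecs n" "proj_pt v \<in> W"
  obtain e G where G: "\<And>i. i \<le> n' \<Longrightarrow> homogeneous n e (G i)" "\<exists>i\<le>n'. mpoly_eval (G i) v \<noteq> 0"
    and Gw: "\<And>w. w \<in> coord_vecs n \<Longrightarrow> proj_pt w \<in> W \<Longrightarrow> \<exists>i\<le>n'. mpoly_eval (G i) w \<noteq> 0 \<Longrightarrow>
      f (proj_pt w) = proj_pt (vec (Suc n') (\<lambda>i. mpoly_eval (G i) w))"
    by (rule morphismE[OF f v]) (rule that)
  define u where "u = (\<lambda>w. vec (Suc n') (\<lambda>i. mpoly_eval (G i) w))"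
  have uv: "u v \<in> coord_vecs n'" "f (proj_pt v) = proj_pt (u v)" "proj_pt (u v) \<in> W'"
    using G(2) Gw[OF v G(2)] morphism_in[OF f v(2)] by (simp_all add: u_def vec_coord_vecs)
  obtain e' H where H: "\<And>i. i \<le> n'' \<Longrightarrow> homogeneous n' e' (H i)" "\<exists>i\<le>n''. mpoly_eval (H i) (u v) \<noteq> 0"
    and Hw: "\<And>w. w \<in> coord_vecs n' \<Longrightarrow> proj_pt w \<in> W' \<Longrightarrow> \<exists>i\<le>n''. mpoly_eval (H i) w \<noteq> 0 \<Longrightarrow>
      g (proj_pt w) = proj_pt (vec (Suc n'') (\<lambda>i. mpoly_eval (H i) w))"
    by (rule morphismE[OF g uv(1,3)]) (rule that)
  let ?K = "\<lambda>i. meval mpoly_const G (H i)"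
  have K: "mpoly_eval (?K i) w = mpoly_eval (H i) (u w)" if "i \<le> n''" for i w
    unfolding u_def by (rule mpoly_eval_subst[OF H(1)[OF that]])
  have "g (f (proj_pt w)) = proj_pt (vec (Suc n'') (\<lambda>i. mpoly_eval (?K i) w))"
    if w: "w \<in> coord_vecs n" "proj_pt w \<in> W" and nz: "\<exists>i\<le>n''. mpoly_eval (?K i) w \<noteq> 0" for w
  proof -
    obtain u' where u': "u' \<in> coord_vecs n'" "f (proj_pt w) = proj_pt u'" "proj_pt u' \<in> W'"
      and same: "\<And>i. i \<le> n'' \<Longrightarrow> mpoly_eval (H i) u' = mpoly_eval (?K i) w"
    proof (cases "\<exists>i\<le>n'. mpoly_eval (G i) w \<noteq> 0")
      case True
      show ?thesis
      proof (rule that[of "u w"])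
        show "u w \<in> coord_vecs n'" using True by (simp add: u_def vec_coord_vecs)
        show fw: "f (proj_pt w) = proj_pt (u w)" using Gw[OF w True] by (simp add: u_def)
        have "f (proj_pt w) \<in> W'" by (rule morphism_in[OF f w(2)])
        thus "proj_pt (u w) \<in> W'" by (simp add: fw)
      qed (simp add: K)
    next
      \<comment> \<open>All inner forms vanish at w, yet a composed one does not. This forces
        \<open>e' = 0\<close>, so the outer forms are constant and any coordinate vector of the
        image of w serves.\<close>
      case False
      obtain u' where u': "u' \<in> coord_vecs n'" "f (proj_pt w) = proj_pt u'" "proj_pt u' \<in> W'"
        using morphism_rep[OF f w] .
      have z: "mpoly_eval (?K i) w = 0 ^ e' * mpoly_eval (H i) u'" if "i \<le> n''" for i
        using False unfolding K[OF that] unfolding mpoly_eval_conv_meval[of "H i"]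
        by (intro meval_homogeneous_0[OF H(1)[OF that]]) (simp add: u_def less_Suc_eq_le)
      hence "(0 :: 'a) ^ e' \<noteq> 0" using nz by auto
      hence "e' = 0" by (simp split: if_splits)
      with z show ?thesis by (intro that[OF u']) simp
    qed
    have "\<exists>i\<le>n''. mpoly_eval (H i) u' \<noteq> 0" using nz same by auto
    from Hw[OF u'(1,3) this] have "g (f (proj_pt w)) = proj_pt (vec (Suc n'') (\<lambda>i. mpoly_eval (H i) u'))"
      by (simp add: u'(2))
    also have "vec (Suc n'') (\<lambda>i. mpoly_eval (H i) u') = vec (Suc n'') (\<lambda>i. mpoly_eval (?K i) w)"
      using same by (auto intro!: eq_vecI)
    finally show ?thesis .
  qed
  moreover have "\<exists>i\<le>n''. mpoly_eval (?K i) v \<noteq> 0" using H(2) K by auto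
  moreover have "homogeneous n (e' * e) (?K i) \<and> coeffs_in UNIV (?K i)" if "i \<le> n''" for i
    using homogeneous_subst[OF H(1)[OF that] G(1)] by (simp add: coeffs_in_def)
  ultimately show "\<exists>e G. (\<forall>i\<le>n''. homogeneous n e (G i) \<and> coeffs_in UNIV (G i)) \<and>
      (\<exists>i\<le>n''. mpoly_eval (G i) v \<noteq> 0) \<and>
      (\<forall>w\<in>coord_vecs n. proj_pt w \<in> W \<and> (\<exists>i\<le>n''. mpoly_eval (G i) w \<noteq> 0) \<longrightarrow>
        g (f (proj_pt w)) = proj_pt (vec (Suc n'') (\<lambda>i. mpoly_eval (G i) w)))"
    by (intro exI[of _ "e' * e"] exI[of _ ?K]) blast
qed

section \<open>Galois conjugation and descent of morphisms\<close>

definition gal_pt :: "('a \<Rightarrow> 'a) \<Rightarrow> 'a vec set \<Rightarrow> 'a vec set" where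
  "gal_pt \<sigma> P = map_vec \<sigma> ` P"

lemma map_vec_coord_vecs: "\<sigma> \<in> carrier Gal \<Longrightarrow> v \<in> coord_vecs n \<Longrightarrow> map_vec \<sigma> v \<in> coord_vecs n"
  by (auto simp: coord_vecs_iff Gal_eq_0)

lemma map_vec_Gal_inv:
  assumes "\<sigma> \<in> carrier Gal"
  shows "map_vec \<sigma> (map_vec (inv_into UNIV \<sigma>) v) = v" "map_vec (inv_into UNIV \<sigma>) (map_vec \<sigma> v) = v"
  using Gal_inv(2,3)[OF assms] by (auto intro!: eq_vecI)

lemma gal_pt_inv:
  assumes "\<sigma> \<in> carrier Gal"
  shows "gal_pt \<sigma> (gal_pt (inv_into UNIV \<sigma>) P) = P" "gal_pt (inv_into UNIV \<sigma>) (gal_pt \<sigma> P) = P"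
  unfolding gal_pt_def image_image map_vec_Gal_inv[OF assms] by simp_all

lemma gal_pt_comp: "gal_pt (\<sigma> \<circ> \<tau>) P = gal_pt \<sigma> (gal_pt \<tau> P)"
proof -
  have "map_vec (\<sigma> \<circ> \<tau>) v = map_vec \<sigma> (map_vec \<tau> v)" for v by (auto intro!: eq_vecI)
  thus ?thesis by (simp add: gal_pt_def image_image)
qed

lemma gal_pt_proj_pt:
  assumes s: "\<sigma> \<in> carrier Gal"
  shows "gal_pt \<sigma> (proj_pt v) = proj_pt (map_vec \<sigma> v)"
proof -
  interpret comm_ring_hom \<sigma> by (rule comm_ring_hom_Gal[OF s])
  have smult: "map_vec \<sigma> (c \<cdot>\<^sub>v v) = \<sigma> c \<cdot>\<^sub>v map_vec \<sigma> v" for c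
    by (auto simp: hom_mult intro!: eq_vecI)
  show ?thesis
  proof
    show "gal_pt \<sigma> (proj_pt v) \<subseteq> proj_pt (map_vec \<sigma> v)"
      unfolding gal_pt_def proj_pt_def using Gal_eq_0[OF s] by (auto simp: smult)
    show "proj_pt (map_vec \<sigma> v) \<subseteq> gal_pt \<sigma> (proj_pt v)"
    proof
      fix w assume "w \<in> proj_pt (map_vec \<sigma> v)"
      then obtain c where c: "c \<noteq> 0" "w = c \<cdot>\<^sub>v map_vec \<sigma> v" unfolding proj_pt_def by blast
      have "w = map_vec \<sigma> (inv_into UNIV \<sigma> c \<cdot>\<^sub>v v)" by (simp add: smult c(2) Gal_inv(2)[OF s])
      moreover have "inv_into UNIV \<sigma> c \<noteq> 0" using c(1) by (simp add: Gal_eq_0[OF Gal_inv(1)[OF s]])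
      ultimately show "w \<in> gal_pt \<sigma> (proj_pt v)" unfolding gal_pt_def proj_pt_def by blast
    qed
  qed
qed

lemma lookup_map_0: "f 0 = 0 \<Longrightarrow> Poly_Mapping.lookup (Poly_Mapping.map f p) e = f (Poly_Mapping.lookup p e)"
  by (simp add: Poly_Mapping.map.rep_eq when_def)

lemma homogeneous_map: "f 0 = 0 \<Longrightarrow> homogeneous n d F \<Longrightarrow> homogeneous n d (Poly_Mapping.map f F)"
proof -
  assume f: "f 0 = 0" and F: "homogeneous n d F"
  have "Poly_Mapping.keys (Poly_Mapping.map f F) \<subseteq> Poly_Mapping.keys F"
    by (auto simp: in_keys_iff lookup_map_0[of f, OF f] f)
  with F show ?thesis unfolding homogeneous_def by blast
qed

lemma mpoly_eval_map_Gal: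
  assumes s: "\<sigma> \<in> carrier Gal" and F: "homogeneous n d F" and v: "v \<in> carrier_vec (Suc n)"
  shows "mpoly_eval (Poly_Mapping.map \<sigma> F) (map_vec \<sigma> v) = \<sigma> (mpoly_eval F v)"
proof -
  interpret comm_ring_hom \<sigma> by (rule comm_ring_hom_Gal[OF s])
  have keys: "Poly_Mapping.keys (Poly_Mapping.map \<sigma> F) = Poly_Mapping.keys F"
    by (intro Set.set_eqI) (simp add: in_keys_iff lookup_map_0[of \<sigma>, OF hom_zero] Gal_eq_0[OF s])
  have "\<sigma> (mpoly_eval F v) = meval \<sigma> (\<lambda>i. \<sigma> (v $ i)) F"
    unfolding mpoly_eval_conv_meval by (rule hom_meval[OF comm_ring_hom_axioms])
  also have "\<dots> = meval \<sigma> (\<lambda>i. map_vec \<sigma> v $ i) F"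
    using v by (intro meval_homogeneous_cong[OF F]) auto
  also have "\<dots> = meval (\<lambda>c. c) (\<lambda>i. map_vec \<sigma> v $ i) (Poly_Mapping.map \<sigma> F)"
    unfolding meval_def keys by (simp add: lookup_map_0[of \<sigma>, OF hom_zero])
  finally show ?thesis by (simp add: mpoly_eval_conv_meval)
qed

lemma map_Gal_base:
  assumes s: "\<sigma> \<in> carrier Gal" and F: "coeffs_in base_field F"
  shows "Poly_Mapping.map \<sigma> F = F"
proof (rule poly_mapping_eqI)
  fix e
  obtain c where "Poly_Mapping.lookup F e = to_ac c" using F unfolding coeffs_in_def by blast
  thus "Poly_Mapping.lookup (Poly_Mapping.map \<sigma> F) e = Poly_Mapping.lookup F e"
    using Gal_eq_0[OF s, of 0] by (simp add: lookup_map_0[of \<sigma>] Gal_to_ac[OF s])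
qed

text \<open>The defining forms have coefficients in k, so conjugating a zero gives a zero of the
  same forms.\<close>

lemma zariski_closed_gal_pt:
  assumes "zariski_closed base_field n W" "\<sigma> \<in> carrier Gal" "P \<in> W"
  shows "gal_pt \<sigma> P \<in> W"
proof -
  obtain S where S: "\<And>f. f \<in> S \<Longrightarrow> coeffs_in base_field f \<and> (\<exists>e. homogeneous n e f)" "W = proj_zeros n S"
    using assms(1) unfolding zariski_closed_def by blast
  obtain v where v: "v \<in> coord_vecs n" "P = proj_pt v" "\<forall>f\<in>S. mpoly_eval f v = 0"
    using assms(3) unfolding S(2) proj_zeros_def by blast
  have "mpoly_eval f (map_vec \<sigma> v) = 0" if "f \<in> S" for f
  proof -
    from S(1)[OF that] obtain e where "homogeneous n e f" "coeffs_in base_field f" by blast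
    with mpoly_eval_map_Gal[OF assms(2) this(1), of v] v that show ?thesis
      by (simp add: map_Gal_base[OF assms(2)] coord_vecs_iff Gal_eq_0[OF assms(2)])
  qed
  thus ?thesis unfolding v(2) gal_pt_proj_pt[OF assms(2)] S(2) proj_zeros_def
    using map_vec_coord_vecs[OF assms(2) v(1)] by blast
qed

text \<open>Representing forms of the conjugate are obtained by applying \<open>\<sigma>\<close> to
  the coefficients; the argument is pulled back by the inverse of \<open>\<sigma>\<close>
  first.\<close>

lemma morphism_conj:
  assumes f: "morphism UNIV n W n' W' f" and s: "\<sigma> \<in> carrier Gal"
    and W: "\<And>P. P \<in> W \<Longrightarrow> gal_pt (inv_into UNIV \<sigma>) P \<in> W" and W': "\<And>P. P \<in> W' \<Longrightarrow> gal_pt \<sigma> P \<in> W'"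
  shows "morphism UNIV n W n' W' (\<lambda>P. gal_pt \<sigma> (f (gal_pt (inv_into UNIV \<sigma>) P)))"
proof (rule morphismI)
  let ?i = "inv_into UNIV \<sigma>"
  have si: "?i \<in> carrier Gal" by (rule Gal_inv(1)[OF s])
  show "gal_pt \<sigma> (f (gal_pt ?i P)) \<in> W'" if "P \<in> W" for P by (intro W' morphism_in[OF f] W that)
  fix v assume v: "v \<in> coord_vecs n" "proj_pt v \<in> W"
  have pull: "map_vec ?i w \<in> coord_vecs n" "proj_pt (map_vec ?i w) \<in> W"
    if "w \<in> coord_vecs n" "proj_pt w \<in> W" for w
    using map_vec_coord_vecs[OF si that(1)] W[OF that(2)] by (simp_all add: gal_pt_proj_pt[OF si])
  obtain e G where G: "\<And>i. i \<le> n' \<Longrightarrow> homogeneous n e (G i)" "\<exists>i\<le>n'. mpoly_eval (G i) (map_vec ?i v) \<noteq> 0"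
    and Gw: "\<And>w. w \<in> coord_vecs n \<Longrightarrow> proj_pt w \<in> W \<Longrightarrow> \<exists>i\<le>n'. mpoly_eval (G i) w \<noteq> 0 \<Longrightarrow>
      f (proj_pt w) = proj_pt (vec (Suc n') (\<lambda>i. mpoly_eval (G i) w))"
    by (rule morphismE[OF f pull[OF v]]) (rule that)
  let ?H = "\<lambda>i. Poly_Mapping.map \<sigma> (G i)"
  have H: "mpoly_eval (?H i) w = \<sigma> (mpoly_eval (G i) (map_vec ?i w))"
    if "i \<le> n'" "w \<in> coord_vecs n" for i w
    using mpoly_eval_map_Gal[OF s G(1)[OF that(1)], of "map_vec ?i w"] that(2)
    by (simp add: map_vec_Gal_inv[OF s] coord_vecs_iff)
  have "gal_pt \<sigma> (f (gal_pt ?i (proj_pt w))) = proj_pt (vec (Suc n') (\<lambda>i. mpoly_eval (?H i) w))"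
    if w: "w \<in> coord_vecs n" "proj_pt w \<in> W" and nz: "\<exists>i\<le>n'. mpoly_eval (?H i) w \<noteq> 0" for w
  proof -
    have "\<exists>i\<le>n'. mpoly_eval (G i) (map_vec ?i w) \<noteq> 0" using nz H[OF _ w(1)] Gal_eq_0[OF s] by auto
    from Gw[OF pull[OF w] this]
    have "gal_pt \<sigma> (f (gal_pt ?i (proj_pt w))) =
        proj_pt (map_vec \<sigma> (vec (Suc n') (\<lambda>i. mpoly_eval (G i) (map_vec ?i w))))"
      by (simp add: gal_pt_proj_pt[OF si] gal_pt_proj_pt[OF s])
    also have "map_vec \<sigma> (vec (Suc n') (\<lambda>i. mpoly_eval (G i) (map_vec ?i w))) =
        vec (Suc n') (\<lambda>i. mpoly_eval (?H i) w)"
      using H[OF _ w(1)] by (auto intro!: eq_vecI)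
    finally show ?thesis .
  qed
  moreover have "\<exists>i\<le>n'. mpoly_eval (?H i) v \<noteq> 0" using G(2) H[OF _ v(1)] Gal_eq_0[OF s] by auto
  moreover have "homogeneous n e (?H i) \<and> coeffs_in UNIV (?H i)" if "i \<le> n'" for i
    using homogeneous_map[of \<sigma> n e "G i"] Gal_eq_0[OF s, of 0] G(1)[OF that] by (simp add: coeffs_in_def)
  ultimately show "\<exists>e G. (\<forall>i\<le>n'. homogeneous n e (G i) \<and> coeffs_in UNIV (G i)) \<and>
      (\<exists>i\<le>n'. mpoly_eval (G i) v \<noteq> 0) \<and>
      (\<forall>w\<in>coord_vecs n. proj_pt w \<in> W \<and> (\<exists>i\<le>n'. mpoly_eval (G i) w \<noteq> 0) \<longrightarrow>
        gal_pt \<sigma> (f (gal_pt ?i (proj_pt w))) = proj_pt (vec (Suc n') (\<lambda>i. mpoly_eval (G i) w)))"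
    by (intro exI[of _ e] exI[of _ ?H]) blast
qed

text \<open>
  A representation \<open>G\<close> of an equivariant morphism is replaced by the trace of \<open>c G\<close>: all conjugates
  of \<open>G\<close> represent the same morphism, so the trace does as well, unless it vanishes; by independence of
  characters, \<open>c\<close> can be chosen such that it does not vanish at a given point.
\<close>

lemma morphism_descent:
  fixes W :: "'k::field alg_closure vec set set"
  assumes perf: "perfect TYPE('k)" and f: "morphism UNIV n W n' W' f"
    and W: "\<And>\<sigma> P. \<sigma> \<in> carrier Gal \<Longrightarrow> P \<in> W \<Longrightarrow> gal_pt \<sigma> P \<in> W"
    and equiv: "\<And>\<sigma> P. \<sigma> \<in> carrier Gal \<Longrightarrow> P \<in> W \<Longrightarrow> f (gal_pt \<sigma> P) = gal_pt \<sigma> (f P)"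
  shows "morphism base_field n W n' W' f"
proof (rule morphismI)
  show "f P \<in> W'" if "P \<in> W" for P by (rule morphism_in[OF f that])
next
  fix v assume v: "v \<in> coord_vecs n" "proj_pt v \<in> W"
  obtain e G where G: "\<And>i. i \<le> n' \<Longrightarrow> homogeneous n e (G i)" "\<exists>i\<le>n'. mpoly_eval (G i) v \<noteq> 0"
    and Gw: "\<And>w. w \<in> coord_vecs n \<Longrightarrow> proj_pt w \<in> W \<Longrightarrow> \<exists>i\<le>n'. mpoly_eval (G i) w \<noteq> 0 \<Longrightarrow>
      f (proj_pt w) = proj_pt (vec (Suc n') (\<lambda>i. mpoly_eval (G i) w))"
    by (rule morphismE[OF f v]) (rule that)
  define S where "S = (\<Union>i\<le>n'. Poly_Mapping.lookup (G i) ` Poly_Mapping.keys (G i))"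
  have "finite S" unfolding S_def by auto
  then obtain L where L: "finite_galois L" "S \<subseteq> L" by (rule finite_subset_finite_galois)
  have coeff_L: "Poly_Mapping.lookup (G i) m \<in> L" if "i \<le> n'" for i m
  proof (cases "m \<in> Poly_Mapping.keys (G i)")
    case True
    hence "Poly_Mapping.lookup (G i) m \<in> S" using that unfolding S_def by blast
    thus ?thesis using L(2) by blast
  qed (simp add: in_keys_iff finite_galois_0[OF L(1)])
  have r_0: "r 0 = 0" if "r \<in> Gal_on L" for r
    using that finite_galois_0[OF L(1)] unfolding Gal_on_def by (auto simp: Gal_eq_0)
  \<comment> \<open>By equivariance the conjugated forms describe the same morphism, so their values
    at w are multiples of one coordinate vector u. The multiple is 0 where they all vanish.\<close>
  have conj: "\<exists>l. \<forall>i\<le>n'. mpoly_eval (Poly_Mapping.map r (G i)) w = l * u $ i"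
    if r: "r \<in> Gal_on L" and w: "w \<in> coord_vecs n" "proj_pt w \<in> W"
      and u: "u \<in> coord_vecs n'" "f (proj_pt w) = proj_pt u" for r w and u :: "'k alg_closure vec"
  proof -
    obtain \<tau> where t: "\<tau> \<in> carrier Gal" "r = restrict \<tau> L" using r unfolding Gal_on_def by blast
    interpret \<tau>: comm_ring_hom \<tau> by (rule comm_ring_hom_Gal[OF t(1)])
    define w' where "w' = map_vec (inv_into UNIV \<tau>) w"
    have w'_in: "w' \<in> coord_vecs n" "proj_pt w' \<in> W" and ww': "map_vec \<tau> w' = w"
      using map_vec_coord_vecs[OF Gal_inv(1)[OF t(1)] w(1)] W[OF Gal_inv(1)[OF t(1)] w(2)]
      by (simp_all add: w'_def gal_pt_proj_pt[OF Gal_inv(1)[OF t(1)]] map_vec_Gal_inv[OF t(1)])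
    have val: "mpoly_eval (Poly_Mapping.map r (G i)) w = \<tau> (mpoly_eval (G i) w')" if i: "i \<le> n'" for i
    proof -
      \<comment> \<open>r is meaningful only on L; the coefficients of the forms lie there, so r may
        be exchanged for the automorphism.\<close>
      have "Poly_Mapping.map r (G i) = Poly_Mapping.map \<tau> (G i)"
        using coeff_L[OF i] r_0[OF r] by (intro poly_mapping_eqI) (simp add: lookup_map_0 t(2))
      thus ?thesis
        using mpoly_eval_map_Gal[OF t(1) G(1)[OF i], of w'] w'_in(1) by (simp add: ww' coord_vecs_iff)
    qed
    show ?thesis
    proof (cases "\<exists>i\<le>n'. mpoly_eval (G i) w' \<noteq> 0")
      case False
      thus ?thesis using val by (intro exI[of _ 0]) simp
    next
      case True
      have "proj_pt u = gal_pt \<tau> (f (proj_pt w'))"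
        using equiv[OF t(1) w'_in(2)] by (simp add: gal_pt_proj_pt[OF t(1)] ww' u(2))
      also have "\<dots> = proj_pt (map_vec \<tau> (vec (Suc n') (\<lambda>i. mpoly_eval (G i) w')))"
        unfolding Gw[OF w'_in True] by (rule gal_pt_proj_pt[OF t(1)])
      finally obtain c where c: "map_vec \<tau> (vec (Suc n') (\<lambda>i. mpoly_eval (G i) w')) = c \<cdot>\<^sub>v u"
        by (rule proj_pt_eqE[OF sym])
      have "mpoly_eval (Poly_Mapping.map r (G i)) w = c * u $ i" if "i \<le> n'" for i
        using arg_cong[OF c, of "\<lambda>x. vec_index x i"] that u(1) val[OF that]
        by (auto simp: coord_vecs_iff less_Suc_eq_le)
      thus ?thesis by blast
    qed
  qed
  \<comment> \<open>The trace of c G over the finite group attached to L, taken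
    coefficientwise.\<close>
  define T where "T c i = (\<Sum>r\<in>Gal_on L. mpoly_const (r c) * Poly_Mapping.map r (G i))" for c i
  have T_hom: "homogeneous n e (T c i)" if "i \<le> n'" for c i
    unfolding T_def by (intro homogeneous_sum homogeneous_smult homogeneous_map r_0 G(1) that)
  have const_mult: "Poly_Mapping.lookup (mpoly_const a * H) m = a * Poly_Mapping.lookup H m"
    for a :: "'k alg_closure" and H m
    by (simp add: mpoly_const_def Poly_Mapping.map.rep_eq when_def flip: mult_map_scale_conv_mult)
  have T_base: "coeffs_in base_field (T c i)" if "i \<le> n'" "c \<in> L" for c i
    unfolding coeffs_in_def
  proof
    fix m
    have "Poly_Mapping.lookup (T c i) m = (\<Sum>r\<in>Gal_on L. r (c * Poly_Mapping.lookup (G i) m))"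
      unfolding T_def lookup_sum
    proof (intro sum.cong refl)
      fix r assume r: "r \<in> Gal_on L"
      then obtain \<tau> where t: "\<tau> \<in> carrier Gal" "r = restrict \<tau> L" unfolding Gal_on_def by blast
      show "Poly_Mapping.lookup (mpoly_const (r c) * Poly_Mapping.map r (G i)) m =
          r (c * Poly_Mapping.lookup (G i) m)"
        unfolding const_mult lookup_map_0[of r, OF r_0[OF r]]
        using that coeff_L[OF that(1), of m] finite_galois_closed(2)[OF L(1)] t(1)
        by (simp add: t(2) Gal_iff)
    qed
    also have "\<dots> \<in> base_field"
      by (intro Gal_on_trace[OF L(1) perf] finite_galois_closed(2)[OF L(1)] coeff_L that)
    finally show "Poly_Mapping.lookup (T c i) m \<in> base_field" .
  qed
  \<comment> \<open>The multipliers depend on w but not on c or i, so the values of the traces form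
    a scalar multiple of u.\<close>
  have T_eval: "\<exists>\<mu>. \<forall>c. \<forall>i\<le>n'. mpoly_eval (T c i) w = (\<Sum>r\<in>Gal_on L. \<mu> r * r c) * u $ i"
    if w: "w \<in> coord_vecs n" "proj_pt w \<in> W" and u: "u \<in> coord_vecs n'" "f (proj_pt w) = proj_pt u" for w and u :: "'k alg_closure vec"
  proof -
    have "\<forall>r\<in>Gal_on L. \<exists>l. \<forall>i\<le>n'. mpoly_eval (Poly_Mapping.map r (G i)) w = l * u $ i"
      using conj[OF _ w u] by blast
    then obtain \<mu> where \<mu>: "\<forall>r\<in>Gal_on L. \<forall>i\<le>n'. mpoly_eval (Poly_Mapping.map r (G i)) w = \<mu> r * u $ i"
      by (rule bchoice[THEN exE])
    have "mpoly_eval (T c i) w = (\<Sum>r\<in>Gal_on L. \<mu> r * r c) * u $ i" if "i \<le> n'" for c i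
    proof -
      have "mpoly_eval (T c i) w = (\<Sum>r\<in>Gal_on L. r c * mpoly_eval (Poly_Mapping.map r (G i)) w)"
        unfolding T_def mpoly_eval_conv_meval
        by (simp add: comm_ring_hom.meval_sum[OF comm_ring_hom_ident] meval_id)
      also have "\<dots> = (\<Sum>r\<in>Gal_on L. \<mu> r * r c) * u $ i"
        unfolding sum_distrib_right using \<mu> that by (intro sum.cong refl) (simp add: mult_ac)
      finally show ?thesis .
    qed
    thus ?thesis by blast
  qed
  have T_rep: "f (proj_pt w) = proj_pt (vec (Suc n') (\<lambda>i. mpoly_eval (T c i) w))"
    if w: "w \<in> coord_vecs n" "proj_pt w \<in> W" and nz: "\<exists>i\<le>n'. mpoly_eval (T c i) w \<noteq> 0" for w c
  proof -
    obtain u where u: "u \<in> coord_vecs n'" "f (proj_pt w) = proj_pt u"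
      using morphism_rep[OF f w] by blast
    obtain \<mu> where \<mu>: "\<And>c i. i \<le> n' \<Longrightarrow> mpoly_eval (T c i) w = (\<Sum>r\<in>Gal_on L. \<mu> r * r c) * u $ i"
      using T_eval[OF w u] by blast
    let ?c = "\<Sum>r\<in>Gal_on L. \<mu> r * r c"
    have "?c \<noteq> 0" using nz \<mu>[of _ c] by auto
    moreover have "vec (Suc n') (\<lambda>i. mpoly_eval (T c i) w) = ?c \<cdot>\<^sub>v u"
      using \<mu> u(1) by (intro eq_vecI) (auto simp: coord_vecs_iff)
    ultimately show ?thesis unfolding u(2) by (simp add: proj_pt_smult)
  qed
  obtain u where u: "u \<in> coord_vecs n'" "f (proj_pt v) = proj_pt u"
    using morphism_rep[OF f v] by blast
  \<comment> \<open>At v the multipliers are chosen explicitly, so that the one belonging to the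
    identity can be inspected.\<close>
  have "\<forall>r\<in>Gal_on L. \<exists>l. \<forall>i\<le>n'. mpoly_eval (Poly_Mapping.map r (G i)) v = l * u $ i"
    using conj[OF _ v u] by blast
  then obtain \<mu> where \<mu>: "\<forall>r\<in>Gal_on L. \<forall>i\<le>n'. mpoly_eval (Poly_Mapping.map r (G i)) v = \<mu> r * u $ i"
    by (rule bchoice[THEN exE])
  let ?r0 = "restrict id L"
  have r0: "?r0 \<in> Gal_on L" by (rule restrict_in_Gal_on[OF Gal_id(1)])
  \<comment> \<open>The identity leaves G unchanged, and G does not vanish at v; this is the
    non-zero coefficient that independence of characters requires.\<close>
  have "\<mu> ?r0 \<noteq> 0"
  proof
    assume z: "\<mu> ?r0 = 0"
    obtain i where i: "i \<le> n'" "mpoly_eval (G i) v \<noteq> 0" using G(2) by blast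
    have "Poly_Mapping.map ?r0 (G i) = G i"
      using coeff_L[OF i(1)] r_0[OF r0] by (intro poly_mapping_eqI) (simp add: lookup_map_0)
    thus False using \<mu>[rule_format, OF r0 i(1)] i(2) z by simp
  qed
  then obtain c where c: "c \<in> L" "(\<Sum>r\<in>Gal_on L. \<mu> r * r c) \<noteq> 0"
    using Gal_on_nonvanishing[OF L(1) r0] by blast
  obtain i where i: "i \<le> n'" "u $ i \<noteq> 0" using u(1) unfolding coord_vecs_iff by blast
  have "mpoly_eval (T c i) v = (\<Sum>r\<in>Gal_on L. r c * mpoly_eval (Poly_Mapping.map r (G i)) v)"
    unfolding T_def mpoly_eval_conv_meval
    by (simp add: comm_ring_hom.meval_sum[OF comm_ring_hom_ident] meval_id)
  also have "\<dots> = (\<Sum>r\<in>Gal_on L. \<mu> r * r c) * u $ i"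
    unfolding sum_distrib_right using \<mu> i(1) by (intro sum.cong refl) (simp add: mult_ac)
  finally have "mpoly_eval (T c i) v \<noteq> 0" using c(2) i(2) by simp
  hence "\<exists>i\<le>n'. mpoly_eval (T c i) v \<noteq> 0" using i(1) by blast
  moreover have "\<forall>i\<le>n'. homogeneous n e (T c i) \<and> coeffs_in base_field (T c i)"
    using T_hom T_base[OF _ c(1)] by blast
  ultimately show "\<exists>e G. (\<forall>i\<le>n'. homogeneous n e (G i) \<and> coeffs_in base_field (G i)) \<and>
           (\<exists>i\<le>n'. mpoly_eval (G i) v \<noteq> 0) \<and>
           (\<forall>w\<in>coord_vecs n. proj_pt w \<in> W \<and> (\<exists>i\<le>n'. mpoly_eval (G i) w \<noteq> 0) \<longrightarrow>
              f (proj_pt w) = proj_pt (vec (Suc n') (\<lambda>i. mpoly_eval (G i) w)))"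
    using T_rep[where c = c] by (intro exI[of _ e] exI[of _ "T c"]) blast
qed

section \<open>Diagonal maps\<close>

definition diag_subst :: "(nat \<Rightarrow> 'a::comm_ring_1) \<Rightarrow> 'a mpoly \<Rightarrow> 'a mpoly" where
  "diag_subst b F = meval mpoly_const (\<lambda>i. mpoly_const (b i) * mpoly_var i) F"

lemma lin_subst_mat_diag:
  assumes "homogeneous n d F"
  shows "lin_subst (mat_diag (Suc n) b) F = diag_subst b F"
  unfolding lin_subst_conv_meval diag_subst_def
proof (rule meval_homogeneous_cong[OF assms])
  fix i assume i: "i \<le> n"
  have "(\<Sum>j<dim_col (mat_diag (Suc n) b). mpoly_const (mat_diag (Suc n) b $$ (i, j)) * mpoly_var j) =
      (\<Sum>j<Suc n. if j = i then mpoly_const (b i) * mpoly_var i else 0)"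
    using i by (intro sum.cong) (auto simp: mat_diag_def mpoly_const_def)
  thus "(\<Sum>j<dim_col (mat_diag (Suc n) b). mpoly_const (mat_diag (Suc n) b $$ (i, j)) * mpoly_var j) =
      mpoly_const (b i) * mpoly_var i"
    using i by simp
qed

lemma lookup_diag_subst:
  fixes F :: "'a::comm_ring_1 mpoly"
  shows "Poly_Mapping.lookup (diag_subst b F) e = Poly_Mapping.lookup F e * monom_eval b e"
proof -
  have "monom_eval (\<lambda>i. mpoly_const (b i)) m = mpoly_const (monom_eval b m)" for m
    by (rule comm_ring_hom.monom_eval_hom[OF comm_ring_hom_mpoly_const, symmetric])
  hence "diag_subst b F = (\<Sum>m\<in>Poly_Mapping.keys F.
      Poly_Mapping.single m (Poly_Mapping.lookup F m * monom_eval b m))"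
    unfolding diag_subst_def meval_def monom_eval_mult monom_eval_var
    by (simp add: mpoly_const_def mult_single)
  hence "Poly_Mapping.lookup (diag_subst b F) e = (\<Sum>m\<in>Poly_Mapping.keys F.
      if m = e then Poly_Mapping.lookup F e * monom_eval b e else 0)"
    by (simp add: lookup_sum lookup_single when_def cong: if_cong)
  thus ?thesis by (simp add: in_keys_iff)
qed

lemma homogeneous_diag_subst: "homogeneous n d F \<Longrightarrow> homogeneous n d (diag_subst b F)"
  for F :: "'a::comm_ring_1 mpoly"
proof -
  assume F: "homogeneous n d F"
  have "Poly_Mapping.keys (diag_subst b F) \<subseteq> Poly_Mapping.keys F"
    by (auto simp: in_keys_iff lookup_diag_subst)
  with F show ?thesis unfolding homogeneous_def by blast
qed

definition diag_act :: "nat \<Rightarrow> (nat \<Rightarrow> 'a::field) \<Rightarrow> 'a vec \<Rightarrow> 'a vec" where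
  "diag_act n b v = vec (Suc n) (\<lambda>i. b i * v $ i)"

lemma meval_diag_subst:
  fixes F :: "'a::comm_ring_1 mpoly"
  shows "meval (\<lambda>c. c) x (diag_subst b F) = meval (\<lambda>c. c) (\<lambda>i. b i * x i) F"
  unfolding diag_subst_def
  by (subst hom_meval[OF comm_ring_hom.comm_ring_hom_meval[OF comm_ring_hom_ident]]) (simp add: meval_id)

lemma mpoly_eval_diag_subst:
  assumes "homogeneous n d F"
  shows "mpoly_eval (diag_subst b F) v = mpoly_eval F (diag_act n b v)"
  unfolding diag_act_def mpoly_eval_vec[OF assms] mpoly_eval_conv_meval[of "diag_subst b F"]
  by (rule meval_diag_subst)

text \<open>Chain rule for a diagonal substitution, checked monomial by monomial: when the variable
  occurs, one factor \<open>b i\<close> splits off the monomial value; otherwise both sides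
  vanish.\<close>

lemma mpoly_eval_deriv_diag_subst:
  fixes F :: "'a::field mpoly"
  assumes "homogeneous n d F"
  shows "mpoly_eval (mpoly_deriv i (diag_subst b F)) v = b i * mpoly_eval (mpoly_deriv i F) (diag_act n b v)"
proof -
  have term_eq: "of_nat (Poly_Mapping.lookup e i) * monom_eval b e * monom_eval x (e - Poly_Mapping.single i 1) =
      b i * (of_nat (Poly_Mapping.lookup e i) * monom_eval (\<lambda>i. b i * x i) (e - Poly_Mapping.single i 1))"
    for e and x :: "nat \<Rightarrow> 'a"
  proof (cases "Poly_Mapping.lookup e i = 0")
    case False
    have "e = Poly_Mapping.single i 1 + (e - Poly_Mapping.single i 1)"
      using False by (intro poly_mapping_eqI) (auto simp: lookup_add lookup_minus lookup_single when_def)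
    hence "monom_eval b e = b i * monom_eval b (e - Poly_Mapping.single i 1)"
      by (metis monom_eval_add monom_eval_single power_one_right)
    thus ?thesis by (simp add: monom_eval_mult mult_ac)
  qed simp
  have "meval (\<lambda>c. c) x (mpoly_deriv i (diag_subst b F)) = (\<Sum>e\<in>Poly_Mapping.keys F.
      of_nat (Poly_Mapping.lookup e i) * Poly_Mapping.lookup (diag_subst b F) e *
        monom_eval x (e - Poly_Mapping.single i 1))" for x
    unfolding meval_mpoly_deriv
    by (intro sum.mono_neutral_left) (auto simp: in_keys_iff lookup_diag_subst)
  also have "\<dots> x = b i * meval (\<lambda>c. c) (\<lambda>i. b i * x i) (mpoly_deriv i F)" for x
    unfolding meval_mpoly_deriv sum_distrib_left lookup_diag_subst
  proof (intro sum.cong refl)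
    fix e
    show "of_nat (Poly_Mapping.lookup e i) * (Poly_Mapping.lookup F e * monom_eval b e) *
           monom_eval x (e - Poly_Mapping.single i 1) =
         b i * (of_nat (Poly_Mapping.lookup e i) * Poly_Mapping.lookup F e *
           monom_eval (\<lambda>i. b i * x i) (e - Poly_Mapping.single i 1))"
      using arg_cong[OF term_eq[of e x], of "\<lambda>y. Poly_Mapping.lookup F e * y"] by (simp add: mult_ac)
  qed
  finally have "meval (\<lambda>c. c) x (mpoly_deriv i (diag_subst b F)) =
      b i * meval (\<lambda>c. c) (\<lambda>i. b i * x i) (mpoly_deriv i F)" for x .
  thus ?thesis
    unfolding diag_act_def mpoly_eval_vec[OF homogeneous_mpoly_deriv[OF assms]]
    unfolding mpoly_eval_conv_meval by simp
qed

lemma diag_act_coord_vecs: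
  "(\<And>i. i \<le> n \<Longrightarrow> b i \<noteq> 0) \<Longrightarrow> v \<in> coord_vecs n \<Longrightarrow> diag_act n b v \<in> coord_vecs n"
  by (auto simp: diag_act_def coord_vecs_iff)

lemma nonsingular_diag_subst:
  assumes F: "homogeneous n d F" "nonsingular n F" and b: "\<And>i. i \<le> n \<Longrightarrow> b i \<noteq> 0"
  shows "nonsingular n (diag_subst b F)"
  unfolding nonsingular_def
proof (intro ballI impI)
  fix v assume v: "v \<in> coord_vecs n" "mpoly_eval (diag_subst b F) v = 0"
  hence "mpoly_eval F (diag_act n b v) = 0" by (simp add: mpoly_eval_diag_subst[OF F(1)])
  from F(2)[unfolded nonsingular_def, rule_format, OF diag_act_coord_vecs[OF b v(1)] this]
  obtain i where i: "i \<le> n" "mpoly_eval (mpoly_deriv i F) (diag_act n b v) \<noteq> 0" by auto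
  have "mpoly_eval (mpoly_deriv i (diag_subst b F)) v \<noteq> 0"
    using i b[OF i(1)] by (simp add: mpoly_eval_deriv_diag_subst[OF F(1)])
  with i(1) show "\<exists>i\<le>n. mpoly_eval (mpoly_deriv i (diag_subst b F)) v \<noteq> 0" by blast
qed

definition diag_pt :: "nat \<Rightarrow> (nat \<Rightarrow> 'a::field) \<Rightarrow> 'a vec set \<Rightarrow> 'a vec set" where
  "diag_pt n b P = diag_act n b ` P"

lemma diag_pt_proj_pt:
  assumes v: "v \<in> coord_vecs n"
  shows "diag_pt n b (proj_pt v) = proj_pt (diag_act n b v)"
proof -
  have e: "diag_act n b (c \<cdot>\<^sub>v v) = c \<cdot>\<^sub>v diag_act n b v" for c
    using v by (auto simp: diag_act_def coord_vecs_iff intro!: eq_vecI)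
  show ?thesis unfolding diag_pt_def proj_pt_def setcompr_eq_image image_image e ..
qed

lemma diag_act_diag_act: "diag_act n b (diag_act n c v) = diag_act n (\<lambda>i. b i * c i) v"
  by (auto simp: diag_act_def intro!: eq_vecI)

lemma diag_pt_diag_pt: "diag_pt n b (diag_pt n c P) = diag_pt n (\<lambda>i. b i * c i) P"
  by (simp add: diag_pt_def image_image diag_act_diag_act)

lemma diag_pt_cong: "(\<And>i. i \<le> n \<Longrightarrow> b i = c i) \<Longrightarrow> diag_pt n b P = diag_pt n c P"
proof -
  assume "\<And>i. i \<le> n \<Longrightarrow> b i = c i"
  hence "diag_act n b = diag_act n c" by (auto simp: diag_act_def less_Suc_eq_le intro!: ext eq_vecI)
  thus ?thesis by (simp add: diag_pt_def)
qed

lemma diag_pt_one: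
  assumes "v \<in> coord_vecs n" "\<And>i. i \<le> n \<Longrightarrow> b i = 1"
  shows "diag_pt n b (proj_pt v) = proj_pt v"
proof -
  have "diag_act n b v = v" using assms by (auto simp: diag_act_def coord_vecs_iff less_Suc_eq_le intro!: eq_vecI)
  thus ?thesis by (simp add: diag_pt_proj_pt[OF assms(1)])
qed

lemma gal_pt_diag_pt:
  assumes s: "\<sigma> \<in> carrier Gal" and v: "v \<in> coord_vecs n"
  shows "gal_pt \<sigma> (diag_pt n b (proj_pt v)) = diag_pt n (\<lambda>i. \<sigma> (b i)) (gal_pt \<sigma> (proj_pt v))"
proof -
  interpret comm_ring_hom \<sigma> by (rule comm_ring_hom_Gal[OF s])
  have "map_vec \<sigma> (diag_act n b v) = diag_act n (\<lambda>i. \<sigma> (b i)) (map_vec \<sigma> v)"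
    using v by (auto simp: diag_act_def hom_mult coord_vecs_iff intro!: eq_vecI)
  thus ?thesis
    by (simp add: diag_pt_proj_pt v gal_pt_proj_pt[OF s] map_vec_coord_vecs[OF s v])
qed

text \<open>Links the action of a coset of matrices, by which automorphisms are described, to
  scaling of coordinates; the free scalars of matrix and vector merge into one.\<close>

lemma pgl_apply_mat_diag:
  assumes v: "v \<in> coord_vecs n"
  shows "pgl_apply (pgl_class n (mat_diag (Suc n) b)) (proj_pt v) = diag_pt n b (proj_pt v)"
proof -
  have mv: "mat_diag (Suc n) b' *\<^sub>v w = diag_act n b' w" if w: "dim_vec w = Suc n" for b' w
  proof (rule eq_vecI)
    fix i assume "i < dim_vec (diag_act n b' w)"
    hence i: "i < Suc n" by (simp add: diag_act_def)
    have "(mat_diag (Suc n) b' *\<^sub>v w) $ i = (\<Sum>j\<in>{0..<Suc n}. (if i = j then b' j else 0) * w $ j)"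
      using i w by (simp add: mat_diag_def scalar_prod_def del: sum.op_ivl_Suc)
    also have "\<dots> = (\<Sum>j\<in>{0..<Suc n}. if j = i then b' i * w $ i else 0)"
      by (intro sum.cong) auto
    finally show "(mat_diag (Suc n) b' *\<^sub>v w) $ i = diag_act n b' w $ i"
      using i by (simp add: diag_act_def del: sum.op_ivl_Suc)
  qed (simp add: diag_act_def mat_diag_def)
  have "(c \<cdot>\<^sub>m mat_diag (Suc n) b) *\<^sub>v (e \<cdot>\<^sub>v v) = (c * e) \<cdot>\<^sub>v diag_act n b v" for c e
  proof -
    have dim: "dim_vec v = Suc n" using v by (simp add: coord_vecs_iff)
    have "c \<cdot>\<^sub>m mat_diag (Suc n) b = mat_diag (Suc n) (\<lambda>i. c * b i)"
      by (rule eq_matI) (auto simp: mat_diag_def)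
    hence "(c \<cdot>\<^sub>m mat_diag (Suc n) b) *\<^sub>v (e \<cdot>\<^sub>v v) = diag_act n (\<lambda>i. c * b i) (e \<cdot>\<^sub>v v)"
      using dim by (simp add: mv)
    also have "\<dots> = (c * e) \<cdot>\<^sub>v diag_act n b v"
      using dim by (intro eq_vecI) (auto simp: diag_act_def)
    finally show ?thesis .
  qed
  note e = this
  have "pgl_apply (pgl_class n (mat_diag (Suc n) b)) (proj_pt v) = proj_pt (diag_act n b v)"
  proof
    show "pgl_apply (pgl_class n (mat_diag (Suc n) b)) (proj_pt v) \<subseteq> proj_pt (diag_act n b v)"
    proof
      fix x assume "x \<in> pgl_apply (pgl_class n (mat_diag (Suc n) b)) (proj_pt v)"
      then obtain c a where "c \<noteq> 0" "a \<noteq> 0" "x = (c \<cdot>\<^sub>m mat_diag (Suc n) b) *\<^sub>v (a \<cdot>\<^sub>v v)"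
        unfolding pgl_apply_def pgl_class_eq[OF mat_diag_dim] proj_pt_def by blast
      hence "x = (c * a) \<cdot>\<^sub>v diag_act n b v" "c * a \<noteq> 0" by (simp_all add: e)
      thus "x \<in> proj_pt (diag_act n b v)" unfolding proj_pt_def by blast
    qed
    show "proj_pt (diag_act n b v) \<subseteq> pgl_apply (pgl_class n (mat_diag (Suc n) b)) (proj_pt v)"
    proof
      fix x assume "x \<in> proj_pt (diag_act n b v)"
      then obtain c where c: "c \<noteq> 0" "x = c \<cdot>\<^sub>v diag_act n b v" unfolding proj_pt_def by blast
      have "x = (c \<cdot>\<^sub>m mat_diag (Suc n) b) *\<^sub>v (1 \<cdot>\<^sub>v v)" by (simp only: e c(2) mult_1_right)
      thus "x \<in> pgl_apply (pgl_class n (mat_diag (Suc n) b)) (proj_pt v)"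
        unfolding pgl_apply_def pgl_class_eq[OF mat_diag_dim] proj_pt_def using c(1) one_neq_zero by blast
    qed
  qed
  thus ?thesis by (simp add: diag_pt_proj_pt[OF v])
qed

lemma morphism_diag_pt:
  assumes b: "\<And>i. i \<le> n \<Longrightarrow> b i \<noteq> 0" and W: "\<And>P. P \<in> W \<Longrightarrow> diag_pt n b P \<in> W'"
  shows "morphism UNIV n W n W' (diag_pt n b)"
proof (rule morphismI)
  fix v assume v: "v \<in> coord_vecs n" "proj_pt v \<in> W"
  let ?G = "\<lambda>i. mpoly_const (b i) * mpoly_var i"
  have ev: "mpoly_eval (?G i) w = b i * w $ i" for i w
    by (simp add: mpoly_eval_conv_meval meval_id)
  have "homogeneous n 1 (?G i) \<and> coeffs_in UNIV (?G i)" if "i \<le> n" for i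
    using that by (auto simp: coeffs_in_def intro!: homogeneous_smult homogeneous_var[unfolded One_nat_def])
  moreover have "\<exists>i\<le>n. mpoly_eval (?G i) v \<noteq> 0" using v(1) b by (auto simp: ev coord_vecs_iff)
  moreover have "diag_pt n b (proj_pt w) = proj_pt (vec (Suc n) (\<lambda>i. mpoly_eval (?G i) w))"
    if "w \<in> coord_vecs n" for w
    unfolding ev diag_pt_proj_pt[OF that] by (simp add: diag_act_def)
  ultimately show "\<exists>e G. (\<forall>i\<le>n. homogeneous n e (G i) \<and> coeffs_in UNIV (G i)) \<and>
           (\<exists>i\<le>n. mpoly_eval (G i) v \<noteq> 0) \<and>
           (\<forall>w\<in>coord_vecs n. proj_pt w \<in> W \<and> (\<exists>i\<le>n. mpoly_eval (G i) w \<noteq> 0) \<longrightarrow>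
              diag_pt n b (proj_pt w) = proj_pt (vec (Suc n) (\<lambda>i. mpoly_eval (G i) w)))"
    by (intro exI[of _ 1] exI[of _ ?G]) blast
qed (rule W)

text \<open>
  A diagonal map that fixes all points of the hypersurface but is not the identity forces some
  \<open>X\<^sub>0 X\<^sub>i\<close> to vanish on it, so that both \<open>X\<^sub>0\<^sup>d\<^sup>-\<^sup>1 X\<^sub>i\<close> and \<open>X\<^sub>0 X\<^sub>i\<^sup>d\<^sup>-\<^sup>1\<close> are multiples of \<open>F\<close>.
\<close>

lemma diagonal_faithful:
  fixes F :: "'a::alg_closed_field mpoly"
  assumes F: "homogeneous n d F" "nonsingular n F" and n: "n \<ge> 1" and d: "d \<ge> 3"
    and b: "b 0 = 1" and i: "i \<le> n" "b i \<noteq> 1"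
  obtains v where "v \<in> coord_vecs n" "mpoly_eval F v = 0" "proj_pt (diag_act n b v) \<noteq> proj_pt v"
proof -
  have "\<exists>v\<in>coord_vecs n. mpoly_eval F v = 0 \<and> v $ 0 * v $ i \<noteq> 0"
  proof (rule ccontr)
    assume "\<not> ?thesis"
    hence van: "v $ 0 * v $ i = 0" if "v \<in> coord_vecs n" "mpoly_eval F v = 0" for v :: "'a vec" using that by blast
    define e where "e j k = Poly_Mapping.single 0 j + (Poly_Mapping.single i k :: nat \<Rightarrow>\<^sub>0 nat)" for j k
    define g where "g j k = (Poly_Mapping.single (e j k) 1 :: 'a mpoly)" for j k
    \<comment> \<open>The monomial contains both variables, so it vanishes wherever their product
      does, in particular on the hypersurface.\<close>
    have "\<exists>c. g j k = mpoly_const c * F" if jk: "j + k = d" "j \<ge> 1" "k \<ge> 1" for j k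
    proof -
      have "homogeneous n d (g j k)"
      proof -
        have "Poly_Mapping.keys (e j k) \<subseteq> {..n}"
          using keys_add[of "Poly_Mapping.single 0 j" "Poly_Mapping.single i k"] i(1)
          by (auto simp: e_def split: if_splits)
        moreover have "monom_deg (e j k) = d"
          unfolding e_def monom_deg_add using jk by (simp add: monom_deg_def)
        ultimately show ?thesis by (simp add: homogeneous_iff g_def)
      qed
      moreover have "mpoly_eval (g j k) v = 0" if "v \<in> coord_vecs n" "mpoly_eval F v = 0" for v
        using van[OF that] jk by (auto simp: mpoly_eval_conv_meval g_def e_def meval_id monom_eval_add)
      ultimately show ?thesis using form_vanishing_on_hypersurface[OF F(1) _ F(2) n, of "g j k"] d by fastforce
    qed
    from this[of "d - 1" 1] this[of 1 "d - 1"] d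
    obtain c1 c2 where c: "g (d - 1) 1 = mpoly_const c1 * F" "g 1 (d - 1) = mpoly_const c2 * F" by fastforce
    \<comment> \<open>Both monomials are multiples of F, hence proportional. They are distinct since
      d is at least 3, which forces the factor \<open>c2\<close> and with it a monomial to be
      0.\<close>
    have "mpoly_const c2 * g (d - 1) 1 = mpoly_const c1 * g 1 (d - 1)"
      unfolding c by (simp add: mult_ac)
    hence eq: "Poly_Mapping.single (e (d - 1) 1) c2 = Poly_Mapping.single (e 1 (d - 1)) c1"
      by (simp add: g_def mpoly_const_def mult_single)
    have i0: "i \<noteq> 0" using i(2) b by (cases "i = 0") simp_all
    have "e (d - 1) 1 \<noteq> e 1 (d - 1)"
    proof
      assume "e (d - 1) 1 = e 1 (d - 1)"
      from arg_cong[OF this, of "\<lambda>m. Poly_Mapping.lookup m 0"] show False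
        using i0 d by (simp add: e_def lookup_add lookup_single when_def)
    qed
    with arg_cong[OF eq, of "\<lambda>m. Poly_Mapping.lookup m (e (d - 1) 1)"] have "c2 = 0"
      by (simp add: lookup_single when_def)
    with c(2) have "g 1 (d - 1) = 0" by (simp add: mpoly_const_def)
    from arg_cong[OF this, of "\<lambda>m. Poly_Mapping.lookup m (e 1 (d - 1))"] show False by (simp add: g_def)
  qed
  then obtain v :: "'a vec" where v: "v \<in> coord_vecs n" "mpoly_eval F v = 0" "v $ 0 \<noteq> 0" "v $ i \<noteq> 0" by auto
  \<comment> \<open>The ratio of coordinate i to coordinate 0 is defined, non-zero, and multiplied
    by \<open>b i\<close>.\<close>
  have "proj_pt (diag_act n b v) \<noteq> proj_pt v"
  proof
    assume "proj_pt (diag_act n b v) = proj_pt v"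
    then obtain c where c: "diag_act n b v = c \<cdot>\<^sub>v v" by (rule proj_pt_eqE)
    have "b j * v $ j = c * v $ j" if "j \<le> n" for j
      using arg_cong[OF c, of "\<lambda>x. vec_index x j"] that v(1) by (auto simp: diag_act_def coord_vecs_iff)
    from this[of 0] this[of i] show False using v b i by simp
  qed
  with v that show ?thesis by blast
qed

section \<open>Twists\<close>

lemma nonsingular_nonzero:
  assumes "nonsingular n (F :: 'a::alg_closed_field mpoly)"
  shows "F \<noteq> 0"
proof
  assume F: "F = 0"
  have v: "vec (Suc n) (\<lambda>i. 1 :: 'a) \<in> coord_vecs n" by (auto simp: vec_coord_vecs)
  have "mpoly_eval (mpoly_deriv i F) w = 0" "mpoly_eval F w = 0" for i w
    by (simp_all add: F mpoly_deriv_def mpoly_eval_def)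
  with assms v show False unfolding nonsingular_def by blast
qed

lemma gal_pt_inv_comp:
  assumes "\<sigma> \<in> carrier Gal" "\<tau> \<in> carrier Gal"
  shows "gal_pt (inv_into UNIV (\<sigma> \<circ> \<tau>)) P = gal_pt (inv_into UNIV \<tau>) (gal_pt (inv_into UNIV \<sigma>) P)"
proof -
  have "inv_into UNIV (\<sigma> \<circ> \<tau>) = inv_into UNIV \<tau> \<circ> inv_into UNIV \<sigma>"
    using assms by (intro o_inv_distrib) (simp_all add: Gal_iff)
  thus ?thesis by (simp add: gal_pt_comp)
qed

lemma hypersurface_closed:
  "homogeneous n d F \<Longrightarrow> coeffs_in base_field F \<Longrightarrow> zariski_closed base_field n (hypersurface n F)"
  unfolding zariski_closed_def hypersurface_def by (intro exI[of _ "{F}"]) auto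

text \<open>The automorphisms attached to the twist form a cocycle as maps on points; faithfulness
  of the diagonal action on V transfers this to the entries. The scalar in b finally makes the
  equation itself, and not merely its zero set, defined over k.\<close>

lemma twist_of_cyclic_diagonal:
  fixes F :: "'k::field alg_closure mpoly"
    and n d m N :: nat and \<zeta> :: "'k alg_closure" and a :: "nat \<Rightarrow> nat"
  defines "V \<equiv> hypersurface n F"
  assumes perf: "perfect TYPE('k)" and n: "n \<ge> 1" and d: "d \<ge> 3"
    and F: "homogeneous n d F" "coeffs_in base_field F" "nonsingular n F"
    and Aut: "Aut_subset_PGL n V"
    and \<zeta>: "\<zeta> ^ m = 1" "m > 0"
    and carr: "carrier (Aut_PGL n V) =
           generate (PGL n) {pgl_class n (mat_diag (Suc n) (\<lambda>i. if i = 0 then 1 else \<zeta> ^ a i))}"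
    and tw: "is_twist n V N W"
  obtains b where "\<And>i. b i \<noteq> 0" "coeffs_in base_field (diag_subst b F)"
    "isomorphic base_field N W n (hypersurface n (diag_subst b F))"
proof -
  have Wz: "zariski_closed base_field N W" using tw unfolding is_twist_def proj_variety_def by blast
  obtain \<phi> where \<phi>_iso: "isomorphism UNIV N W n V \<phi>"
    using tw unfolding is_twist_def isomorphic_def by blast
  hence \<phi>: "morphism UNIV N W n V \<phi>" unfolding isomorphism_def by (rule conjunct1)
  obtain \<gamma> where \<gamma>: "morphism UNIV n V N W \<gamma>" and inv: "\<forall>P\<in>W. \<gamma> (\<phi> P) = P" "\<forall>P\<in>V. \<phi> (\<gamma> P) = P"
    using \<phi>_iso unfolding isomorphism_def by blast
  have \<gamma>\<phi>: "\<gamma> (\<phi> P) = P" if "P \<in> W" for P using inv(1) that by blast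
  have \<phi>\<gamma>: "\<phi> (\<gamma> P) = P" if "P \<in> V" for P using inv(2) that by blast
  have Wg: "gal_pt \<sigma> P \<in> W" if "\<sigma> \<in> carrier Gal" "P \<in> W" for \<sigma> P
    by (rule zariski_closed_gal_pt[OF Wz that])
  have Vg: "gal_pt \<sigma> P \<in> V" if "\<sigma> \<in> carrier Gal" "P \<in> V" for \<sigma> P
    using zariski_closed_gal_pt[OF hypersurface_closed[OF F(1,2)] that(1)] that(2) unfolding V_def by blast
  have Vrep: "\<exists>v\<in>coord_vecs n. P = proj_pt v" if "P \<in> V" for P
    using that unfolding V_def hypersurface_def proj_zeros_def by blast
  have V_iff: "proj_pt v \<in> V \<longleftrightarrow> mpoly_eval F v = 0" if "v \<in> coord_vecs n" for v
    unfolding V_def by (rule proj_pt_in_hypersurface[OF that F(1)])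
  have \<phi>_in: "\<phi> P \<in> V" if "P \<in> W" for P by (rule morphism_in[OF \<phi> that])
  have \<gamma>_in: "\<gamma> P \<in> W" if "P \<in> V" for P by (rule morphism_in[OF \<gamma> that])
  have nz\<zeta>: "\<zeta> \<noteq> 0" using \<zeta> by (auto simp: power_0_left)
  define \<xi> where "\<xi> \<sigma> P = \<phi> (gal_pt \<sigma> (\<gamma> (gal_pt (inv_into UNIV \<sigma>) P)))" for \<sigma> P
  define E where "E j i = (if i = 0 then 1 else (\<zeta> ^ a i) ^ j)" for i j :: nat
  have E0: "E j 0 = 1" and Enz: "E j i \<noteq> 0" for i j using nz\<zeta> by (simp_all add: E_def)
  have "isomorphism UNIV n V n V (\<xi> \<sigma>)" if s: "\<sigma> \<in> carrier Gal" for \<sigma>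
    unfolding isomorphism_def
  proof (intro conjI exI ballI)
    note si = Gal_inv(1)[OF s]
    show "morphism UNIV n V n V (\<xi> \<sigma>)"
      unfolding \<xi>_def by (rule morphism_comp[OF morphism_conj[OF \<gamma> s Vg[OF si] Wg[OF s]] \<phi>])
    \<comment> \<open>The inverse reverses the order: first to W by \<open>\<gamma>\<close>, then
      the conjugate of \<open>\<phi>\<close>.\<close>
    show "morphism UNIV n V n V (\<lambda>Q. gal_pt \<sigma> (\<phi> (gal_pt (inv_into UNIV \<sigma>) (\<gamma> Q))))"
      by (rule morphism_comp[OF \<gamma> morphism_conj[OF \<phi> s Wg[OF si] Vg[OF s]]])
    fix P assume P: "P \<in> V"
    show "gal_pt \<sigma> (\<phi> (gal_pt (inv_into UNIV \<sigma>) (\<gamma> (\<xi> \<sigma> P)))) = P"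
      unfolding \<xi>_def using P s si by (simp add: \<gamma>\<phi> \<phi>\<gamma> Wg Vg \<gamma>_in gal_pt_inv)
    show "\<xi> \<sigma> (gal_pt \<sigma> (\<phi> (gal_pt (inv_into UNIV \<sigma>) (\<gamma> P)))) = P"
      unfolding \<xi>_def using P s si by (simp add: \<gamma>\<phi> \<phi>\<gamma> Wg Vg \<gamma>_in gal_pt_inv)
  qed
  note iso = this
  have "\<forall>\<sigma>\<in>carrier Gal. \<exists>j. j < m \<and> (\<forall>P\<in>V. \<xi> \<sigma> P = diag_pt n (E j) P)"
  proof
    fix \<sigma> :: "'k alg_closure \<Rightarrow> 'k alg_closure" assume s: "\<sigma> \<in> carrier Gal"
    obtain g where g: "g \<in> carrier (Aut_PGL n V)" "\<forall>P\<in>V. \<xi> \<sigma> P = pgl_apply g P"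
      using Aut[unfolded Aut_subset_PGL_def, rule_format, OF iso[OF s]] by blast
    obtain j where j: "j < m" "g = pgl_class n (mat_diag (Suc n) (\<lambda>i. if i = 0 then 1 else (\<zeta> ^ a i) ^ j))"
      using g(1) unfolding carr by (rule generate_diagonal_cyclic[OF \<zeta>])
    have gE: "g = pgl_class n (mat_diag (Suc n) (E j))" unfolding j(2) E_def ..
    have "\<xi> \<sigma> P = diag_pt n (E j) P" if P: "P \<in> V" for P
    proof -
      obtain v where v: "v \<in> coord_vecs n" "P = proj_pt v" using Vrep[OF P] by blast
      show ?thesis using g(2) P unfolding gE v(2) pgl_apply_mat_diag[OF v(1), symmetric] by blast
    qed
    with j(1) show "\<exists>j. j < m \<and> (\<forall>P\<in>V. \<xi> \<sigma> P = diag_pt n (E j) P)" by blast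
  qed
  then obtain J where J: "\<forall>\<sigma>\<in>carrier Gal. J \<sigma> < m \<and> (\<forall>P\<in>V. \<xi> \<sigma> P = diag_pt n (E (J \<sigma>)) P)"
    by (rule bchoice[THEN exE])
  define \<chi> where "\<chi> \<sigma> = E (J \<sigma>)" for \<sigma>
  have Jm: "J \<sigma> < m" and \<xi>\<chi>: "P \<in> V \<Longrightarrow> \<xi> \<sigma> P = diag_pt n (\<chi> \<sigma>) P"
    if "\<sigma> \<in> carrier Gal" for \<sigma> P
    using J that unfolding \<chi>_def by blast+
  have \<chi>0: "\<chi> \<sigma> 0 = 1" and \<chi>nz: "\<chi> \<sigma> i \<noteq> 0" for \<sigma> i by (simp_all add: \<chi>_def E0 Enz)
  \<comment> \<open>If f and g act alike on V, then g / f fixes V pointwise, and faithfulness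
    excludes any entry other than 1.\<close>
  have uniq: "f i = g i"
    if f: "f 0 = 1" "g 0 = 1" "\<And>i. f i \<noteq> 0" "\<And>P. P \<in> V \<Longrightarrow> diag_pt n f P = diag_pt n g P" and i: "i \<le> n"
    for f g i
  proof (rule ccontr)
    assume ne: "f i \<noteq> g i"
    let ?b = "\<lambda>i. inverse (f i) * g i"
    have b: "?b 0 = 1" "?b i \<noteq> 1" using f(1,2) f(3)[of i] ne by (auto simp: field_simps)
    obtain v where v: "v \<in> coord_vecs n" "mpoly_eval F v = 0" "proj_pt (diag_act n ?b v) \<noteq> proj_pt v"
      using diagonal_faithful[of n d F ?b i, OF F(1,3) n d b(1) i b(2)] by blast
    have "diag_pt n ?b (proj_pt v) = diag_pt n (\<lambda>i. inverse (f i)) (diag_pt n g (proj_pt v))"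
      by (simp add: diag_pt_diag_pt)
    also have "\<dots> = diag_pt n (\<lambda>i. inverse (f i)) (diag_pt n f (proj_pt v))"
      using f(4)[of "proj_pt v"] V_iff[OF v(1)] v(2) by simp
    also have "\<dots> = proj_pt v"
      unfolding diag_pt_diag_pt using f(3) by (intro diag_pt_one[OF v(1)]) simp
    finally show False using v(3) by (simp add: diag_pt_proj_pt[OF v(1)])
  qed
  have cocycle: "\<chi> (\<sigma> \<circ> \<tau>) i = \<chi> \<sigma> i * \<sigma> (\<chi> \<tau> i)"
    if s: "\<sigma> \<in> carrier Gal" and t: "\<tau> \<in> carrier Gal" and i: "i \<le> n" for \<sigma> \<tau> i
  proof (rule uniq)
    show "\<chi> (\<sigma> \<circ> \<tau>) 0 = 1" "\<chi> \<sigma> 0 * \<sigma> (\<chi> \<tau> 0) = 1" "\<chi> (\<sigma> \<circ> \<tau>) i \<noteq> 0" for i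
      using Gal_to_ac[OF s, of 1] by (simp_all add: \<chi>0 \<chi>nz)
    show "i \<le> n" by (rule i)
    fix P assume P: "P \<in> V"
    \<comment> \<open>With Q the preimage of P under conjugation by \<open>\<sigma>\<close>, the
      inner part of the composite is \<open>\<xi> \<tau> Q\<close>, and conjugating it conjugates
      the diagonal entries.\<close>
    define Q where "Q = gal_pt (inv_into UNIV \<sigma>) P"
    have Q: "Q \<in> V" "gal_pt \<sigma> Q = P"
      unfolding Q_def using Vg[OF Gal_inv(1)[OF s] P] by (simp_all add: gal_pt_inv[OF s])
    obtain v where v: "v \<in> coord_vecs n" "Q = proj_pt v" using Vrep[OF Q(1)] by blast
    have \<xi>Q: "\<xi> \<tau> Q \<in> V" unfolding \<xi>_def by (intro \<phi>_in Wg t \<gamma>_in Vg Gal_inv(1) Q(1))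
    have "diag_pt n (\<chi> (\<sigma> \<circ> \<tau>)) P = \<xi> (\<sigma> \<circ> \<tau>) P" by (rule \<xi>\<chi>[OF Gal_comp[OF s t] P, symmetric])
    also have "\<dots> = \<xi> \<sigma> (gal_pt \<sigma> (\<xi> \<tau> Q))"
      unfolding \<xi>_def gal_pt_inv_comp[OF s t] gal_pt_inv[OF s] gal_pt_comp Q_def[symmetric]
      using Q(1) t by (subst \<gamma>\<phi>) (auto intro!: Wg \<gamma>_in Vg Gal_inv(1))
    also have "\<dots> = diag_pt n (\<chi> \<sigma>) (gal_pt \<sigma> (\<xi> \<tau> Q))" by (rule \<xi>\<chi>[OF s Vg[OF s \<xi>Q]])
    also have "\<xi> \<tau> Q = diag_pt n (\<chi> \<tau>) Q" by (rule \<xi>\<chi>[OF t Q(1)])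
    also have "gal_pt \<sigma> (diag_pt n (\<chi> \<tau>) Q) = diag_pt n (\<lambda>i. \<sigma> (\<chi> \<tau> i)) P"
      unfolding v(2) gal_pt_diag_pt[OF s v(1)] unfolding v(2)[symmetric] Q(2) ..
    finally show "diag_pt n (\<chi> (\<sigma> \<circ> \<tau>)) P = diag_pt n (\<lambda>i. \<chi> \<sigma> i * \<sigma> (\<chi> \<tau> i)) P"
      unfolding diag_pt_diag_pt .
  qed
  \<comment> \<open>The exponents whose diagonal map is non-trivial. Each moves some point v of V;
    an automorphism fixing the coordinates of v and of \<open>\<gamma>\<close> at v also has
    \<open>\<xi> \<tau>\<close> fix v, so it cannot carry that exponent. Finitely many coordinates
    thus exclude all bad exponents.\<close>
  define bad where "bad = {j. j < m \<and> (\<exists>i\<le>n. E j i \<noteq> 1)}"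
  have "\<forall>j\<in>bad. \<exists>S. finite S \<and> (\<forall>\<tau>\<in>carrier Gal. (\<forall>s\<in>S. \<tau> s = s) \<longrightarrow> J \<tau> \<noteq> j)"
  proof
    fix j assume "j \<in> bad"
    then obtain i where i: "i \<le> n" "E j i \<noteq> 1" unfolding bad_def by blast
    obtain v where v: "v \<in> coord_vecs n" "mpoly_eval F v = 0" "proj_pt (diag_act n (E j) v) \<noteq> proj_pt v"
      using diagonal_faithful[of n d F "E j" i, OF F(1,3) n d E0 i] by blast
    have PV: "proj_pt v \<in> V" using V_iff[OF v(1)] v(2) by blast
    obtain u where u: "u \<in> coord_vecs N" "\<gamma> (proj_pt v) = proj_pt u"
      using morphism_rep[OF \<gamma> v(1) PV] by blast
    let ?S = "(\<lambda>i. v $ i) ` {..n} \<union> (\<lambda>i. u $ i) ` {..N}"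
    have "J \<tau> \<noteq> j" if t: "\<tau> \<in> carrier Gal" and fixed: "\<forall>s\<in>?S. \<tau> s = s" for \<tau>
    proof
      assume "J \<tau> = j"
      have tv: "map_vec \<tau> v = v" and tu: "map_vec \<tau> u = u"
        using fixed v(1) u(1) by (auto simp: coord_vecs_iff less_Suc_eq_le intro!: eq_vecI)
      have "map_vec (inv_into UNIV \<tau>) v = v" using map_vec_Gal_inv(2)[OF t, of v] tv by simp
      hence "\<xi> \<tau> (proj_pt v) = \<phi> (gal_pt \<tau> (proj_pt u))"
        by (simp add: \<xi>_def gal_pt_proj_pt[OF Gal_inv(1)[OF t]] u(2))
      also have "\<dots> = proj_pt v"
        using \<phi>\<gamma>[OF PV] by (simp add: gal_pt_proj_pt[OF t] tu u(2))
      finally have "diag_pt n (E j) (proj_pt v) = proj_pt v"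
        using \<xi>\<chi>[OF t PV] \<open>J \<tau> = j\<close> by (simp add: \<chi>_def)
      thus False using v(3) by (simp add: diag_pt_proj_pt[OF v(1)])
    qed
    thus "\<exists>S. finite S \<and> (\<forall>\<tau>\<in>carrier Gal. (\<forall>s\<in>S. \<tau> s = s) \<longrightarrow> J \<tau> \<noteq> j)"
      by (intro exI[of _ ?S]) blast
  qed
  then obtain S where S: "\<forall>j\<in>bad. finite (S j) \<and> (\<forall>\<tau>\<in>carrier Gal. (\<forall>s\<in>S j. \<tau> s = s) \<longrightarrow> J \<tau> \<noteq> j)"
    by (rule bchoice[THEN exE])
  have finS: "finite (\<Union>j\<in>bad. S j)"
    using S by (intro finite_UN_I) (simp_all add: bad_def)
  have cont: "\<chi> \<tau> i = 1"
    if t: "\<tau> \<in> carrier Gal" and fixed: "\<forall>s\<in>(\<Union>j\<in>bad. S j). \<tau> s = s" and i: "i \<le> n" for \<tau> i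
  proof -
    have "J \<tau> \<notin> bad"
    proof
      assume "J \<tau> \<in> bad"
      with S t fixed show False by blast
    qed
    thus ?thesis using Jm[OF t] i unfolding bad_def \<chi>_def by blast
  qed
  obtain B where B0: "B 0 = 1" and Bnz: "\<And>i. B i \<noteq> 0"
    and B: "\<And>\<sigma> i. \<sigma> \<in> carrier Gal \<Longrightarrow> i \<le> n \<Longrightarrow> \<chi> \<sigma> i * \<sigma> (B i) = B i"
    using diagonal_hilbert90[of \<chi> n "\<Union>j\<in>bad. S j", OF \<chi>nz \<chi>0 cocycle finS cont] by blast
  define F' where "F' = diag_subst B F"
  define V' where "V' = hypersurface n F'"
  have F': "homogeneous n d F'" "nonsingular n F'"
    unfolding F'_def using homogeneous_diag_subst[OF F(1)] nonsingular_diag_subst[OF F(1,3), of B] Bnz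
    by simp_all
  have V'_iff: "proj_pt v \<in> V' \<longleftrightarrow> mpoly_eval F (diag_act n B v) = 0" if "v \<in> coord_vecs n" for v
    unfolding V'_def proj_pt_in_hypersurface[OF that F'(1)]
    unfolding F'_def mpoly_eval_diag_subst[OF F(1)] ..
  have V'rep: "\<exists>v\<in>coord_vecs n. P = proj_pt v" if "P \<in> V'" for P
    using that unfolding V'_def hypersurface_def proj_zeros_def by blast
  let ?B' = "\<lambda>i. inverse (B i)"
  have cancel: "diag_pt n B (diag_pt n ?B' P) = P" "diag_pt n ?B' (diag_pt n B P) = P"
    if "\<exists>v\<in>coord_vecs n. P = proj_pt v" for P
  proof -
    obtain v where v: "v \<in> coord_vecs n" "P = proj_pt v" using \<open>\<exists>v\<in>coord_vecs n. P = proj_pt v\<close> by blast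
    show "diag_pt n B (diag_pt n ?B' P) = P" "diag_pt n ?B' (diag_pt n B P) = P"
      unfolding diag_pt_diag_pt v(2) using Bnz by (simp_all add: diag_pt_one[OF v(1)])
  qed
  have V'V: "diag_pt n B P \<in> V" if P: "P \<in> V'" for P
  proof -
    obtain v where v: "v \<in> coord_vecs n" "P = proj_pt v" using V'rep[OF P] by blast
    show ?thesis using P V'_iff[OF v(1)] V_iff[OF diag_act_coord_vecs[OF Bnz v(1)]]
      by (simp add: v(2) diag_pt_proj_pt[OF v(1)])
  qed
  have VV': "diag_pt n ?B' P \<in> V'" if P: "P \<in> V" for P
  proof -
    obtain v where v: "v \<in> coord_vecs n" "P = proj_pt v" using Vrep[OF P] by blast
    have w: "diag_act n ?B' v \<in> coord_vecs n" using Bnz by (intro diag_act_coord_vecs v(1)) simp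
    have "diag_act n B (diag_act n ?B' v) = v"
      unfolding diag_act_diag_act using v(1) Bnz by (intro eq_vecI) (auto simp: diag_act_def coord_vecs_iff)
    thus ?thesis using P V'_iff[OF w] V_iff[OF v(1)] by (simp add: v(2) diag_pt_proj_pt[OF v(1)])
  qed
  \<comment> \<open>The corrected isomorphism: composing with the inverse of B cancels the cocycle
    that prevents \<open>\<phi>\<close> from being equivariant.\<close>
  define f where "f P = diag_pt n ?B' (\<phi> P)" for P
  define g where "g Q = \<gamma> (diag_pt n B Q)" for Q
  have f: "morphism UNIV N W n V' f"
    unfolding f_def using Bnz by (intro morphism_comp[OF \<phi>] morphism_diag_pt VV') simp
  have g: "morphism UNIV n V' N W g"
    unfolding g_def using Bnz by (intro morphism_comp[OF _ \<gamma>] morphism_diag_pt V'V)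
  have gf: "g (f P) = P" if "P \<in> W" for P
    unfolding f_def g_def cancel(1)[OF Vrep[OF \<phi>_in[OF that]]] by (rule \<gamma>\<phi>[OF that])
  have fg: "f (g Q) = Q" if "Q \<in> V'" for Q
    unfolding f_def g_def \<phi>\<gamma>[OF V'V[OF that]] by (rule cancel(2)[OF V'rep[OF that]])
  have f_equiv: "f (gal_pt \<sigma> P) = gal_pt \<sigma> (f P)" if s: "\<sigma> \<in> carrier Gal" and P: "P \<in> W" for \<sigma> P
  proof -
    obtain v where v: "v \<in> coord_vecs n" "\<phi> P = proj_pt v" using Vrep[OF \<phi>_in[OF P]] by blast
    have "\<phi> (gal_pt \<sigma> P) = \<xi> \<sigma> (gal_pt \<sigma> (\<phi> P))"
      unfolding \<xi>_def gal_pt_inv[OF s] \<gamma>\<phi>[OF P] ..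
    also have "\<dots> = diag_pt n (\<chi> \<sigma>) (gal_pt \<sigma> (\<phi> P))" by (rule \<xi>\<chi>[OF s Vg[OF s \<phi>_in[OF P]]])
    finally have "f (gal_pt \<sigma> P) = diag_pt n (\<lambda>i. ?B' i * \<chi> \<sigma> i) (gal_pt \<sigma> (\<phi> P))"
      by (simp add: f_def diag_pt_diag_pt)
    \<comment> \<open>The relation \<open>\<chi> \<sigma> i * \<sigma> (B i) = B i\<close>,
      rewritten: the cocycle turns the inverse of B into its conjugate.\<close>
    also have "\<dots> = diag_pt n (\<lambda>i. \<sigma> (?B' i)) (gal_pt \<sigma> (\<phi> P))"
    proof (rule diag_pt_cong)
      fix i assume i: "i \<le> n"
      have "\<sigma> (B i) \<noteq> 0" using Bnz by (simp add: Gal_eq_0[OF s])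
      thus "?B' i * \<chi> \<sigma> i = \<sigma> (?B' i)"
        using B[OF s i] Bnz[of i] unfolding Gal_inverse[OF s] by (simp add: field_simps)
    qed
    also have "\<dots> = gal_pt \<sigma> (f P)" unfolding f_def v(2) by (rule gal_pt_diag_pt[OF s v(1), symmetric])
    finally show ?thesis .
  qed
  \<comment> \<open>F' is not yet known to be proportional to a form over k, so Galois stability of
    V' is transported from W along the equivariant bijection.\<close>
  have V'g: "gal_pt \<sigma> Q \<in> V'" and g_equiv: "g (gal_pt \<sigma> Q) = gal_pt \<sigma> (g Q)"
    if s: "\<sigma> \<in> carrier Gal" and Q: "Q \<in> V'" for \<sigma> Q
  proof -
    have gQ: "g Q \<in> W" "gal_pt \<sigma> (g Q) \<in> W" using morphism_in[OF g Q] Wg[OF s] by blast+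
    have e: "gal_pt \<sigma> Q = f (gal_pt \<sigma> (g Q))" using f_equiv[OF s gQ(1)] fg[OF Q] by simp
    show "gal_pt \<sigma> Q \<in> V'" unfolding e by (rule morphism_in[OF f gQ(2)])
    show "g (gal_pt \<sigma> Q) = gal_pt \<sigma> (g Q)" unfolding e by (rule gf[OF gQ(2)])
  qed
  have fk: "morphism base_field N W n V' f" by (rule morphism_descent[OF perf f Wg f_equiv])
  have gk: "morphism base_field n V' N W g" by (rule morphism_descent[OF perf g V'g g_equiv])
  have iso_k: "isomorphic base_field N W n V'"
    unfolding isomorphic_def isomorphism_def using fk gk gf fg by blast
  have conj_F': "\<exists>c. Poly_Mapping.map \<sigma> F' = mpoly_const c * F'" if s: "\<sigma> \<in> carrier Gal" for \<sigma>
  proof -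
    note si = Gal_inv(1)[OF s]
    have "homogeneous n d (Poly_Mapping.map \<sigma> F')"
      using F'(1) Gal_eq_0[OF s, of 0] by (intro homogeneous_map) simp_all
    moreover have "mpoly_eval (Poly_Mapping.map \<sigma> F') v = 0" if v: "v \<in> coord_vecs n" "mpoly_eval F' v = 0" for v
    proof -
      \<comment> \<open>The conjugated form vanishes at v exactly when F' vanishes at the inverse
        conjugate of v, which stays on V'.\<close>
      let ?w = "map_vec (inv_into UNIV \<sigma>) v"
      have w: "?w \<in> coord_vecs n" by (rule map_vec_coord_vecs[OF si v(1)])
      have "proj_pt v \<in> V'" unfolding V'_def using v proj_pt_in_hypersurface[OF v(1) F'(1)] by blast
      from V'g[OF si this] have "proj_pt ?w \<in> V'" unfolding gal_pt_proj_pt[OF si] .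
      hence "mpoly_eval F' ?w = 0" unfolding V'_def using proj_pt_in_hypersurface[OF w F'(1)] by blast
      moreover have "?w \<in> carrier_vec (Suc n)" using w by (simp add: coord_vecs_iff)
      ultimately show ?thesis
        using mpoly_eval_map_Gal[OF s F'(1), of ?w] by (simp add: map_vec_Gal_inv[OF s] Gal_eq_0[OF s])
    qed
    moreover have "d \<ge> 1" using d by simp
    ultimately obtain c where "Poly_Mapping.map \<sigma> F' = mpoly_const c * F'"
      using form_vanishing_on_hypersurface[OF F'(1) _ F'(2) n] by blast
    thus ?thesis by blast
  qed
  \<comment> \<open>All coefficients of F' are multiplied by the same scalar under conjugation, so
    dividing by one non-zero coefficient yields invariant quotients.\<close>
  obtain e where e: "Poly_Mapping.lookup F' e \<noteq> 0"
  proof -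
    have "\<exists>e. Poly_Mapping.lookup F' e \<noteq> 0"
    proof (rule ccontr)
      assume "\<not> ?thesis"
      hence "F' = 0" by (intro poly_mapping_eqI) simp
      thus False using nonsingular_nonzero[OF F'(2)] by blast
    qed
    thus ?thesis using that by blast
  qed
  \<comment> \<open>Scaling B by \<open>\<kappa>\<close> multiplies a form of degree d by
    \<open>\<kappa> ^ d\<close>. The d-th root realises the division by the chosen coefficient
    within the diagonal matrix.\<close>
  obtain \<kappa> where \<kappa>: "\<kappa> ^ d = inverse (Poly_Mapping.lookup F' e)"
    using nth_root_exists[of d "inverse (Poly_Mapping.lookup F' e)"] d by auto
  have \<kappa>nz: "\<kappa> \<noteq> 0"
  proof
    assume "\<kappa> = 0"
    thus False using \<kappa> e d by (simp add: power_0_left)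
  qed
  define b where "b i = \<kappa> * B i" for i
  have bnz: "b i \<noteq> 0" for i using Bnz \<kappa>nz by (simp add: b_def)
  have lookup_b: "Poly_Mapping.lookup (diag_subst b F) m =
      inverse (Poly_Mapping.lookup F' e) * Poly_Mapping.lookup F' m" for m
  proof (cases "m \<in> Poly_Mapping.keys F")
    case True
    hence "(\<Sum>i\<in>Poly_Mapping.keys m. Poly_Mapping.lookup m i) = d" using F(1) by (simp add: homogeneous_def)
    hence "monom_eval b m = inverse (Poly_Mapping.lookup F' e) * monom_eval B m"
      unfolding b_def monom_eval_smult_deg by (simp add: \<kappa>)
    thus ?thesis by (simp add: lookup_diag_subst F'_def)
  qed (simp add: lookup_diag_subst F'_def in_keys_iff)
  have "coeffs_in base_field (diag_subst b F)"
    unfolding coeffs_in_def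
  proof (intro allI fixed_field_Gal[OF perf])
    fix m :: "nat \<Rightarrow>\<^sub>0 nat" and \<sigma> :: "'k alg_closure \<Rightarrow> 'k alg_closure" assume s: "\<sigma> \<in> carrier Gal"
    interpret comm_ring_hom \<sigma> by (rule comm_ring_hom_Gal[OF s])
    obtain c where c: "Poly_Mapping.map \<sigma> F' = mpoly_const c * F'" using conj_F'[OF s] by blast
    have \<sigma>F': "\<sigma> (Poly_Mapping.lookup F' l) = c * Poly_Mapping.lookup F' l" for l
    proof -
      have "\<sigma> (Poly_Mapping.lookup F' l) = Poly_Mapping.lookup (mpoly_const c * F') l"
        unfolding c[symmetric] by (simp add: lookup_map_0[of \<sigma>, OF hom_zero])
      also have "\<dots> = c * Poly_Mapping.lookup F' l"
        by (simp add: mpoly_const_def Poly_Mapping.map.rep_eq when_def flip: mult_map_scale_conv_mult)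
      finally show ?thesis .
    qed
    have "c \<noteq> 0"
    proof
      assume "c = 0"
      with \<sigma>F'[of e] have "\<sigma> (Poly_Mapping.lookup F' e) = 0" by simp
      thus False using e by (simp add: Gal_eq_0[OF s])
    qed
    thus "\<sigma> (Poly_Mapping.lookup (diag_subst b F) m) = Poly_Mapping.lookup (diag_subst b F) m"
      unfolding lookup_b hom_mult Gal_inverse[OF s] \<sigma>F' using e by (simp add: field_simps)
  qed
  \<comment> \<open>Rescaling the matrix multiplies its equation by a non-zero constant and leaves
    the zero set alone.\<close>
  moreover have "hypersurface n (diag_subst b F) = V'"
  proof -
    have "mpoly_eval (diag_subst b F) v = 0 \<longleftrightarrow> mpoly_eval F' v = 0" if v: "v \<in> coord_vecs n" for v
    proof -
      have "diag_act n b v = \<kappa> \<cdot>\<^sub>v diag_act n B v" by (rule eq_vecI) (auto simp: diag_act_def b_def)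
      moreover have "diag_act n B v \<in> carrier_vec (Suc n)" by (simp add: diag_act_def)
      ultimately show ?thesis
        unfolding F'_def mpoly_eval_diag_subst[OF F(1)] using \<kappa>nz
        by (simp add: mpoly_eval_smult_vec[OF F(1)])
    qed
    thus ?thesis unfolding V'_def hypersurface_def proj_zeros_def by auto
  qed
  ultimately show ?thesis using iso_k bnz by (intro that[of b]) simp_all
qed

theorem theorem2p5:
  fixes F :: "'k::field alg_closure mpoly"
    and n d m :: nat
    and \<zeta> :: "'k alg_closure"
    and a :: "nat \<Rightarrow> nat"
  assumes "perfect TYPE('k)"
    and "n \<ge> 2" and "d \<ge> 4" and "(n, d) \<noteq> (3, 4)"
    and "homogeneous n d F" and "coeffs_in base_field F" and "nonsingular n F"
    and "Aut_subset_PGL n (hypersurface n F)"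
    and "m > 1" and "char_coprime TYPE('k) m" and "primitive_root_of_unity m \<zeta>"
    and "carrier (Aut_PGL n (hypersurface n F)) =
           generate (PGL n) {pgl_class n (mat_diag (Suc n) (\<lambda>i. if i = 0 then 1 else \<zeta> ^ a i))}"
    and "Coset.order (Aut_PGL n (hypersurface n F)) = m"
  shows "(\<forall>N W. is_twist n (hypersurface n F) N W \<longrightarrow> is_diagonal_twist n F N W) \<and>
         (\<forall>N W. is_twist n (hypersurface n F) N W \<longrightarrow>
            (\<exists>D. D \<in> carrier_mat (Suc n) (Suc n) \<and> invertible_mat D \<and> diagonal_mat D \<and>
               coeffs_in base_field (lin_subst D F) \<and> nonsingular n (lin_subst D F) \<and>
               isomorphic base_field N W n (hypersurface n (lin_subst D F)))) \<and>
         Sigma_map n ` H1 (Aut_PGL n (hypersurface n F)) gal_pgl = {H1_trivial (PGL n) gal_pgl}"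
proof -
  let ?V = "hypersurface n F"
  have \<zeta>: "\<zeta> ^ m = 1" "m > 0" using assms(11) by (simp_all add: primitive_root_of_unity_def)
  have twist: "\<exists>D. D \<in> carrier_mat (Suc n) (Suc n) \<and> invertible_mat D \<and> diagonal_mat D \<and>
      coeffs_in base_field (lin_subst D F) \<and> nonsingular n (lin_subst D F) \<and>
      isomorphic base_field N W n (hypersurface n (lin_subst D F))"
    if tw: "is_twist n ?V N W" for N W
  proof -
    have "n \<ge> 1" "d \<ge> 3" using assms(2,3) by simp_all
    then obtain b where b: "\<And>i. b i \<noteq> 0" "coeffs_in base_field (diag_subst b F)"
      "isomorphic base_field N W n (hypersurface n (diag_subst b F))"
      using twist_of_cyclic_diagonal[OF assms(1) _ _ assms(5-8) \<zeta> assms(12) tw] by blast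
    let ?D = "mat_diag (Suc n) b"
    obtain D' where "D' \<in> carrier_mat (Suc n) (Suc n)" "D' * ?D = 1\<^sub>m (Suc n)" "?D * D' = 1\<^sub>m (Suc n)"
      using mat_diag_in_GL[of n b] b(1) unfolding GL_carrier_iff by blast
    hence "invertible_mat ?D"
      unfolding invertible_mat_def inverts_mat_def by (auto simp: mat_diag_def)
    moreover have "diagonal_mat ?D" by (auto simp: diagonal_mat_def mat_diag_def)
    ultimately show ?thesis
      using b(2,3) nonsingular_diag_subst[OF assms(5,7), of b] b(1)
      by (intro exI[of _ ?D]) (simp add: lin_subst_mat_diag[OF assms(5)])
  qed
  moreover have "is_diagonal_twist n F N W" if tw: "is_twist n ?V N W" for N W
  proof -
    obtain D where D: "D \<in> carrier_mat (Suc n) (Suc n)" "invertible_mat D" "diagonal_mat D"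
      "coeffs_in base_field (lin_subst D F)" "isomorphic base_field N W n (hypersurface n (lin_subst D F))"
      using twist[OF tw] by blast
    \<comment> \<open>The rational matrix M in the definition of a diagonal twist is taken to be the
      identity.\<close>
    have "map_mat to_ac (1\<^sub>m (Suc n) :: 'k mat) = 1\<^sub>m (Suc n)" by (rule eq_matI) auto
    hence 1: "map_mat to_ac (1\<^sub>m (Suc n) :: 'k mat) * D = D" using D(1) by simp
    have "invertible_mat (1\<^sub>m (Suc n) :: 'k mat)"
      unfolding invertible_mat_def inverts_mat_def by (auto intro!: exI[of _ "1\<^sub>m (Suc n)"])
    with D tw show ?thesis unfolding is_diagonal_twist_def
      by (intro conjI exI[of _ "1\<^sub>m (Suc n)"] exI[of _ D]) (simp_all add: 1)
  qed
  \<comment> \<open>The two groups share the operations of PGL, so equality of carriers identifies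
    the whole structures.\<close>
  moreover have "Aut_PGL n ?V = (PGL n)\<lparr>carrier :=
      generate (PGL n) {pgl_class n (mat_diag (Suc n) (\<lambda>i. if i = 0 then 1 else \<zeta> ^ a i))}\<rparr>"
    unfolding assms(12)[symmetric] by (simp add: Aut_PGL_def)
  ultimately show ?thesis using Sigma_map_diagonal_trivial[OF \<zeta>, of n a] by simp
qed

end
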